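(* Let $p>1$, $\alpha\ge0$, and let $g$ be holomorphic on $\mathbb D$ such that $z\mapsto(1-z)g'(z)$ is bounded on $\mathbb D$ and extends continuously to a neighborhood of $1$ in $\overline{\mathbb D}$. Then the Volterra operator $V_g$ on $A^p_\alpha$, $V_g(f)(z)=\int_0^zf(w)g'(w)\,dw$, has essential norm $$\|V_g\|_{e}=\lim_{z\in\mathbb D,\,z\to1}|(1-z)g'(z)|\int_0^1t^{\frac{2+\alpha}{p}-1}\,dt .$$
   Context: $\mathbb D$ is the open unit disk in $\mathbb C$, $dA(x+iy)=dx\,dy/\pi$, $dA_\alpha(z)=(1+\alpha)(1-|z|^2)^\alpha dA(z)$, and $A^p_\alpha$ is the Banach space of holomorphic $f$ on $\mathbb D$ with $\|f\|^p=\int_{\mathbb D}|f|^p\,dA_\alpha<\infty$. The essential norm of a bounded operator $S$ on $A^p_\alpha$ is $\|S\|_e=\inf\{\|S-K\|:K \text{ compact on }A^p_\alpha\}$. Under the stated assumptions on $g$, $V_g$ is bounded on $A^p_\alpha$. *)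

theory Defs
  imports "HOL-Complex_Analysis.Complex_Analysis"
begin

abbreviation unit_disk :: "complex set" where
  "unit_disk \<equiv> ball 0 1"

text \<open>The measure \<open>dA\<^sub>\<alpha>\<close> on the disk; the factor \<open>1/\<pi>\<close> comes from \<open>dA = dx dy/\<pi>\<close>.\<close>

definition disk_measure :: "real \<Rightarrow> complex measure" where
  "disk_measure \<alpha> =
     density (restrict_space lborel unit_disk)
       (\<lambda>z. ennreal ((1 + \<alpha>) * (1 - (cmod z)\<^sup>2) powr \<alpha> / pi))"

text \<open>Functions on the disk are represented by their extension by zero to the plane, so that
  equality of elements of the space is equality of HOL functions.\<close>

definition bergman_space :: "real \<Rightarrow> real \<Rightarrow> (complex \<Rightarrow> complex) set" where
  "bergman_space p \<alpha> =
     {f. f holomorphic_on unit_disk \<and> (\<forall>z. z \<notin> unit_disk \<longrightarrow> f z = 0) \<and>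
         integrable (disk_measure \<alpha>) (\<lambda>z. cmod (f z) powr p)}"

definition bergman_norm :: "real \<Rightarrow> real \<Rightarrow> (complex \<Rightarrow> complex) \<Rightarrow> real" where
  "bergman_norm p \<alpha> f = (\<integral>z. cmod (f z) powr p \<partial>disk_measure \<alpha>) powr (1 / p)"

text \<open>An operator is a map on all of \<open>complex \<Rightarrow> complex\<close>, of which only the restriction to
  \<^const>\<open>bergman_space\<close> matters.\<close>

type_synonym fun_operator = "(complex \<Rightarrow> complex) \<Rightarrow> (complex \<Rightarrow> complex)"

definition bergman_linear :: "real \<Rightarrow> real \<Rightarrow> fun_operator \<Rightarrow> bool" where
  "bergman_linear p \<alpha> T \<longleftrightarrow>
     (\<forall>f\<in>bergman_space p \<alpha>. T f \<in> bergman_space p \<alpha>) \<and>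
     (\<forall>f\<in>bergman_space p \<alpha>. \<forall>h\<in>bergman_space p \<alpha>.
        T (\<lambda>z. f z + h z) = (\<lambda>z. T f z + T h z)) \<and>
     (\<forall>c. \<forall>f\<in>bergman_space p \<alpha>. T (\<lambda>z. c * f z) = (\<lambda>z. c * T f z))"

definition bergman_bounded :: "real \<Rightarrow> real \<Rightarrow> fun_operator \<Rightarrow> bool" where
  "bergman_bounded p \<alpha> T \<longleftrightarrow>
     bergman_linear p \<alpha> T \<and>
     (\<exists>C. \<forall>f\<in>bergman_space p \<alpha>. bergman_norm p \<alpha> (T f) \<le> C * bergman_norm p \<alpha> f)"

text \<open>Compactness: images of bounded sequences have subsequences converging in norm to an
  element of the space.\<close>

definition bergman_compact :: "real \<Rightarrow> real \<Rightarrow> fun_operator \<Rightarrow> bool" where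
  "bergman_compact p \<alpha> K \<longleftrightarrow>
     bergman_linear p \<alpha> K \<and>
     (\<forall>f :: nat \<Rightarrow> complex \<Rightarrow> complex.
        (\<forall>n. f n \<in> bergman_space p \<alpha>) \<and> (\<exists>C. \<forall>n. bergman_norm p \<alpha> (f n) \<le> C) \<longrightarrow>
        (\<exists>r h. strict_mono (r :: nat \<Rightarrow> nat) \<and> h \<in> bergman_space p \<alpha> \<and>
           (\<lambda>n. bergman_norm p \<alpha> (\<lambda>z. K (f (r n)) z - h z)) \<longlonglongrightarrow> 0))"

text \<open>Meaningful for bounded \<open>T\<close> only: otherwise the supremum is over an unbounded set.\<close>

definition bergman_opnorm :: "real \<Rightarrow> real \<Rightarrow> fun_operator \<Rightarrow> real" where
  "bergman_opnorm p \<alpha> T =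
     (SUP f\<in>{f \<in> bergman_space p \<alpha>. bergman_norm p \<alpha> f \<le> 1}. bergman_norm p \<alpha> (T f))"

definition essential_norm :: "real \<Rightarrow> real \<Rightarrow> fun_operator \<Rightarrow> real" where
  "essential_norm p \<alpha> S =
     (INF K\<in>{K. bergman_compact p \<alpha> K}. bergman_opnorm p \<alpha> (\<lambda>f z. S f z - K f z))"

text \<open>For \<open>f\<close> and \<open>g\<close> holomorphic on the disk the integrand is holomorphic there, so integrating
  along the segment is no restriction.\<close>

definition volterra :: "(complex \<Rightarrow> complex) \<Rightarrow> fun_operator" where
  "volterra g f z =
     (if z \<in> unit_disk then contour_integral (linepath 0 z) (\<lambda>w. f w * deriv g w) else 0)"

end

(* Along the semigroup phi_t(z) = t z / (1 - (1 - t) z) of self-maps of the disk, whose images are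
   horodisks at 1, the substitution w = phi_t(z) in the integral from 0 to z gives
     V_g f(z) = integral over t in [0,1] of (f M)(phi_t(z)) phi_t(z) dt / t,   M(z) = (1 - z) g'(z).
   After multiplying the symbol by a power z^m (m large), the t-th integrand has norm at most
   t^(gamma - 1) sup |M z^j|, gamma = (2 + alpha)/p, over the horodisk phi_t(D), which tends to
   L t^(gamma - 1) as j grows since the horodisk touches the unit circle at 1 only; the symbol
   (1 - z^m) g' is bounded, hence gives a compact operator.
   For the lower bound, functions (1 - z)^(-beta) with beta -> gamma are almost eigenfunctions, with
   eigenvalue 1/beta, for the symbol 1/(1 - z), and, normalized, they tend to 0 locally uniformly.
   A compact operator sends a subsequence of such functions to 0 in norm, by a gliding hump
   argument that uses p > 1. *)

theory Submission
  imports Defs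
begin

section \<open>Change of variables in the complex plane\<close>

text \<open>Why a power of z enters the upper bound: with w = phi_t(z) and D = |1 - (1 - t) z|, the
  change of variables from z to w costs the factor t^(-(2 + \<alpha>)) D^(4 + 2 \<alpha>) from
  Jacobian and weight. Since D <= t / |w|, multiplication by |w|^(4 + 2 \<alpha>) reduces the cost
  to t^(2 + \<alpha>), whose p-th root is the factor t^gamma. One part of the power of z pays for
  this; the other part makes the symbol small on a horodisk away from 1. For t near 1 the horodisks
  fill the disk and only boundedness of M is available, but these t form a short interval. The
  exponent gamma is critical: |1 - z|^(-gamma p) just fails to be integrable against the weight.
  Hence the norms of the test functions blow up as beta tends to gamma, while 1/beta tends to
  1/gamma, the integral of t^(gamma - 1). For a general symbol, c/(1 - z) is subtracted, c being the
  limit of M at 1. The difference has limit 0, and the upper estimate itself shows that it sends the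
  test functions to 0 in norm.\<close>

definition of_real2 :: "real^2 \<Rightarrow> complex" where
  "of_real2 x = Complex (x $ 1) (x $ 2)"

definition to_real2 :: "complex \<Rightarrow> real^2" where
  "to_real2 z = (\<chi> i. if i = 1 then Re z else Im z)"

lemma of_real2_inverse [simp]:
  "of_real2 (to_real2 z) = z" "to_real2 (of_real2 x) = x"
  by (auto simp: of_real2_def to_real2_def vec_eq_iff complex_eq_iff forall_2)

lemma bounded_linear_of_real2: "bounded_linear of_real2"
  unfolding linear_conv_bounded_linear[symmetric]
  by (rule linearI) (auto simp: of_real2_def complex_eq_iff)

lemma bounded_linear_to_real2: "bounded_linear to_real2"
  unfolding linear_conv_bounded_linear[symmetric]
  by (rule linearI) (auto simp: to_real2_def vec_eq_iff)

lemma continuous_of_real2: "continuous_on A of_real2"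
  by (rule linear_continuous_on[OF bounded_linear_of_real2])

lemma measurable_of_real2 [measurable]: "of_real2 \<in> borel_measurable borel"
  by (intro borel_measurable_continuous_onI continuous_of_real2)

text \<open>Identifies planar Lebesgue measure with the one on \<open>real^2\<close>, where
  matrices, determinants and the multidimensional change of variables live.\<close>

lemma lborel_complex_eq_distr: "(lborel :: complex measure) = distr lborel borel of_real2"
proof (rule lborel_eqI)
  fix l u :: complex
  assume le: "\<And>b. b \<in> Basis \<Longrightarrow> l \<bullet> b \<le> u \<bullet> b"
  have "of_real2 -` box l u = box (to_real2 l) (to_real2 u)"
    by (auto simp: mem_box Basis_complex_def of_real2_def to_real2_def Basis_vec_def
        inner_axis exhaust_2 forall_2)
  moreover have "to_real2 l \<bullet> b \<le> to_real2 u \<bullet> b" if "b \<in> Basis" for b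
    using that le[of 1] le[of \<i>]
    by (auto simp: Basis_complex_def to_real2_def Basis_vec_def inner_axis)
  ultimately have "emeasure (distr lborel borel of_real2) (box l u)
      = (\<Prod>b\<in>Basis. (to_real2 u - to_real2 l) \<bullet> b)"
    by (simp add: emeasure_distr emeasure_lborel_box)
  also have "(\<Prod>b\<in>Basis. (to_real2 u - to_real2 l) \<bullet> b) = (\<Prod>b\<in>Basis. (u - l) \<bullet> b)"
  proof -
    have B: "(Basis :: (real^2) set) = {axis 1 1, axis 2 1}"
      by (auto simp: Basis_vec_def) (metis exhaust_2)
    moreover have "axis 1 1 \<noteq> (axis 2 1 :: real^2)"
      by (simp add: axis_eq_axis)
    ultimately show ?thesis
      unfolding B by (simp add: Basis_complex_def inner_axis to_real2_def)
  qed
  finally show "emeasure (distr lborel borel of_real2) (box l u) = (\<Prod>b\<in>Basis. (u - l) \<bullet> b)" .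
qed simp

lemma nn_integral_of_real2:
  assumes [measurable]: "f \<in> borel_measurable borel"
  shows "(\<integral>\<^sup>+z. f z \<partial>lborel) = (\<integral>\<^sup>+x. f (of_real2 x) \<partial>lborel)"
  by (subst lborel_complex_eq_distr, subst nn_integral_distr) auto

text \<open>Multiplication by \<open>c\<close> is a rotation followed by a scaling with |c|. This
  makes |\<phi>'|^2 the Jacobian of a holomorphic map.\<close>

lemma det_complex_mult:
  "det (matrix (\<lambda>x. to_real2 (c * of_real2 x))) = (cmod c)\<^sup>2"
  by (simp add: det_2 matrix_def to_real2_def of_real2_def axis_def cmod_power2
      flip: power2_eq_square)

text \<open>Stated as an inequality of extended integrals so that no integrability has to be
  assumed: an infinite right side leaves nothing to show, and a finite one makes \<open>f\<close>
  absolutely integrable on the image, where the theorem on \<open>real^2\<close> applies.\<close>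

lemma nn_integral_change_of_variables_complex_le:
  fixes f :: "complex \<Rightarrow> real"
  assumes "open S" and der: "\<And>z. z \<in> S \<Longrightarrow> (\<phi> has_field_derivative \<phi>' z) (at z)"
    and inj: "inj_on \<phi> S"
    and f[measurable]: "f \<in> borel_measurable borel" and f0: "\<And>z. f z \<ge> 0"
  shows "(\<integral>\<^sup>+z. ennreal (indicator S z * ((cmod (\<phi>' z))\<^sup>2 * f (\<phi> z))) \<partial>lborel)
      \<le> (\<integral>\<^sup>+w. ennreal (indicator (\<phi> ` S) w * f w) \<partial>lborel)" (is "_ \<le> ?rhs")
proof (cases "?rhs < \<infinity>")
  case fin: True
  have hol: "\<phi> holomorphic_on S"
    using der \<open>open S\<close> holomorphic_on_open by blast
  have oS: "open (\<phi> ` S)"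
    using hol \<open>open S\<close> inj by (rule open_mapping_thm3)
  have [measurable]: "\<phi> ` S \<in> sets borel" "S \<in> sets borel"
    using oS \<open>open S\<close> by auto
  have dd: "deriv \<phi> z = \<phi>' z" if "z \<in> S" for z
    using der[OF that] by (rule DERIV_imp_deriv)
  have "continuous_on S \<phi>" "continuous_on S (deriv \<phi>)"
    using hol \<open>open S\<close> by (auto intro!: holomorphic_on_imp_continuous_on holomorphic_deriv)
  then have [measurable]: "(\<lambda>z. indicator S z *\<^sub>R \<phi> z) \<in> borel_measurable borel"
      "(\<lambda>z. indicator S z *\<^sub>R deriv \<phi> z) \<in> borel_measurable borel"
    by (auto intro!: borel_measurable_continuous_on_indicator)
  \<comment> \<open>Nothing is known of \<open>\<phi>\<close> outside \<open>S\<close>, so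
    measurability is shown for the extensions by zero; the outer indicator makes the two integrands
    equal.\<close>
  have "(\<lambda>z. indicator S z * ((cmod (indicator S z *\<^sub>R deriv \<phi> z))\<^sup>2 * f (indicator S z *\<^sub>R \<phi> z)))
       \<in> borel_measurable borel" by measurable
  also have "(\<lambda>z. indicator S z * ((cmod (indicator S z *\<^sub>R deriv \<phi> z))\<^sup>2 * f (indicator S z *\<^sub>R \<phi> z)))
      = (\<lambda>z. indicator S z * ((cmod (\<phi>' z))\<^sup>2 * f (\<phi> z)))"
    by (auto simp: indicator_def fun_eq_iff dd)
  finally have m1[measurable]: "(\<lambda>z. indicator S z * ((cmod (\<phi>' z))\<^sup>2 * f (\<phi> z)))
       \<in> borel_measurable borel" .
  define A where "A = of_real2 -` S"
  define g where "g = (\<lambda>x. to_real2 (\<phi> (of_real2 x)))"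
  define h where "h = (\<lambda>x. f (of_real2 x))"
  have [measurable]: "h \<in> borel_measurable borel"
    unfolding h_def by measurable
  have "open A"
    unfolding A_def using \<open>open S\<close> continuous_of_real2[of UNIV] continuous_on_open_vimage[of UNIV of_real2] 
    by auto
  have gA: "g ` A = of_real2 -` (\<phi> ` S)"
  proof (intro equalityI subsetI)
    fix x assume "x \<in> of_real2 -` (\<phi> ` S)"
    then obtain z where "z \<in> S" "of_real2 x = \<phi> z" by auto
    then have "x = g (to_real2 z)" "to_real2 z \<in> A"
      by (auto simp: g_def A_def) (metis of_real2_inverse(2))
    then show "x \<in> g ` A" by blast
  qed (auto simp: A_def g_def)
  have [measurable]: "g ` A \<in> sets borel"
    unfolding gA using measurable_sets[OF measurable_of_real2, of "\<phi> ` S"] by auto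
  let ?u = "\<lambda>x. (cmod (\<phi>' (of_real2 x)))\<^sup>2 * h (g x)"
  have rhs: "?rhs = (\<integral>\<^sup>+x\<in>g ` A. h x \<partial>lborel)"
    by (subst nn_integral_of_real2)
      (auto simp: gA h_def split: split_indicator intro!: nn_integral_cong)
  have lhs: "(\<integral>\<^sup>+z. ennreal (indicator S z * ((cmod (\<phi>' z))\<^sup>2 * f (\<phi> z))) \<partial>lborel)
     = (\<integral>\<^sup>+x. ennreal (?u x) * indicator A x \<partial>lborel)"
    by (subst nn_integral_of_real2)
      (auto simp: A_def g_def h_def split: split_indicator intro!: nn_integral_cong)
  have h0: "h x \<ge> 0" for x
    by (simp add: h_def f0)
  have finh: "(\<integral>\<^sup>+x\<in>g ` A. h x \<partial>lborel) < \<infinity>"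
    using fin by (simp add: rhs)
  have eqh: "(\<integral>\<^sup>+x\<in>g ` A. h x \<partial>lborel) = integral (g ` A) h"
    using finh h0 by (intro set_nn_integral_lborel_eq_integral) (auto simp: set_borel_measurable_def)
  have "(\<integral>\<^sup>+x\<in>g ` A. h x \<partial>lborel) = (\<integral>\<^sup>+x. ennreal (indicator (g ` A) x * h x) \<partial>lborel)"
    by (auto simp: indicator_def intro!: nn_integral_cong)
  then have "integrable lborel (\<lambda>x. indicator (g ` A) x * h x)"
    using finh h0 by (intro integrableI_nonneg) auto
  then have "h absolutely_integrable_on (g ` A)"
    by (simp add: set_integrable_def integrable_completion)
  moreover have "(g has_derivative (\<lambda>y. to_real2 (\<phi>' (of_real2 x) * of_real2 y))) (at x within A)"
    if "x \<in> A" for x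
    unfolding g_def
    using that der[of "of_real2 x"]
    by (intro bounded_linear.has_derivative[OF bounded_linear_to_real2])
       (auto simp: A_def has_field_derivative_def intro!: has_derivative_compose[OF bounded_linear_imp_has_derivative[OF bounded_linear_of_real2]])
  moreover have "inj_on g A"
    using inj unfolding g_def A_def inj_on_def by (metis of_real2_inverse vimageE)
  ultimately have *: "(\<lambda>x. vec (?u x) :: real^1) absolutely_integrable_on A \<and>
     integral A (\<lambda>x. vec (?u x) :: real^1) = vec (integral (g ` A) h)"
    using has_absolute_integral_change_of_variables[of A g
       "\<lambda>x y. to_real2 (\<phi>' (of_real2 x) * of_real2 y)"
       "\<lambda>x. vec (h x) :: real^1" "vec (integral (g ` A) h)"] \<open>open A\<close>
    by (simp add: det_complex_mult absolutely_integrable_on_1_iff integral_on_1_eq lebesgue_openin vec_def scaleR_vec_def)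
  then have "((\<lambda>x. ?u x) has_integral integral (g ` A) h) A"
    by (auto simp: absolutely_integrable_on_1_iff integral_on_1_eq has_integral_iff
        dest: set_lebesgue_integral_eq_integral)
  then show ?thesis
    unfolding lhs rhs eqh using h0
    by (subst nn_integral_has_integral_lebesgue') auto
next
  case False
  then have "?rhs = top"
    by (metis infinity_ennreal_def top.not_eq_extremum)
  then show ?thesis by simp
qed

section \<open>Integral inequalities and the Bergman norm\<close>

text \<open>Convexity of x^p, in the form that its graph lies above the tangent at \<open>a\<close>.
  Young's inequality for the product of x and a^(p - 1), with exponents p and p/(p - 1), is a
  rearrangement of it and covers a = 0 and x = 0 as well.\<close>

lemma powr_tangent_le:
  fixes a x p :: real
  assumes "p > 1" "a \<ge> 0" "x \<ge> 0"
  shows "a powr p + p * a powr (p - 1) * (x - a) \<le> x powr p"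
proof -
  define q where "q = p / (p - 1)"
  have q: "q > 1" "1 / p + 1 / q = 1" "(p - 1) * q = p"
    using assms by (auto simp: q_def field_simps)
  have "x * a powr (p - 1) \<le> x powr p / p + (a powr (p - 1)) powr q / q"
    using assms q by (intro Youngs_inequality) auto
  also have "(a powr (p - 1)) powr q / q = a powr p * (1 - 1 / p)"
  proof -
    have "1 / q = 1 - 1 / p" using q(2) by simp
    then show ?thesis unfolding powr_powr q(3) by (metis mult.right_neutral times_divide_eq_right)
  qed
  finally have "p * (x * a powr (p - 1)) \<le> p * (x powr p / p + a powr p * (1 - 1 / p))"
    using assms by (intro mult_left_mono) auto
  also have "\<dots> = x powr p + a powr p * (p - 1)"
    using assms by (simp add: field_simps)
  finally have "p * (x * a powr (p - 1)) \<le> x powr p + a powr p * (p - 1)" .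
  moreover have "a powr (p - 1) * a = a powr p"
    using assms by (cases "a = 0") (auto simp: powr_diff)
  ultimately show ?thesis
    by (simp add: algebra_simps)
qed

text \<open>The sum a + b is the mean of a/l and b/(1 - l) with weights l and 1 - l. Adding the
  tangent inequalities at a + b cancels the linear terms. The weight stays free: Minkowski's
  inequality takes the ratio of the norms, the argument for null sequences a value with prescribed
  first coefficient.\<close>

lemma add_powr_le:
  fixes a b l p :: real
  assumes "p > 1" "0 < l" "l < 1" "a \<ge> 0" "b \<ge> 0"
  shows "(a + b) powr p \<le> l powr (1 - p) * a powr p + (1 - l) powr (1 - p) * b powr p"
proof -
  define s where "s = a + b"
  have [simp]: "s \<ge> 0" using assms by (simp add: s_def)
  have 1: "l * (s powr p + p * s powr (p - 1) * (a / l - s)) \<le> l * (a / l) powr p"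
    using assms by (intro mult_left_mono powr_tangent_le) auto
  have 2: "(1 - l) * (s powr p + p * s powr (p - 1) * (b / (1 - l) - s)) \<le> (1 - l) * (b / (1 - l)) powr p"
    using assms by (intro mult_left_mono powr_tangent_le) auto
  have "l * (s powr p + p * s powr (p - 1) * (a / l - s))
      + (1 - l) * (s powr p + p * s powr (p - 1) * (b / (1 - l) - s))
      = s powr p + p * s powr (p - 1) * ((l * (a / l) + (1 - l) * (b / (1 - l))) - s)"
    by (simp add: algebra_simps)
  also have "(l * (a / l) + (1 - l) * (b / (1 - l))) - s = 0"
    using assms by (simp add: s_def)
  finally have "s powr p \<le> l * (a / l) powr p + (1 - l) * (b / (1 - l)) powr p"
    using 1 2 by simp
  also have "l * (a / l) powr p = l powr (1 - p) * a powr p"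
    using assms by (simp add: powr_divide powr_diff)
  also have "(1 - l) * (b / (1 - l)) powr p = (1 - l) powr (1 - p) * b powr p"
    using assms by (simp add: powr_divide powr_diff)
  finally show ?thesis by (simp add: s_def)
qed

text \<open>Jensen's inequality, by integrating the tangent at the mean of the norm of
  \<open>X\<close>.\<close>

lemma norm_integral_powr_le:
  fixes X :: "'a \<Rightarrow> 'b::{banach,second_countable_topology}"
  assumes "emeasure M (space M) = 1" "p > 1" and [measurable]: "X \<in> borel_measurable M"
  shows "ennreal (norm (\<integral>x. X x \<partial>M) powr p) \<le> (\<integral>\<^sup>+x. ennreal (norm (X x) powr p) \<partial>M)"
proof (cases "integrable M X \<and> (\<integral>\<^sup>+x. ennreal (norm (X x) powr p) \<partial>M) < \<infinity>")
  \<comment> \<open>A non-integrable \<open>X\<close> has integral 0 by default, so the left side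
    vanishes; otherwise the right side is infinite.\<close>
  case False
  then show ?thesis
    using not_integrable_integral_eq[of M X] by (auto simp flip: top.not_eq_extremum)
next
  case True
  interpret finite_measure M
    by (rule finite_measureI) (simp add: assms)
  have [simp]: "measure M (space M) = 1"
    using assms by (simp add: measure_def)
  have int: "integrable M (\<lambda>x. norm (X x))" "integrable M (\<lambda>x. norm (X x) powr p)"
    using True by (auto intro!: integrableI_nonneg)
  define a where "a = (\<integral>x. norm (X x) \<partial>M)"
  have "a \<ge> 0" by (simp add: a_def)
  have "a powr p = (\<integral>x. a powr p + p * a powr (p - 1) * (norm (X x) - a) \<partial>M)"
    using int(1) by (simp add: a_def)
  also have "\<dots> \<le> (\<integral>x. norm (X x) powr p \<partial>M)"
    using int \<open>a \<ge> 0\<close> \<open>p > 1\<close> by (intro integral_mono powr_tangent_le) auto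
  finally have "norm (\<integral>x. X x \<partial>M) powr p \<le> (\<integral>x. norm (X x) powr p \<partial>M)"
    using integral_norm_bound[of M X] \<open>p > 1\<close> powr_mono2[of p "norm (\<integral>x. X x \<partial>M)" a]
    by (auto simp: a_def)
  also have "ennreal (\<integral>x. norm (X x) powr p \<partial>M) = (\<integral>\<^sup>+x. ennreal (norm (X x) powr p) \<partial>M)"
    using int by (intro nn_integral_eq_integral[symmetric]) auto
  finally show ?thesis by (simp add: ennreal_leI)
qed

lemma Minkowski_powr:
  fixes f h :: "'a \<Rightarrow> 'b::{real_normed_vector,second_countable_topology}"
  assumes "p > 1" and [measurable]: "f \<in> borel_measurable M" "h \<in> borel_measurable M"
    and int: "integrable M (\<lambda>x. norm (f x) powr p)" "integrable M (\<lambda>x. norm (h x) powr p)"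
  shows "integrable M (\<lambda>x. norm (f x + h x) powr p)"
    and "(\<integral>x. norm (f x + h x) powr p \<partial>M) powr (1 / p)
       \<le> (\<integral>x. norm (f x) powr p \<partial>M) powr (1 / p) + (\<integral>x. norm (h x) powr p \<partial>M) powr (1 / p)"
proof -
  let ?S = "\<integral>x. norm (f x + h x) powr p \<partial>M"
  have le: "norm (f x + h x) powr p \<le> l powr (1 - p) * norm (f x) powr p + (1 - l) powr (1 - p) * norm (h x) powr p"
    if "0 < l" "l < 1" for l x
  proof -
    have "norm (f x + h x) powr p \<le> (norm (f x) + norm (h x)) powr p"
      using \<open>p > 1\<close> by (intro powr_mono2 norm_triangle_ineq) auto
    then show ?thesis using add_powr_le[of p l "norm (f x)" "norm (h x)"] \<open>p > 1\<close> that by auto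
  qed
  show int': "integrable M (\<lambda>x. norm (f x + h x) powr p)"
  proof (rule Bochner_Integration.integrable_bound)
    show "integrable M (\<lambda>x. (1/2) powr (1 - p) * norm (f x) powr p + (1 - 1/2) powr (1 - p) * norm (h x) powr p)"
      using int by auto
    show "AE x in M. norm (norm (f x + h x) powr p)
        \<le> norm ((1/2) powr (1 - p) * norm (f x) powr p + (1 - 1/2) powr (1 - p) * norm (h x) powr p)"
      using le[of "1/2"] by (intro AE_I2) auto
  qed auto
  define A B where "A = (\<integral>x. norm (f x) powr p \<partial>M) powr (1 / p)"
    and "B = (\<integral>x. norm (h x) powr p \<partial>M) powr (1 / p)"
  have AB: "(\<integral>x. norm (f x) powr p \<partial>M) = A powr p" "(\<integral>x. norm (h x) powr p \<partial>M) = B powr p" "A \<ge> 0" "B \<ge> 0"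
    using \<open>p > 1\<close> by (auto simp: A_def B_def powr_powr)
  have "?S powr (1 / p) \<le> A + B + 2 * e" if "e > 0" for e
  proof -
    \<comment> \<open>The added \<open>e\<close> keeps both numbers positive even if one of the
      norms is 0.\<close>
    define a b where "a = A + e" and "b = B + e"
    have ab: "a > 0" "b > 0" using AB that by (auto simp: a_def b_def)
    \<comment> \<open>The minimiser of l^(1 - p) a^p + (1 - l)^(1 - p) b^p, characterised by a/l =
      b/(1 - l); the minimum is (a + b)^p.\<close>
    define l where "l = a / (a + b)"
    have l: "0 < l" "l < 1" "1 - l = b / (a + b)" using ab by (auto simp: l_def field_simps)
    have "?S
       \<le> (\<integral>x. l powr (1 - p) * norm (f x) powr p + (1 - l) powr (1 - p) * norm (h x) powr p \<partial>M)"
      using int int' le[of l] l by (intro integral_mono) auto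
    also have "\<dots> = l powr (1 - p) * A powr p + (1 - l) powr (1 - p) * B powr p"
      using int by (simp add: AB)
    also have "\<dots> \<le> l powr (1 - p) * a powr p + (1 - l) powr (1 - p) * b powr p"
      using AB that \<open>p > 1\<close> by (intro add_mono mult_left_mono powr_mono2) (auto simp: a_def b_def)
    also have "\<dots> = a * (a + b) powr (p - 1) + b * (a + b) powr (p - 1)"
    proof -
      have "(x / s) powr (1 - p) * x powr p = x * s powr (p - 1)" if "x > 0" "s > 0" for x s :: real
      proof -
        have "(x / s) powr (1 - p) * x powr p = (x powr (1 - p) * x powr p) * inverse (s powr (1 - p))"
          using that by (simp add: powr_divide inverse_eq_divide)
        also have "x powr (1 - p) * x powr p = x" using that by (simp flip: powr_add)
        finally show ?thesis by (simp flip: powr_minus)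
      qed
      then show ?thesis unfolding l(3) unfolding l_def using ab by simp
    qed
    also have "\<dots> = (a + b) powr p"
      using ab powr_mult_base[of "a + b" "p - 1"] by (simp add: distrib_right)
    finally have "?S powr (1 / p) \<le> ((a + b) powr p) powr (1 / p)"
      using \<open>p > 1\<close> by (intro powr_mono2) auto
    then show ?thesis using ab \<open>p > 1\<close> by (simp add: powr_powr a_def b_def)
  qed
  then have "?S powr (1 / p) \<le> A + B + e" if "e > 0" for e
    using that by (metis field_sum_of_halves half_gt_zero mult_2)
  then show "?S powr (1 / p)
       \<le> (\<integral>x. norm (f x) powr p \<partial>M) powr (1 / p) + (\<integral>x. norm (h x) powr p \<partial>M) powr (1 / p)"
    unfolding A_def B_def by (rule field_le_epsilon)
qed

text \<open>The density of \<open>disk_measure\<close>, continued by zero, so that integrals run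
  over the whole plane with \<open>lborel\<close> and are accessible to the change of
  variables.\<close>

definition disk_weight :: "real \<Rightarrow> complex \<Rightarrow> real" where
  "disk_weight \<alpha> z = indicator unit_disk z * ((1 + \<alpha>) * (1 - (cmod z)\<^sup>2) powr \<alpha> / pi)"

text \<open>The p-th power of the norm as an extended number. It can be estimated before anything is
  known to be integrable, so one estimate yields both membership in the space and a norm
  bound.\<close>

definition bergman_mass :: "real \<Rightarrow> real \<Rightarrow> (complex \<Rightarrow> complex) \<Rightarrow> ennreal" where
  "bergman_mass p \<alpha> f = (\<integral>\<^sup>+z. ennreal (cmod (f z) powr p) \<partial>disk_measure \<alpha>)"

lemma disk_weight_nonneg: "\<alpha> \<ge> 0 \<Longrightarrow> disk_weight \<alpha> z \<ge> 0"
  by (simp add: disk_weight_def)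

section \<open>Integrals against the weighted measure of the disk\<close>

lemma disk_weight_measurable [measurable]: "disk_weight \<alpha> \<in> borel_measurable borel"
proof -
  have [measurable]: "(unit_disk :: complex set) \<in> sets borel" by simp
  have [measurable]: "(\<lambda>z :: complex. (1 - (cmod z)\<^sup>2) powr \<alpha>) \<in> borel_measurable borel"
    by measurable
  show ?thesis unfolding disk_weight_def[abs_def] by measurable
qed

lemma space_disk_measure [simp]: "space (disk_measure \<alpha>) = unit_disk"
  by (simp add: disk_measure_def space_restrict_space)

lemma measurable_disk_measure:
  "f \<in> borel_measurable (disk_measure \<alpha>) \<longleftrightarrow> f \<in> borel_measurable (restrict_space borel unit_disk)"
proof -
  have "sets (disk_measure \<alpha>) = sets (restrict_space borel unit_disk)"
    by (simp add: disk_measure_def sets_restrict_space)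
  then show ?thesis by (simp cong: measurable_cong_sets)
qed

lemma continuous_imp_measurable_disk_measure:
  "continuous_on unit_disk f \<Longrightarrow> f \<in> borel_measurable (disk_measure \<alpha>)"
  unfolding measurable_disk_measure by (rule borel_measurable_continuous_on_restrict)

lemma nn_integral_disk_measure:
  assumes "f \<in> borel_measurable (disk_measure \<alpha>)" "\<alpha> \<ge> 0"
  shows "(\<integral>\<^sup>+z. ennreal (f z) \<partial>disk_measure \<alpha>) = (\<integral>\<^sup>+z. ennreal (disk_weight \<alpha> z * f z) \<partial>lborel)"
proof -
  have m: "f \<in> borel_measurable (restrict_space lborel unit_disk)"
    using assms unfolding disk_measure_def by simp
  have "(\<lambda>z. ennreal ((1 + \<alpha>) * (1 - (cmod z)\<^sup>2) powr \<alpha> / pi)) \<in> borel_measurable (restrict_space lborel unit_disk)"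
    by (intro measurable_restrict_space1) measurable
  then have "(\<integral>\<^sup>+z. ennreal (f z) \<partial>disk_measure \<alpha>)
     = (\<integral>\<^sup>+z. ennreal ((1 + \<alpha>) * (1 - (cmod z)\<^sup>2) powr \<alpha> / pi) * ennreal (f z) \<partial>restrict_space lborel unit_disk)"
    unfolding disk_measure_def using m by (subst nn_integral_density) auto
  also have "\<dots> = (\<integral>\<^sup>+z. ennreal (disk_weight \<alpha> z * f z) \<partial>lborel)"
    using assms(2) by (subst nn_integral_restrict_space)
      (auto simp: disk_weight_def simp flip: ennreal_mult' split: split_indicator intro!: nn_integral_cong)
  finally show ?thesis .
qed

lemma bergman_mass_eq:
  assumes "continuous_on unit_disk f" "\<alpha> \<ge> 0" "p > 1"
  shows "bergman_mass p \<alpha> f = (\<integral>\<^sup>+z. ennreal (disk_weight \<alpha> z * cmod (f z) powr p) \<partial>lborel)"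
  unfolding bergman_mass_def
  using assms by (intro nn_integral_disk_measure continuous_imp_measurable_disk_measure continuous_on_powr' continuous_intros) auto

lemma disk_weight_le:
  assumes "\<alpha> \<ge> 0" shows "disk_weight \<alpha> z \<le> indicator unit_disk z * ((1 + \<alpha>) / pi)"
proof -
  have "(1 - (cmod z)\<^sup>2) powr \<alpha> \<le> 1 powr \<alpha>" if "cmod z < 1"
    using that assms by (intro powr_mono2) (auto simp: power_le_one)
  then show ?thesis
    using assms unfolding disk_weight_def
    by (auto split: split_indicator intro!: divide_right_mono mult_left_le)
qed

lemma emeasure_disk_measure_finite:
  assumes "\<alpha> \<ge> 0" shows "emeasure (disk_measure \<alpha>) unit_disk < \<infinity>"
proof -
  have "emeasure (disk_measure \<alpha>) unit_disk = (\<integral>\<^sup>+z. ennreal 1 \<partial>disk_measure \<alpha>)"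
    by simp
  also have "\<dots> = (\<integral>\<^sup>+z. ennreal (disk_weight \<alpha> z * 1) \<partial>lborel)"
    by (rule nn_integral_disk_measure) (auto simp: assms)
  also have "\<dots> \<le> (\<integral>\<^sup>+z. ennreal ((1 + \<alpha>) / pi) * indicator (unit_disk :: complex set) z \<partial>lborel)"
  proof (intro nn_integral_mono)
    fix z show "ennreal (disk_weight \<alpha> z * 1) \<le> ennreal ((1 + \<alpha>) / pi) * indicator unit_disk z"
      using disk_weight_le[OF assms, of z] disk_weight_nonneg[OF assms, of z]
      by (auto split: split_indicator intro: ennreal_leI)
  qed
  also have "\<dots> = ennreal ((1 + \<alpha>) / pi) * emeasure lborel (unit_disk :: complex set)"
    by (rule nn_integral_cmult_indicator) auto
  also have "\<dots> < \<infinity>"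
    using emeasure_lborel_ball_finite[of "0::complex" 1] by (simp add: ennreal_mult_less_top)
  finally show ?thesis .
qed

lemma bergman_space_iff:
  "f \<in> bergman_space p \<alpha> \<longleftrightarrow>
    f holomorphic_on unit_disk \<and> (\<forall>z. z \<notin> unit_disk \<longrightarrow> f z = 0) \<and> bergman_mass p \<alpha> f < \<infinity>"
proof -
  have "f \<in> borel_measurable (disk_measure \<alpha>)" if "f holomorphic_on unit_disk"
    using that by (intro continuous_imp_measurable_disk_measure holomorphic_on_imp_continuous_on)
  then show ?thesis
    unfolding bergman_space_def bergman_mass_def
    by (auto simp: integrable_iff_bounded)
qed

lemma bergman_norm_nonneg [simp]: "bergman_norm p \<alpha> f \<ge> 0"
  by (simp add: bergman_norm_def)

lemma bergman_norm_eq_mass: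
  assumes "continuous_on unit_disk f"
  shows "bergman_norm p \<alpha> f = enn2real (bergman_mass p \<alpha> f) powr (1 / p)"
proof -
  have [measurable]: "f \<in> borel_measurable (disk_measure \<alpha>)"
    using assms by (rule continuous_imp_measurable_disk_measure)
  show ?thesis
    unfolding bergman_norm_def bergman_mass_def by (subst integral_eq_nn_integral) auto
qed

lemma bergman_space_continuous: "f \<in> bergman_space p \<alpha> \<Longrightarrow> continuous_on unit_disk f"
  by (simp add: bergman_space_iff holomorphic_on_imp_continuous_on)

lemma bergman_mass_eq_norm:
  assumes "f \<in> bergman_space p \<alpha>" "p > 1"
  shows "bergman_mass p \<alpha> f = ennreal (bergman_norm p \<alpha> f powr p)"
  using assms bergman_norm_eq_mass[OF bergman_space_continuous[OF assms(1)], of p \<alpha>]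
  by (auto simp: bergman_space_iff powr_powr less_top)

lemma bergman_norm_leI:
  assumes "continuous_on unit_disk f" "bergman_mass p \<alpha> f \<le> ennreal (C powr p)" "C \<ge> 0" "p > 1"
  shows "bergman_norm p \<alpha> f \<le> C"
proof -
  have "enn2real (bergman_mass p \<alpha> f) \<le> C powr p"
    using assms enn2real_mono[OF assms(2)] by simp
  then have "enn2real (bergman_mass p \<alpha> f) powr (1 / p) \<le> (C powr p) powr (1 / p)"
    using assms by (intro powr_mono2) auto
  then show ?thesis using assms by (simp add: bergman_norm_eq_mass powr_powr)
qed

section \<open>The Bergman space as a normed space\<close>

lemma bergman_add:
  assumes "f \<in> bergman_space p \<alpha>" "h \<in> bergman_space p \<alpha>" "p > 1"
  shows "(\<lambda>z. f z + h z) \<in> bergman_space p \<alpha>"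
    and "bergman_norm p \<alpha> (\<lambda>z. f z + h z) \<le> bergman_norm p \<alpha> f + bergman_norm p \<alpha> h"
  using assms Minkowski_powr[of p f "disk_measure \<alpha>" h]
  by (auto simp: bergman_space_def bergman_norm_def continuous_imp_measurable_disk_measure
      holomorphic_on_imp_continuous_on intro: holomorphic_on_add)

lemma bergman_scale:
  assumes "f \<in> bergman_space p \<alpha>" "p > 1"
  shows "(\<lambda>z. c * f z) \<in> bergman_space p \<alpha>"
    and "bergman_norm p \<alpha> (\<lambda>z. c * f z) = cmod c * bergman_norm p \<alpha> f"
  using assms by (auto simp: bergman_space_def bergman_norm_def norm_mult powr_mult powr_powr
      intro!: holomorphic_intros)

lemma bergman_diff:
  assumes "f \<in> bergman_space p \<alpha>" "h \<in> bergman_space p \<alpha>" "p > 1"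
  shows "(\<lambda>z. f z - h z) \<in> bergman_space p \<alpha>"
    and "bergman_norm p \<alpha> (\<lambda>z. f z - h z) \<le> bergman_norm p \<alpha> f + bergman_norm p \<alpha> h"
  using bergman_add[OF assms(1) bergman_scale(1)[OF assms(2), of "-1"] assms(3)]
    bergman_scale(2)[OF assms(2), of "-1"] assms by auto

lemma bergman_zero [simp]: "(\<lambda>z. 0) \<in> bergman_space p \<alpha>" "bergman_norm p \<alpha> (\<lambda>z. 0) = 0"
  by (auto simp: bergman_space_def bergman_norm_def)

section \<open>Volterra operators and integration along paths\<close>

text \<open>Parametrised by the symbol that replaces g', because the proof alters the symbol (to z^m
  G, (1 - z^m) G, 1/(1 - z)) and never needs its primitive.\<close>

definition volterra_op :: "(complex \<Rightarrow> complex) \<Rightarrow> fun_operator" where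
  "volterra_op G f z =
     (if z \<in> unit_disk then contour_integral (linepath 0 z) (\<lambda>w. f w * G w) else 0)"

lemma volterra_eq_volterra_op: "volterra g = volterra_op (deriv g)"
  by (simp add: volterra_def volterra_op_def fun_eq_iff)

lemma volterra_op_primitive:
  assumes "f holomorphic_on unit_disk" "G holomorphic_on unit_disk"
  obtains F where "\<And>z. z \<in> unit_disk \<Longrightarrow> (F has_field_derivative f z * G z) (at z)"
    "\<And>z. z \<in> unit_disk \<Longrightarrow> volterra_op G f z = F z - F 0"
proof -
  have "(\<lambda>z. f z * G z) holomorphic_on unit_disk"
    using assms by (intro holomorphic_intros)
  then obtain F where F: "\<And>z. z \<in> unit_disk \<Longrightarrow> (F has_field_derivative f z * G z) (at z within unit_disk)"
    by (rule holomorphic_convex_primitive'[OF convex_ball open_ball]) blast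
  then have F': "(F has_field_derivative f z * G z) (at z)" if "z \<in> unit_disk" for z
    using that by (metis at_within_open open_ball)
  have "((\<lambda>w. f w * G w) has_contour_integral (F z - F 0)) (linepath 0 z)" if "z \<in> unit_disk" for z
  proof -
    have "closed_segment 0 z \<subseteq> unit_disk"
      using that by (intro closed_segment_subset) auto
    then show ?thesis
      using contour_integral_primitive[of unit_disk F "\<lambda>w. f w * G w" "linepath 0 z", OF F] by simp
  qed
  then show ?thesis using F' that[of F] by (simp add: volterra_op_def contour_integral_unique)
qed

text \<open>On the disk the integrand has a primitive, so the radius may be replaced by any
  differentiable path from 0 to \<open>z\<close>. It is used for the radius itself and for the
  orbits of the horodisk maps.\<close>

lemma volterra_op_has_integral_path:
  assumes "f holomorphic_on unit_disk" "G holomorphic_on unit_disk"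
    and path: "\<And>t. t \<in> {0..1} \<Longrightarrow> (q has_vector_derivative q' t) (at t within {0..1})"
      "\<And>t. t \<in> {0..1} \<Longrightarrow> q t \<in> unit_disk" "q 0 = 0" "q 1 = z"
  shows "((\<lambda>t. f (q t) * G (q t) * q' t) has_integral volterra_op G f z) {0..1}"
proof -
  obtain F where F: "\<And>z. z \<in> unit_disk \<Longrightarrow> (F has_field_derivative f z * G z) (at z)"
    "\<And>z. z \<in> unit_disk \<Longrightarrow> volterra_op G f z = F z - F 0"
    using volterra_op_primitive assms by blast
  have "((\<lambda>t. q' t * (f (q t) * G (q t))) has_integral ((F \<circ> q) 1 - (F \<circ> q) 0)) {0..1}"
    using path F(1)
    by (intro fundamental_theorem_of_calculus field_vector_diff_chain_within)
       (auto intro: has_field_derivative_at_within)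
  then show ?thesis using path F(2)[of z] path(2)[of 1] by (simp add: mult_ac)
qed

lemma volterra_op_has_field_derivative:
  assumes "f holomorphic_on unit_disk" "G holomorphic_on unit_disk" "z \<in> unit_disk"
  shows "(volterra_op G f has_field_derivative f z * G z) (at z)"
proof -
  obtain F where F: "\<And>z. z \<in> unit_disk \<Longrightarrow> (F has_field_derivative f z * G z) (at z)"
    "\<And>z. z \<in> unit_disk \<Longrightarrow> volterra_op G f z = F z - F 0"
    using volterra_op_primitive assms by blast
  have "((\<lambda>z. F z - F 0) has_field_derivative f z * G z) (at z)"
    using F(1)[OF assms(3)] by (auto intro!: derivative_eq_intros)
  then show ?thesis
    by (rule has_field_derivative_transform_within_open[OF _ open_ball[of 0 1] assms(3)])
      (use F(2) in simp)
qed

lemma volterra_op_holomorphic: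
  assumes "f holomorphic_on unit_disk" "G holomorphic_on unit_disk"
  shows "volterra_op G f holomorphic_on unit_disk"
  using volterra_op_has_field_derivative[OF assms] holomorphic_on_open[of unit_disk] by blast

lemma volterra_op_outside: "z \<notin> unit_disk \<Longrightarrow> volterra_op G f z = 0"
  by (auto simp: volterra_op_def)

text \<open>Jensen's inequality for the probability density \<open>\<omega> / W\<close>, applied to \<open>W \<Phi>\<^sub>t / \<omega> t\<close>,
  gives the integral form of Minkowski's inequality for a family with \<open>\<parallel>\<Phi>\<^sub>t\<parallel>\<close> of the order \<open>\<omega> t\<close>.\<close>

lemma nn_integral_powr_integral_le:
  fixes \<Phi> :: "real \<Rightarrow> complex \<Rightarrow> complex" and \<omega> c :: "real \<Rightarrow> real" and \<rho> :: "complex \<Rightarrow> real"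
  assumes p: "p > 1" and "open S"
    and rho: "\<rho> \<in> borel_measurable borel" "\<And>z. \<rho> z \<ge> 0" "\<And>z. z \<notin> S \<Longrightarrow> \<rho> z = 0"
    and cont: "continuous_on ({0<..<1} \<times> S) (\<lambda>(t, z). \<Phi> t z)"
    and cont1: "\<And>z. z \<in> S \<Longrightarrow> continuous_on {0..1} (\<lambda>t. \<Phi> t z)"
    and V: "\<And>z. z \<in> S \<Longrightarrow> ((\<lambda>t. \<Phi> t z) has_integral V z) {0..1}"
    and \<omega>: "continuous_on {0<..<1} \<omega>" "\<And>t. t \<in> {0<..<1} \<Longrightarrow> \<omega> t > 0" "(\<omega> has_integral W) {0..1}" "W > 0"
    and c: "\<And>t. t \<in> {0<..<1} \<Longrightarrow> c t \<ge> 0" "((\<lambda>t. \<omega> t * c t) has_integral I) {0..1}"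
    and bound: "\<And>t. t \<in> {0<..<1} \<Longrightarrow>
      (\<integral>\<^sup>+z. ennreal (\<rho> z * cmod (\<Phi> t z) powr p) \<partial>lborel) \<le> ennreal (\<omega> t powr p * c t)"
  shows "(\<integral>\<^sup>+z. ennreal (\<rho> z * cmod (V z) powr p) \<partial>lborel) \<le> ennreal (W powr (p - 1) * I)"
proof -
  let ?u = "\<lambda>x. \<omega> (fst x) powr (1 - p) * cmod (\<Phi> (fst x) (snd x)) powr p"
  let ?J = "{0<..<1} :: real set"
  have \<omega>': "\<omega> t \<ge> 0" "\<omega> t \<noteq> 0" if "0 < t" "t < 1" for t
    using \<omega>(2)[of t] that by auto
  have [measurable]: "S \<in> sets borel" using \<open>open S\<close> by auto
  note rho(1)[measurable]
  have "(\<lambda>t. indicator ?J t *\<^sub>R \<omega> t) \<in> borel_measurable borel"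
    by (intro borel_measurable_continuous_on_indicator \<omega>) auto
  then have m\<omega>[measurable]: "(\<lambda>t. indicator ?J t * \<omega> t) \<in> borel_measurable borel" by simp
  \<comment> \<open>A probability measure on the open unit interval. The endpoints are dropped
    because \<open>\<omega>\<close> is assumed continuous and positive only inside; the weight used
    later is a power of t that may be singular at 0.\<close>
  define \<nu> where "\<nu> = density lborel (\<lambda>t. ennreal (indicator ?J t * \<omega> t / W))"
  have int_open: "(f has_integral y) ?J \<longleftrightarrow> (f has_integral y) {0..1}" for f :: "real \<Rightarrow> real" and y
    using has_integral_Icc_iff_Ioo[of f y 0 1] by simp
  have "(\<omega> has_integral W) ?J" "((\<lambda>t. \<omega> t * c t) has_integral I) ?J"
    using \<omega>(3) c(2) by (simp_all add: int_open)
  have "emeasure \<nu> (space \<nu>) = (\<integral>\<^sup>+t. ennreal (indicator ?J t * \<omega> t / W) \<partial>lborel)"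
    unfolding \<nu>_def by (subst emeasure_density) auto
  also have "\<dots> = (\<integral>\<^sup>+t. ennreal (\<omega> t / W) * indicator ?J t \<partial>lborel)"
    by (intro nn_integral_cong) (auto split: split_indicator)
  also have "\<dots> = ennreal (W / W)"
    using \<omega>(2) \<open>W > 0\<close> \<open>(\<omega> has_integral W) ?J\<close>
    by (intro nn_integral_has_integral_lebesgue' has_integral_divide) (auto simp: \<omega>')
  finally have prob: "emeasure \<nu> (space \<nu>) = 1" using \<open>W > 0\<close> by simp
  \<comment> \<open>This is (\<omega>/W) |W \<Phi>/\<omega>|^p, the integrand on the right of
    Jensen's inequality, written with respect to dt.\<close>
  define h where "h = (\<lambda>t z. indicator ?J t * (W powr (p - 1) * (\<omega> t powr (1 - p) * cmod (\<Phi> t z) powr p)))"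
  have Vle: "ennreal (cmod (V z) powr p) \<le> (\<integral>\<^sup>+t. ennreal (h t z) \<partial>lborel)" if "z \<in> S" for z
  proof -
    \<comment> \<open>Dividing by the density makes \<open>V z\<close> the mean of \<open>X\<close>
      under \<open>\<nu>\<close>.\<close>
    define X where "X = (\<lambda>t. indicator ?J t *\<^sub>R (of_real (W / \<omega> t) * \<Phi> t z))"
    have cz: "continuous_on ?J (\<lambda>t. \<Phi> t z)"
      using cont1[OF that] by (rule continuous_on_subset) auto
    have mX[measurable]: "X \<in> borel_measurable borel"
      unfolding X_def using \<omega> cz
      by (intro borel_measurable_continuous_on_indicator continuous_intros)
         (auto simp: \<omega>')
    have "set_integrable lborel {0..1} (\<lambda>t. \<Phi> t z)"
      using cont1[OF that] by (rule borel_integrable_atLeastAtMost')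
    then have si: "set_integrable lborel ?J (\<lambda>t. \<Phi> t z)"
      by (rule set_integrable_subset) auto
    have "(\<integral>t. X t \<partial>\<nu>) = (\<integral>t. (indicator ?J t * \<omega> t / W) *\<^sub>R X t \<partial>lborel)"
      unfolding \<nu>_def using \<open>W > 0\<close> \<omega>(2)
      by (intro integral_density) (auto split: split_indicator simp: \<omega>' intro!: AE_I2)
    also have "\<dots> = (LINT t:?J|lborel. \<Phi> t z)"
      unfolding set_lebesgue_integral_def X_def using \<open>W > 0\<close> \<omega>(2)
      by (intro Bochner_Integration.integral_cong)
         (auto split: split_indicator simp: scaleR_conv_of_real \<omega>')
    also have "\<dots> = integral ?J (\<lambda>t. \<Phi> t z)"
      by (rule set_borel_integral_eq_integral(2)[OF si])
    also have "\<dots> = integral {0..1} (\<lambda>t. \<Phi> t z)"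
      by (simp add: integral_open_interval_real)
    also have "\<dots> = V z"
      using V[OF that] by (rule integral_unique)
    finally have "V z = (\<integral>t. X t \<partial>\<nu>)" ..
    then have "ennreal (cmod (V z) powr p) \<le> (\<integral>\<^sup>+t. ennreal (cmod (X t) powr p) \<partial>\<nu>)"
      using norm_integral_powr_le[OF prob p, of X] mX by (simp add: \<nu>_def)
    also have "\<dots> = (\<integral>\<^sup>+t. ennreal (indicator ?J t * \<omega> t / W) * ennreal (cmod (X t) powr p) \<partial>lborel)"
      unfolding \<nu>_def by (intro nn_integral_density) auto
    also have "\<dots> = (\<integral>\<^sup>+t. ennreal (h t z) \<partial>lborel)"
    proof (intro nn_integral_cong)
      fix t
      show "ennreal (indicator ?J t * \<omega> t / W) * ennreal (cmod (X t) powr p) = ennreal (h t z)"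
      proof (cases "t \<in> ?J")
        case True
        then have "\<omega> t > 0" using \<omega>(2) by auto
        then have "\<omega> t / W * (W / \<omega> t * cmod (\<Phi> t z)) powr p
            = W powr (p - 1) * (\<omega> t powr (1 - p) * cmod (\<Phi> t z) powr p)"
          using \<open>W > 0\<close> by (simp add: powr_mult powr_divide powr_diff)
        moreover have "cmod (X t) = W / \<omega> t * cmod (\<Phi> t z)"
          using True \<open>\<omega> t > 0\<close> \<open>W > 0\<close> by (simp add: X_def norm_mult norm_divide)
        ultimately show ?thesis
          using True \<open>\<omega> t > 0\<close> \<open>W > 0\<close> by (simp add: h_def flip: ennreal_mult')
      qed (auto simp: h_def)
    qed
    finally show ?thesis .
  qed
  \<comment> \<open>Joint continuity on the open set, followed by extension by zero, gives the joint
    measurability that Fubini's theorem asks for.\<close>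
  have "continuous_on (?J \<times> S) (\<lambda>x. ?u x)"
  proof (intro continuous_on_mult continuous_on_powr' continuous_on_norm continuous_on_const)
    show "continuous_on (?J \<times> S) (\<lambda>x. \<omega> (fst x))"
      by (rule continuous_on_compose2[OF \<omega>(1) continuous_on_fst[OF continuous_on_id]]) auto
    show "continuous_on (?J \<times> S) (\<lambda>x. \<Phi> (fst x) (snd x))"
      using cont by (simp add: case_prod_unfold)
  qed (use p in \<open>auto simp: \<omega>'\<close>)
  then have "(\<lambda>x. indicator (?J \<times> S) x *\<^sub>R ?u x)
      \<in> borel_measurable borel"
    by (intro borel_measurable_continuous_on_indicator) (auto intro!: borel_open open_Times \<open>open S\<close>)
  then have "(\<lambda>x. indicator (?J \<times> S) x *\<^sub>R ?u x)
      \<in> borel_measurable (lborel \<Otimes>\<^sub>M lborel)"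
    by (simp add: lborel_prod)
  then have "(\<lambda>x. \<rho> (snd x) * (W powr (p - 1) *
      (indicator (?J \<times> S) x *\<^sub>R ?u x)))
      \<in> borel_measurable (lborel \<Otimes>\<^sub>M lborel)"
    by (intro borel_measurable_times[OF measurable_compose[OF measurable_snd]] borel_measurable_times[OF borel_measurable_const])
      (auto simp: rho)
  also have "(\<lambda>x. \<rho> (snd x) * (W powr (p - 1) *
      (indicator (?J \<times> S) x *\<^sub>R ?u x)))
      = (\<lambda>(t, z). \<rho> z * h t z)"
    using rho(3) by (auto simp: h_def fun_eq_iff indicator_def)
  finally have mh: "(\<lambda>(t, z). \<rho> z * h t z) \<in> borel_measurable (lborel \<Otimes>\<^sub>M lborel)" .
  have h0: "h t z \<ge> 0" for t z by (simp add: h_def)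
  have "(\<integral>\<^sup>+z. ennreal (\<rho> z * cmod (V z) powr p) \<partial>lborel) \<le> (\<integral>\<^sup>+z. \<integral>\<^sup>+t. ennreal (\<rho> z * h t z) \<partial>lborel \<partial>lborel)"
  proof (intro nn_integral_mono)
    fix z :: complex
    show "ennreal (\<rho> z * cmod (V z) powr p) \<le> (\<integral>\<^sup>+t. ennreal (\<rho> z * h t z) \<partial>lborel)"
    proof (cases "z \<in> S")
      case True
      have "(\<lambda>t. indicator ?J t *\<^sub>R (\<omega> t powr (1 - p) * cmod (\<Phi> t z) powr p)) \<in> borel_measurable borel"
      proof (intro borel_measurable_continuous_on_indicator continuous_on_mult continuous_on_powr'
          continuous_on_norm continuous_on_const)
        show "continuous_on ?J (\<lambda>t. \<Phi> t z)"
          using cont1[OF True] by (rule continuous_on_subset) auto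
      qed (use p \<omega>(1) in \<open>auto simp: \<omega>'\<close>)
      then have "(\<lambda>t. W powr (p - 1) * (indicator ?J t *\<^sub>R (\<omega> t powr (1 - p) * cmod (\<Phi> t z) powr p))) \<in> borel_measurable borel"
        by (rule borel_measurable_times[OF borel_measurable_const])
      also have "(\<lambda>t. W powr (p - 1) * (indicator ?J t *\<^sub>R (\<omega> t powr (1 - p) * cmod (\<Phi> t z) powr p)))
          = (\<lambda>t. h t z)"
        unfolding h_def by (intro ext) (simp only: real_scaleR_def mult.left_commute)
      finally have [measurable]: "(\<lambda>t. h t z) \<in> borel_measurable borel" .
      have "ennreal (\<rho> z * cmod (V z) powr p) = ennreal (\<rho> z) * ennreal (cmod (V z) powr p)"
        using rho by (simp add: ennreal_mult')
      also have "\<dots> \<le> ennreal (\<rho> z) * (\<integral>\<^sup>+t. ennreal (h t z) \<partial>lborel)"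
        by (intro mult_left_mono Vle True) auto
      also have "\<dots> = (\<integral>\<^sup>+t. ennreal (\<rho> z * h t z) \<partial>lborel)"
        using rho by (subst nn_integral_cmult[symmetric]) (auto simp: ennreal_mult')
      finally show ?thesis .
    qed (simp add: rho)
  qed
  also have "\<dots> = (\<integral>\<^sup>+t. \<integral>\<^sup>+z. ennreal (\<rho> z * h t z) \<partial>lborel \<partial>lborel)"
    using mh by (intro lborel_pair.Fubini') (simp add: case_prod_unfold)
  also have "\<dots> \<le> (\<integral>\<^sup>+t. ennreal (W powr (p - 1) * (\<omega> t * c t)) * indicator ?J t \<partial>lborel)"
  proof (intro nn_integral_mono)
    fix t :: real
    show "(\<integral>\<^sup>+z. ennreal (\<rho> z * h t z) \<partial>lborel) \<le> ennreal (W powr (p - 1) * (\<omega> t * c t)) * indicator ?J t"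
    proof (cases "t \<in> ?J")
      case True
      then have "\<omega> t > 0" using \<omega>(2) by auto
      have "continuous_on S (\<lambda>z. \<Phi> t z)"
      proof -
        have "continuous_on S (\<lambda>z. (t, z))"
          by (intro continuous_on_Pair continuous_on_const continuous_on_id)
        moreover have "(\<lambda>z. (t, z)) ` S \<subseteq> ?J \<times> S" using True by auto
        ultimately show ?thesis using continuous_on_compose2[OF cont] by fastforce
      qed
      then have "(\<lambda>z. indicator S z *\<^sub>R \<Phi> t z) \<in> borel_measurable borel"
        by (intro borel_measurable_continuous_on_indicator) auto
      then have "(\<lambda>z. \<rho> z * cmod (indicator S z *\<^sub>R \<Phi> t z) powr p) \<in> borel_measurable borel"
        by measurable
      also have "(\<lambda>z. \<rho> z * cmod (indicator S z *\<^sub>R \<Phi> t z) powr p) = (\<lambda>z. \<rho> z * cmod (\<Phi> t z) powr p)"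
        using rho(3) by (auto simp: indicator_def fun_eq_iff)
      finally have [measurable]: "(\<lambda>z. \<rho> z * cmod (\<Phi> t z) powr p) \<in> borel_measurable borel" .
      have "(\<integral>\<^sup>+z. ennreal (\<rho> z * h t z) \<partial>lborel)
         = (\<integral>\<^sup>+z. ennreal (W powr (p - 1) * \<omega> t powr (1 - p)) * ennreal (\<rho> z * cmod (\<Phi> t z) powr p) \<partial>lborel)"
        using True by (intro nn_integral_cong, subst ennreal_mult'[symmetric]) (auto simp: h_def mult_ac)
      also have "\<dots> = ennreal (W powr (p - 1) * \<omega> t powr (1 - p)) * (\<integral>\<^sup>+z. ennreal (\<rho> z * cmod (\<Phi> t z) powr p) \<partial>lborel)"
        by (rule nn_integral_cmult) auto
      also have "\<dots> \<le> ennreal (W powr (p - 1) * \<omega> t powr (1 - p)) * ennreal (\<omega> t powr p * c t)"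
        by (intro mult_left_mono bound True) auto
      also have "\<dots> = ennreal (W powr (p - 1) * (\<omega> t * c t))"
        using \<open>\<omega> t > 0\<close> by (subst ennreal_mult'[symmetric]) (auto simp: powr_diff)
      finally show ?thesis using True by simp
    qed (auto simp: h_def)
  qed
  also have "\<dots> = ennreal (W powr (p - 1) * I)"
    using c \<omega>(2) \<open>((\<lambda>t. \<omega> t * c t) has_integral I) ?J\<close>
    by (intro nn_integral_has_integral_lebesgue' has_integral_mult_right) (auto simp: \<omega>')
  finally show ?thesis .
qed

section \<open>Point evaluations and bounded symbols\<close>

text \<open>Cauchy's formula on the unit circle for the map from \<zeta> to f(a + w \<zeta>). The
  point \<open>w\<close> is complex, not a radius, so that the formula can afterwards be integrated
  over all \<open>w\<close> of a disk.\<close>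

lemma circle_mean_value:
  assumes "f holomorphic_on ball a r" "w \<in> ball 0 r"
  shows "((\<lambda>t. f (a + w * exp (2 * of_real pi * \<i> * of_real t))) has_integral f a) {0..1}"
proof -
  define h where "h = (\<lambda>\<zeta>. f (a + w * \<zeta>))"
  have "a + w * \<zeta> \<in> ball a r" if "cmod \<zeta> \<le> 1" for \<zeta>
  proof -
    have "cmod (w * \<zeta>) \<le> cmod w"
      using that by (simp add: norm_mult mult_left_le)
    then show ?thesis using assms(2) by (simp add: dist_norm)
  qed
  then have sub: "(\<lambda>\<zeta>. a + w * \<zeta>) ` cball 0 1 \<subseteq> ball a r" by auto
  have "h holomorphic_on cball 0 1"
    unfolding h_def
    using sub by (intro holomorphic_on_compose_gen[OF _ assms(1), unfolded o_def] holomorphic_intros)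
  then have "((\<lambda>u. h u / (u - 0)) has_contour_integral (2 * of_real pi * \<i> * h 0)) (circlepath 0 1)"
    by (intro Cauchy_integral_circlepath)
      (auto intro: holomorphic_on_imp_continuous_on holomorphic_on_subset)
  then have I: "((\<lambda>t. (2 * of_real pi * \<i>) * h (exp (2 * of_real pi * \<i> * of_real t)))
      has_integral ((2 * of_real pi * \<i>) * h 0)) {0..1}"
    unfolding has_contour_integral_def
    by (rule has_integral_eq[rotated], subst vector_derivative_circlepath01) (auto simp: circlepath)
  have "((\<lambda>t. h (exp (2 * of_real pi * \<i> * of_real t))) has_integral h 0) {0..1}"
  proof -
    have *: "inverse (2 * of_real pi * \<i>) * ((2 * of_real pi * \<i>) * x) = x" for x :: complex
      by (subst mult.assoc[symmetric], subst left_inverse) auto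
    show ?thesis
      using has_integral_mult_right[OF I, of "inverse (2 * of_real pi * \<i>)"] unfolding * .
  qed
  then show ?thesis by (simp add: h_def)
qed

text \<open>Subharmonicity of |f|^p without polar coordinates: for each \<open>w\<close> the value
  f(a) is the mean of f(a + w e(t)) over t. Integrating over \<open>w\<close> with constant \<omega>
  = 1 leaves, for each t, the integral of |f|^p over a rotated disk, which is the same disk.\<close>

lemma area_mean_value_powr_le:
  assumes "p > 1" "r > 0" and hol: "f holomorphic_on ball a r"
    and C: "(\<integral>\<^sup>+z. ennreal (indicator (ball a r) z * cmod (f z) powr p) \<partial>lborel) \<le> ennreal C" "C \<ge> 0"
  shows "cmod (f a) powr p * measure lborel (ball (0 :: complex) r) \<le> C"
proof -
  define e where "e = (\<lambda>t :: real. exp (2 * of_real pi * \<i> * of_real t))"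
  have e: "cmod (e t) = 1" "e t \<noteq> 0" for t
    by (simp_all add: e_def norm_exp_eq_Re)
  have ce: "continuous_on A e" for A
    unfolding e_def by (intro continuous_intros)
  have cf: "continuous_on (ball a r) f"
    using hol by (rule holomorphic_on_imp_continuous_on)
  have mem: "a + w * e t \<in> ball a r" if "w \<in> ball 0 r" for w t
    using that e by (simp add: dist_norm norm_mult)
  define F where "F = (\<lambda>z. indicator (ball a r) z *\<^sub>R f z)"
  have [measurable]: "F \<in> borel_measurable borel"
    unfolding F_def using cf by (intro borel_measurable_continuous_on_indicator) auto
  have [measurable]: "ball a r \<in> sets borel" by simp
  have mF: "(\<lambda>w. indicator (ball a r) w * cmod (F w) powr p) \<in> borel_measurable borel"
    by measurable
  have "(\<integral>\<^sup>+w. ennreal (indicator (ball (0 :: complex) r) w * cmod (f a) powr p) \<partial>lborel) \<le> ennreal (1 powr (p - 1) * C)"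
  proof (rule nn_integral_powr_integral_le[where \<Phi> = "\<lambda>t w. f (a + w * e t)" and \<omega> = "\<lambda>_. 1" and c = "\<lambda>_. C" and S = "ball 0 r"
        and V = "\<lambda>_. f a" and \<rho> = "indicator (ball 0 r)" and W = 1 and I = C])
    have "continuous_on ({0<..<1} \<times> ball 0 r) (\<lambda>x. f (a + snd x * e (fst x)))"
      by (rule continuous_on_compose2[OF cf]) (use mem in \<open>auto intro!: continuous_intros continuous_on_compose2[OF ce[of UNIV]]\<close>)
    then show "continuous_on ({0<..<1} \<times> ball 0 r) (\<lambda>(t, w). f (a + w * e t))"
      by (simp add: case_prod_unfold)
    show "continuous_on {0..1} (\<lambda>t. f (a + w * e t))" if "w \<in> ball 0 r" for w
      by (rule continuous_on_compose2[OF cf]) (use mem[OF that] in \<open>auto intro!: continuous_intros ce\<close>)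
    show "((\<lambda>t. f (a + w * e t)) has_integral f a) {0..1}" if "w \<in> ball 0 r" for w
      unfolding e_def using hol that by (rule circle_mean_value)
    show "((\<lambda>_. 1 :: real) has_integral 1) {0..1 :: real}" "((\<lambda>t. 1 * C) has_integral C) {0..1 :: real}"
      using has_integral_const_real[of "1 :: real" 0 1] has_integral_const_real[of C 0 1] by auto
    fix t :: real assume "t \<in> {0<..<1}"
    have "(\<integral>\<^sup>+z. ennreal (indicator (ball 0 r) z * cmod (f (a + z * e t)) powr p) \<partial>lborel)
       = (\<integral>\<^sup>+z. ennreal (indicator (ball 0 r) z * ((cmod (e t))\<^sup>2 *
            (indicator (ball a r) (a + z * e t) * cmod (F (a + z * e t)) powr p))) \<partial>lborel)"
      using mem e by (intro nn_integral_cong) (auto simp: F_def split: split_indicator)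
    also have "\<dots> \<le> (\<integral>\<^sup>+z. ennreal (indicator ((\<lambda>z. a + z * e t) ` ball 0 r) z *
           (indicator (ball a r) z * cmod (F z) powr p)) \<partial>lborel)"
      using e mF by (intro nn_integral_change_of_variables_complex_le)
        (auto intro!: derivative_eq_intros inj_onI split: split_indicator)
    also have "\<dots> \<le> (\<integral>\<^sup>+z. ennreal (indicator (ball a r) z * cmod (f z) powr p) \<partial>lborel)"
      by (intro nn_integral_mono ennreal_leI) (auto simp: F_def split: split_indicator)
    also have "\<dots> \<le> ennreal (1 powr p * C)" using C by simp
    finally show "(\<integral>\<^sup>+z. ennreal (indicator (ball 0 r) z * cmod (f (a + z * e t)) powr p) \<partial>lborel)
      \<le> ennreal (1 powr p * C)" .
  qed (use assms in \<open>auto split: split_indicator intro!: borel_measurable_indicator\<close>)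
  also have "(\<integral>\<^sup>+w. ennreal (indicator (ball (0 :: complex) r) w * cmod (f a) powr p) \<partial>lborel)
      = (\<integral>\<^sup>+w. ennreal (cmod (f a) powr p) * indicator (ball (0 :: complex) r) w \<partial>lborel)"
    by (intro nn_integral_cong) (auto split: split_indicator)
  also have "\<dots> = ennreal (cmod (f a) powr p) * emeasure lborel (ball (0 :: complex) r)"
    by (rule nn_integral_cmult_indicator) auto
  also have "\<dots> = ennreal (cmod (f a) powr p * measure lborel (ball (0 :: complex) r))"
    using emeasure_lborel_ball_finite[of "0 :: complex" r]
    by (simp add: emeasure_eq_ennreal_measure less_top ennreal_mult'' flip: top.not_eq_extremum)
  finally show ?thesis using \<open>C \<ge> 0\<close> by (simp add: ennreal_le_iff)
qed

lemma bergman_space_measurable: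
  assumes "f \<in> bergman_space p \<alpha>"
  shows "f \<in> borel_measurable borel"
proof -
  have "(\<lambda>z. indicator unit_disk z *\<^sub>R f z) \<in> borel_measurable borel"
    using bergman_space_continuous[OF assms] by (intro borel_measurable_continuous_on_indicator) auto
  also have "(\<lambda>z. indicator unit_disk z *\<^sub>R f z) = f"
    using assms by (auto simp: bergman_space_iff indicator_def fun_eq_iff)
  finally show ?thesis .
qed

text \<open>The area mean value property around \<open>a\<close>, on a disk where the weight is
  bounded below by a constant independent of \<open>a\<close>.\<close>

lemma bergman_point_bound:
  assumes "p > 1" "\<alpha> \<ge> 0" "R < 1"
  obtains C where "C \<ge> 0"
    "\<And>f a. f \<in> bergman_space p \<alpha> \<Longrightarrow> cmod a \<le> R \<Longrightarrow> cmod (f a) \<le> C * bergman_norm p \<alpha> f"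
proof -
  \<comment> \<open>Half the distance from the circle of radius \<open>R\<close> to the unit circle:
    disks of radius \<open>r\<close> around the points \<open>a\<close> stay inside |z| <= 1 - r,
    where the weight is at least \<open>\<kappa>\<close>.\<close>
  define r where "r = (1 - R) / 2"
  define \<kappa> where "\<kappa> = (1 + \<alpha>) * (1 - (1 - r)\<^sup>2) powr \<alpha> / pi"
  define m where "m = measure lborel (ball (0 :: complex) r)"
  define C where "C = (1 / (\<kappa> * m)) powr (1 / p)"
  have bd: "cmod (f a) \<le> C * bergman_norm p \<alpha> f" if f: "f \<in> bergman_space p \<alpha>" and a: "cmod a \<le> R" for f a
  proof -
    have "R \<ge> 0" using a norm_ge_zero[of a] by linarith
    then have r: "r > 0" "r \<le> 1/2" "R + r = 1 - r" using assms by (auto simp: r_def field_simps)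
    have "m > 0" using r content_ball_pos[of r "0 :: complex"] by (simp add: m_def)
    have "(1 - r)\<^sup>2 < 1" using r by (simp add: power_less_one_iff abs_less_iff)
    then have "\<kappa> > 0" using assms by (simp add: \<kappa>_def)
    have near: "cmod z \<le> 1 - r" if "z \<in> ball a r" for z
    proof -
      have "cmod z \<le> cmod a + dist a z" using norm_triangle_ineq2[of z a] by (simp add: dist_norm norm_minus_commute)
      then show ?thesis using that a r by simp
    qed
    then have sub: "ball a r \<subseteq> unit_disk" using r by force
    have wt: "\<kappa> * indicator (ball a r) z \<le> disk_weight \<alpha> z" for z
    proof (cases "z \<in> ball a r")
      case True
      then have "(cmod z)\<^sup>2 \<le> (1 - r)\<^sup>2" using near by (intro power_mono) auto
      then have "(1 - (1 - r)\<^sup>2) powr \<alpha> \<le> (1 - (cmod z)\<^sup>2) powr \<alpha>"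
        using \<open>(1 - r)\<^sup>2 < 1\<close> assms by (intro powr_mono2) auto
      then have "\<kappa> \<le> (1 + \<alpha>) * (1 - (cmod z)\<^sup>2) powr \<alpha> / pi"
        unfolding \<kappa>_def using assms by (intro divide_right_mono mult_left_mono) auto
      then show ?thesis using True sub by (auto simp: disk_weight_def)
    qed (auto simp: disk_weight_nonneg assms)
    have "(\<integral>\<^sup>+z. ennreal (indicator (ball a r) z * cmod (f z) powr p) \<partial>lborel)
        \<le> (\<integral>\<^sup>+z. ennreal (1 / \<kappa>) * ennreal (disk_weight \<alpha> z * cmod (f z) powr p) \<partial>lborel)"
    proof (intro nn_integral_mono)
      fix z
      have "indicator (ball a r) z * cmod (f z) powr p \<le> 1 / \<kappa> * (disk_weight \<alpha> z * cmod (f z) powr p)"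
        using mult_right_mono[OF wt[of z], of "cmod (f z) powr p"] \<open>\<kappa> > 0\<close> by (simp add: field_simps)
      then show "ennreal (indicator (ball a r) z * cmod (f z) powr p)
          \<le> ennreal (1 / \<kappa>) * ennreal (disk_weight \<alpha> z * cmod (f z) powr p)"
        using \<open>\<kappa> > 0\<close> by (simp add: ennreal_leI flip: ennreal_mult')
    qed
    also have "\<dots> = ennreal (1 / \<kappa>) * bergman_mass p \<alpha> f"
    proof -
      note bergman_space_measurable[OF f, measurable]
      show ?thesis
        using bergman_mass_eq[OF bergman_space_continuous[OF f], of \<alpha> p] assms by (simp add: nn_integral_cmult)
    qed
    also have "\<dots> = ennreal (1 / \<kappa> * bergman_norm p \<alpha> f powr p)"
      using bergman_mass_eq_norm[OF f] assms \<open>\<kappa> > 0\<close> by (simp flip: ennreal_mult')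
    finally have "cmod (f a) powr p * m \<le> 1 / \<kappa> * bergman_norm p \<alpha> f powr p"
      unfolding m_def using f sub r assms \<open>\<kappa> > 0\<close>
      by (intro area_mean_value_powr_le) (auto simp: bergman_space_iff intro: holomorphic_on_subset)
    then have "cmod (f a) powr p \<le> 1 / (\<kappa> * m) * bergman_norm p \<alpha> f powr p"
      using \<open>m > 0\<close> \<open>\<kappa> > 0\<close> by (simp add: field_simps)
    then have "(cmod (f a) powr p) powr (1 / p) \<le> (1 / (\<kappa> * m) * bergman_norm p \<alpha> f powr p) powr (1 / p)"
      using assms by (intro powr_mono2) auto
    then show ?thesis
      using assms \<open>m > 0\<close> \<open>\<kappa> > 0\<close> by (simp add: powr_powr powr_mult powr_divide C_def)
  qed
  show ?thesis
    by (rule that[of C]) (use bd in \<open>auto simp: C_def\<close>)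
qed


text \<open>The weight does not decrease when z is replaced by s z, and the Jacobian s^2 is at least
  1/4; hence the constant 4.\<close>

lemma nn_integral_dilation_le:
  assumes f: "f \<in> bergman_space p \<alpha>" and "p > 1" "\<alpha> \<ge> 0" "1 / 2 \<le> s" "s \<le> 1"
  shows "(\<integral>\<^sup>+z. ennreal (disk_weight \<alpha> z * cmod (f (of_real s * z)) powr p) \<partial>lborel)
     \<le> ennreal (4 * bergman_norm p \<alpha> f powr p)"
proof -
  note bergman_space_measurable[OF f, measurable]
  let ?F = "\<lambda>z. 4 * (disk_weight \<alpha> z * cmod (f z) powr p)"
  have "(\<integral>\<^sup>+z. ennreal (disk_weight \<alpha> z * cmod (f (of_real s * z)) powr p) \<partial>lborel)
     \<le> (\<integral>\<^sup>+z. ennreal (indicator unit_disk z * ((cmod (of_real s))\<^sup>2 * ?F (of_real s * z))) \<partial>lborel)"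
  proof (intro nn_integral_mono ennreal_leI)
    fix z :: complex
    show "disk_weight \<alpha> z * cmod (f (of_real s * z)) powr p
      \<le> indicator unit_disk z * ((cmod (of_real s))\<^sup>2 * ?F (of_real s * z))"
    proof (cases "z \<in> unit_disk")
      case True
      have "s * cmod z \<le> 1 * cmod z"
        using assms by (intro mult_right_mono) auto
      then have "(s * cmod z)\<^sup>2 \<le> (cmod z)\<^sup>2" "of_real s * z \<in> unit_disk"
        using assms True by (auto intro!: power_mono simp: norm_mult)
      moreover have "(cmod z)\<^sup>2 < 1" using True by (simp add: power_less_one_iff abs_less_iff)
      ultimately have "disk_weight \<alpha> z \<le> disk_weight \<alpha> (of_real s * z)"
        unfolding disk_weight_def using True assms
        by (auto intro!: divide_right_mono mult_left_mono powr_mono2 simp: norm_mult)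
      moreover have "1 \<le> 4 * s\<^sup>2"
        using power_mono[of "1/2" s 2] assms by (simp add: power2_eq_square)
      then have "disk_weight \<alpha> (of_real s * z) \<le> 4 * s\<^sup>2 * disk_weight \<alpha> (of_real s * z)"
        using mult_right_mono[of 1 "4 * s\<^sup>2"] disk_weight_nonneg assms by fastforce
      ultimately have "disk_weight \<alpha> z \<le> 4 * s\<^sup>2 * disk_weight \<alpha> (of_real s * z)" by linarith
      then have "disk_weight \<alpha> z * cmod (f (of_real s * z)) powr p
          \<le> 4 * s\<^sup>2 * disk_weight \<alpha> (of_real s * z) * cmod (f (of_real s * z)) powr p"
        by (rule mult_right_mono) auto
      then show ?thesis using True by (simp add: mult_ac)
    qed (auto simp: disk_weight_def)
  qed
  also have "\<dots> \<le> (\<integral>\<^sup>+z. ennreal (indicator ((\<lambda>z. of_real s * z) ` unit_disk) z * ?F z) \<partial>lborel)"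
    using assms by (intro nn_integral_change_of_variables_complex_le)
      (auto intro!: derivative_eq_intros inj_onI simp: disk_weight_nonneg)
  also have "\<dots> \<le> (\<integral>\<^sup>+z. ennreal 4 * ennreal (disk_weight \<alpha> z * cmod (f z) powr p) \<partial>lborel)"
    using assms by (intro nn_integral_mono, subst ennreal_mult'[symmetric])
      (auto split: split_indicator simp: disk_weight_nonneg intro!: ennreal_leI)
  also have "\<dots> = ennreal 4 * bergman_mass p \<alpha> f"
    using bergman_mass_eq[OF bergman_space_continuous[OF f], of \<alpha> p] assms by (simp add: nn_integral_cmult)
  also have "\<dots> = ennreal (4 * bergman_norm p \<alpha> f powr p)"
    using bergman_mass_eq_norm[OF f] assms by (subst ennreal_mult') auto
  finally show ?thesis .
qed

lemma has_integral_indicator_Icc: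
  fixes r :: real assumes "0 \<le> r" "r \<le> 1"
  shows "((\<lambda>s. indicator {r..1} s) has_integral (1 - r)) {0..1}"
proof -
  have "((\<lambda>s. if s \<in> {r..1} then 1 else 0) has_integral (1 - r)) {0..1}"
    using has_integral_const_real[of "1 :: real" r 1] assms
    by (subst has_integral_restrict) auto
  then show ?thesis
    by (simp add: indicator_def of_bool_def)
qed

text \<open>The radial integral is split at s = r. For s < r the function is evaluated only inside
  |z| <= r, where it is at most \<open>\<sigma>\<close>; for s >= r the dilation bound applies on an
  interval of length 1 - r. For a bounded sequence tending to 0 locally uniformly, the second term
  is made small by the choice of \<open>r\<close> and then the first by going far along the
  sequence.\<close>

lemma volterra_bounded_symbol_mass_le:
  assumes p: "p > 1" and \<alpha>: "\<alpha> \<ge> 0" and G: "G holomorphic_on unit_disk"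
    and B: "\<And>z. z \<in> unit_disk \<Longrightarrow> cmod (G z) \<le> B" "B > 0"
    and k: "k \<in> bergman_space p \<alpha>"
    and r: "1 / 2 \<le> r" "r < 1" and \<sigma>: "\<And>z. cmod z \<le> r \<Longrightarrow> cmod (k z) \<le> \<sigma>"
  shows "bergman_mass p \<alpha> (volterra_op G k)
    \<le> ennreal (B powr p * (measure (disk_measure \<alpha>) unit_disk * \<sigma> powr p
         + 4 * (1 - r) * bergman_norm p \<alpha> k powr p))"
proof -
  let ?\<Phi> = "\<lambda>s z. k (of_real s * z) * G (of_real s * z) * z"
  have "cmod (k 0) \<le> \<sigma>" using \<sigma>[of 0] r by auto
  then have "\<sigma> \<ge> 0" using norm_ge_zero order_trans by blast
  define A where "A = measure (disk_measure \<alpha>) unit_disk"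
  have "A \<ge> 0" by (simp add: A_def)
  let ?c = "\<lambda>s. A * \<sigma> powr p + 4 * bergman_norm p \<alpha> k powr p * indicator {r..1} s"
  let ?I = "\<lambda>s. \<integral>\<^sup>+z. ennreal (disk_weight \<alpha> z * cmod (k (of_real s * z)) powr p) \<partial>lborel"
  define c where "c = (\<lambda>s. B powr p * (?c s))"
  have hk: "k holomorphic_on unit_disk" using k by (simp add: bergman_space_iff)
  have ck: "continuous_on unit_disk k" "continuous_on unit_disk G"
    using hk G by (auto intro: holomorphic_on_imp_continuous_on)
  have mem: "of_real s * z \<in> unit_disk" if "z \<in> unit_disk" "0 \<le> s" "s \<le> 1" for s z
    using that mult_left_le[of s "cmod z"] by (auto simp: norm_mult mult.commute)
  have V: "((\<lambda>s. ?\<Phi> s z) has_integral volterra_op G k z) {0..1}"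
    if "z \<in> unit_disk" for z
    using that hk G mem[of z]
    by (intro volterra_op_has_integral_path)
       (auto intro!: derivative_eq_intros simp: has_vector_derivative_def scaleR_conv_of_real)
  have "bergman_mass p \<alpha> (volterra_op G k)
     = (\<integral>\<^sup>+z. ennreal (disk_weight \<alpha> z * cmod (volterra_op G k z) powr p) \<partial>lborel)"
    using volterra_op_holomorphic[OF hk G] p \<alpha>
    by (intro bergman_mass_eq holomorphic_on_imp_continuous_on)
  also have "\<dots> \<le> ennreal (1 powr (p - 1) * (B powr p * (A * \<sigma> powr p + 4 * bergman_norm p \<alpha> k powr p * (1 - r))))"
  proof (rule nn_integral_powr_integral_le[where \<Phi> = "\<lambda>s z. ?\<Phi> s z"
        \<comment> \<open>With constant weight the lemma is plain convexity: the p-th power of a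
          mean is at most the mean of the p-th powers.\<close>
        and \<omega> = "\<lambda>_. 1" and c = c and S = unit_disk])
    have "continuous_on ({0<..<1} \<times> unit_disk) (\<lambda>x. ?\<Phi> (fst x) (snd x))"
      by (intro continuous_intros continuous_on_compose2[OF ck(1)] continuous_on_compose2[OF ck(2)])
        (use mem in force)+
    then show "continuous_on ({0<..<1} \<times> unit_disk) (\<lambda>(s, z). ?\<Phi> s z)"
      by (simp add: case_prod_unfold)
    show "continuous_on {0..1} (\<lambda>s. ?\<Phi> s z)" if "z \<in> unit_disk" for z
      by (intro continuous_intros continuous_on_compose2[OF ck(1)] continuous_on_compose2[OF ck(2)])
        (use mem[OF that] in force)+
    show "((\<lambda>_. 1 :: real) has_integral 1) {0..1 :: real}"
      using has_integral_const_real[of "1 :: real" 0 1] by auto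
    have "((\<lambda>s. B powr p * (?c s)) has_integral
        B powr p * (1 *\<^sub>R (A * \<sigma> powr p) + 4 * bergman_norm p \<alpha> k powr p * (1 - r))) {0..1}"
      using r has_integral_const_real[of "A * \<sigma> powr p" 0 1]
      by (intro has_integral_mult_right has_integral_add has_integral_indicator_Icc) auto
    then show "((\<lambda>s. 1 * c s) has_integral B powr p * (A * \<sigma> powr p + 4 * bergman_norm p \<alpha> k powr p * (1 - r))) {0..1}"
      by (simp add: c_def)
    show "disk_weight \<alpha> z = 0" if "z \<notin> unit_disk" for z
      using that by (auto simp: disk_weight_def)
    show "c s \<ge> 0" for s using \<open>A \<ge> 0\<close> by (simp add: c_def)
    fix s :: real assume s: "s \<in> {0<..<1}"
    have pw: "cmod (?\<Phi> s z) powr p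
        \<le> B powr p * cmod (k (of_real s * z)) powr p" if "z \<in> unit_disk" for z
    proof -
      have "cmod (?\<Phi> s z) \<le> cmod (k (of_real s * z)) * B * 1"
        unfolding norm_mult using B mem[OF that, of s] s that by (intro mult_mono) auto
      then have "cmod (?\<Phi> s z) powr p \<le> (cmod (k (of_real s * z)) * B * 1) powr p"
        using p by (intro powr_mono2) auto
      then show ?thesis using B by (simp add: powr_mult mult_ac)
    qed
    have wt0: "disk_weight \<alpha> z = 0" if "z \<notin> unit_disk" for z
      using that by (auto simp: disk_weight_def)
    have "?I s
        \<le> ennreal (?c s)"
    proof (cases "r \<le> s")
      case True
      have "?I s
          \<le> ennreal (4 * bergman_norm p \<alpha> k powr p)"
        using True s r by (intro nn_integral_dilation_le k p \<alpha>) auto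
      also have "\<dots> \<le> ennreal (?c s)"
        using True s \<open>A \<ge> 0\<close> by (intro ennreal_leI) auto
      finally show ?thesis .
    next
      case False
      have "?I s
         \<le> (\<integral>\<^sup>+z. ennreal (disk_weight \<alpha> z * \<sigma> powr p) \<partial>lborel)"
      proof (intro nn_integral_mono ennreal_leI)
        fix z
        show "disk_weight \<alpha> z * cmod (k (of_real s * z)) powr p \<le> disk_weight \<alpha> z * \<sigma> powr p"
        proof (cases "z \<in> unit_disk")
          case True
          then have "cmod (of_real s * z) \<le> r"
            using False s mult_mono[of s r "cmod z" 1] r by (auto simp: norm_mult)
          then show ?thesis using \<sigma> p disk_weight_nonneg[OF \<alpha>] by (intro mult_left_mono powr_mono2) auto
        qed (simp add: wt0)
      qed
      also have "\<dots> = (\<integral>\<^sup>+z. ennreal (\<sigma> powr p) \<partial>disk_measure \<alpha>)"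
        using \<alpha> by (intro nn_integral_disk_measure[symmetric]) auto
      also have "\<dots> = ennreal (\<sigma> powr p) * ennreal A"
        using emeasure_disk_measure_finite[OF \<alpha>] unfolding A_def
        by (subst emeasure_eq_ennreal_measure[symmetric]) auto
      also have "\<dots> = ennreal (?c s)"
        using False \<open>A \<ge> 0\<close> by (simp add: mult.commute flip: ennreal_mult')
      finally show ?thesis .
    qed
    note 1 = this
    have mk: "(\<lambda>z. ennreal (disk_weight \<alpha> z * cmod (k (of_real s * z)) powr p)) \<in> borel_measurable lborel"
    proof -
      note bergman_space_measurable[OF k, measurable]
      show ?thesis by measurable
    qed
    have "(\<integral>\<^sup>+z. ennreal (disk_weight \<alpha> z * cmod (?\<Phi> s z) powr p) \<partial>lborel)
       \<le> (\<integral>\<^sup>+z. ennreal (B powr p) * ennreal (disk_weight \<alpha> z * cmod (k (of_real s * z)) powr p) \<partial>lborel)"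
    proof (intro nn_integral_mono)
      fix z
      show "ennreal (disk_weight \<alpha> z * cmod (?\<Phi> s z) powr p)
        \<le> ennreal (B powr p) * ennreal (disk_weight \<alpha> z * cmod (k (of_real s * z)) powr p)"
        using mult_left_mono[OF pw[of z] disk_weight_nonneg[OF \<alpha>, of z]] wt0[of z]
        by (cases "z \<in> unit_disk") (auto simp: mult_ac simp flip: ennreal_mult' intro!: ennreal_leI)
    qed
    also have "\<dots> = ennreal (B powr p) * ?I s"
      by (rule nn_integral_cmult[OF mk])
    also have "\<dots> \<le> ennreal (B powr p) * ennreal (?c s)"
      by (intro mult_left_mono 1) auto
    also have "\<dots> = ennreal (1 powr p * c s)"
      by (simp add: c_def flip: ennreal_mult')
    finally show "(\<integral>\<^sup>+z. ennreal (disk_weight \<alpha> z * cmod (?\<Phi> s z) powr p) \<partial>lborel)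
       \<le> ennreal (1 powr p * c s)" .
  qed (use p \<alpha> V in \<open>auto simp: disk_weight_nonneg\<close>)
  finally show ?thesis by (simp add: A_def algebra_simps)
qed

section \<open>Compactness for bounded symbols\<close>

lemma volterra_op_has_integral_radial:
  assumes "f holomorphic_on unit_disk" "G holomorphic_on unit_disk" "z \<in> unit_disk"
  shows "((\<lambda>s. f (of_real s * z) * G (of_real s * z) * z) has_integral volterra_op G f z) {0..1}"
proof (rule volterra_op_has_integral_path[OF assms(1,2)])
  show "of_real s * z \<in> unit_disk" if "s \<in> {0..1}" for s
    using that assms(3) mult_left_le[of s "cmod z"] by (auto simp: norm_mult mult.commute)
qed (auto intro!: derivative_eq_intros simp: has_vector_derivative_def scaleR_conv_of_real)

lemma volterra_op_add:
  assumes "f holomorphic_on unit_disk" "h holomorphic_on unit_disk" "G holomorphic_on unit_disk"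
  shows "volterra_op G (\<lambda>z. f z + h z) = (\<lambda>z. volterra_op G f z + volterra_op G h z)"
proof
  fix z
  show "volterra_op G (\<lambda>z. f z + h z) z = volterra_op G f z + volterra_op G h z"
  proof (cases "z \<in> unit_disk")
    case True
    show ?thesis
      using has_integral_add[OF volterra_op_has_integral_radial[OF assms(1,3) True]
          volterra_op_has_integral_radial[OF assms(2,3) True]]
        volterra_op_has_integral_radial[OF holomorphic_on_add[OF assms(1,2)] assms(3) True]
      by (simp add: distrib_right has_integral_unique)
  qed (simp add: volterra_op_def)
qed

lemma volterra_op_scale:
  assumes "f holomorphic_on unit_disk" "G holomorphic_on unit_disk"
  shows "volterra_op G (\<lambda>z. c * f z) = (\<lambda>z. c * volterra_op G f z)"
proof
  fix z
  show "volterra_op G (\<lambda>z. c * f z) z = c * volterra_op G f z"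
  proof (cases "z \<in> unit_disk")
    case True
    show ?thesis
      using has_integral_mult_right[OF volterra_op_has_integral_radial[OF assms True], of c]
        volterra_op_has_integral_radial[OF holomorphic_on_mult[OF holomorphic_on_const assms(1)] assms(2) True, of c]
      by (simp add: mult.assoc has_integral_unique)
  qed (simp add: volterra_op_def)
qed

lemma volterra_op_mult_symbol: "volterra_op (\<lambda>z. b z * G z) f = volterra_op G (\<lambda>z. b z * f z)"
proof -
  have "(\<lambda>w. f w * (b w * G w)) = (\<lambda>w. b w * f w * G w)"
    by (simp add: fun_eq_iff)
  then show ?thesis by (intro ext) (simp only: volterra_op_def)
qed

text \<open>The integrand is symmetric in function and symbol, so additivity in the symbol follows
  from additivity in the function.\<close>

lemma volterra_op_swap: "volterra_op G f = volterra_op f G"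
proof -
  have "(\<lambda>w. f w * G w) = (\<lambda>w. G w * f w)"
    by (simp add: fun_eq_iff)
  then show ?thesis by (intro ext) (simp only: volterra_op_def)
qed

lemma volterra_op_add_symbol:
  assumes "f holomorphic_on unit_disk" "H holomorphic_on unit_disk" "G holomorphic_on unit_disk"
  shows "volterra_op (\<lambda>z. G z + H z) f = (\<lambda>z. volterra_op G f z + volterra_op H f z)"
  using volterra_op_add[OF assms(3,2,1)] by (simp only: volterra_op_swap[of _ f])

lemma volterra_op_linear:
  assumes "G holomorphic_on unit_disk"
    and "\<And>f. f \<in> bergman_space p \<alpha> \<Longrightarrow> volterra_op G f \<in> bergman_space p \<alpha>"
  shows "bergman_linear p \<alpha> (volterra_op G)"
  using assms volterra_op_add volterra_op_scale
  unfolding bergman_linear_def by (simp add: bergman_space_iff)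

lemma volterra_op_in_bergman_space:
  assumes "f \<in> bergman_space p \<alpha>" "G holomorphic_on unit_disk"
    and "bergman_mass p \<alpha> (volterra_op G f) < \<infinity>"
  shows "volterra_op G f \<in> bergman_space p \<alpha>"
  using assms volterra_op_holomorphic[of f G] volterra_op_outside by (auto simp: bergman_space_iff)

context
  fixes p \<alpha> B :: real and G :: "complex \<Rightarrow> complex"
  assumes p: "p > 1" and \<alpha>: "\<alpha> \<ge> 0" and G: "G holomorphic_on unit_disk"
    and B: "\<And>z. z \<in> unit_disk \<Longrightarrow> cmod (G z) \<le> B" "B > 0"
begin

lemma volterra_bounded_symbol_maps:
  assumes "f \<in> bergman_space p \<alpha>"
  shows "volterra_op G f \<in> bergman_space p \<alpha>"
proof -
  obtain C where "C \<ge> 0" "\<And>f a. f \<in> bergman_space p \<alpha> \<Longrightarrow> cmod a \<le> 1/2 \<Longrightarrow> cmod (f a) \<le> C * bergman_norm p \<alpha> f"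
    using bergman_point_bound[OF p \<alpha>, of "1/2"] by auto
  then have "bergman_mass p \<alpha> (volterra_op G f) < \<infinity>"
    using volterra_bounded_symbol_mass_le[OF p \<alpha> G B assms, of "1/2" "C * bergman_norm p \<alpha> f"] assms
    by (auto intro: le_less_trans)
  then show ?thesis using assms G by (intro volterra_op_in_bergman_space)
qed

lemma volterra_bounded_symbol_bounded:
  obtains C where "C \<ge> 0"
    "\<And>f. f \<in> bergman_space p \<alpha> \<Longrightarrow> bergman_norm p \<alpha> (volterra_op G f) \<le> C * bergman_norm p \<alpha> f"
proof -
  obtain C where C: "C \<ge> 0" "\<And>f a. f \<in> bergman_space p \<alpha> \<Longrightarrow> cmod a \<le> 1/2 \<Longrightarrow> cmod (f a) \<le> C * bergman_norm p \<alpha> f"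
    using bergman_point_bound[OF p \<alpha>, of "1/2"] by auto
  define A where "A = measure (disk_measure \<alpha>) unit_disk"
  define D where "D = B powr p * (A * C powr p + 2)"
  have D: "D \<ge> 0" by (simp add: D_def A_def)
  have "bergman_norm p \<alpha> (volterra_op G f) \<le> D powr (1 / p) * bergman_norm p \<alpha> f"
    if f: "f \<in> bergman_space p \<alpha>" for f
  proof (rule bergman_norm_leI)
    show "continuous_on unit_disk (volterra_op G f)"
      using volterra_bounded_symbol_maps[OF f] by (rule bergman_space_continuous)
    have "bergman_mass p \<alpha> (volterra_op G f)
      \<le> ennreal (B powr p * (A * (C * bergman_norm p \<alpha> f) powr p + 4 * (1 - 1/2) * bergman_norm p \<alpha> f powr p))"
      unfolding A_def using C f by (intro volterra_bounded_symbol_mass_le p \<alpha> G B) auto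
    also have "B powr p * (A * (C * bergman_norm p \<alpha> f) powr p + 4 * (1 - 1/2) * bergman_norm p \<alpha> f powr p)
       = D * bergman_norm p \<alpha> f powr p"
      using C by (simp add: D_def powr_mult algebra_simps)
    also have "\<dots> = (D powr (1 / p) * bergman_norm p \<alpha> f) powr p"
      using D p by (simp add: powr_mult powr_powr)
    finally show "bergman_mass p \<alpha> (volterra_op G f) \<le> ennreal ((D powr (1 / p) * bergman_norm p \<alpha> f) powr p)" .
  qed (use p in auto)
  then show ?thesis using that[of "D powr (1 / p)"] by auto
qed

lemma volterra_bounded_symbol_tendsto_0:
  assumes f: "\<And>n. f n \<in> bergman_space p \<alpha>" and C: "\<And>n. bergman_norm p \<alpha> (f n) \<le> C"
    and unif: "\<And>r. r < 1 \<Longrightarrow> uniform_limit (cball 0 r) f (\<lambda>_. 0) sequentially"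
  shows "(\<lambda>n. bergman_norm p \<alpha> (volterra_op G (f n))) \<longlonglongrightarrow> 0"
proof (rule tendstoI)
  fix e :: real assume "e > 0"
  define A where "A = measure (disk_measure \<alpha>) unit_disk"
  have "A \<ge> 0" by (simp add: A_def)
  have "C \<ge> 0" using C[of 0] bergman_norm_nonneg order_trans by blast
  \<comment> \<open>Chosen so that two terms of size \<open>d\<close>, times B^p, make exactly
    (e/2)^p.\<close>
  define d where "d = (e / 2) powr p / B powr p / 2"
  have "d > 0" using \<open>e > 0\<close> B by (simp add: d_def)
  \<comment> \<open>The radius is r = 1 - q. The bound 1/2 gives r >= 1/2 as the mass estimate
    requires; C^p + 1 keeps the denominator positive when C = 0.\<close>
  define q where "q = min (1 / 2) (d / (4 * (C powr p + 1)))"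
  have q: "q > 0" "q \<le> 1/2" "4 * q * C powr p \<le> d"
  proof -
    have Cp: "C powr p + 1 > 0" using powr_ge_zero[of C p] by linarith
    then show "q > 0" "q \<le> 1/2" using \<open>d > 0\<close> by (auto simp: q_def min_def)
    have "4 * q * C powr p \<le> 4 * (d / (4 * (C powr p + 1))) * (C powr p + 1)"
      using \<open>d > 0\<close> Cp \<open>q > 0\<close> by (intro mult_mono) (auto simp: q_def)
    also have "4 * (d / (4 * (C powr p + 1))) * (C powr p + 1) = d"
      using Cp by (simp add: nonzero_divide_eq_eq)
    finally show "4 * q * C powr p \<le> d" .
  qed
  define \<sigma> where "\<sigma> = (d / (A + 1)) powr (1 / p)"
  have \<sigma>: "\<sigma> > 0" using \<open>d > 0\<close> \<open>A \<ge> 0\<close> by (simp add: \<sigma>_def)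
  have "\<sigma> powr p = d / (A + 1)" using \<open>d > 0\<close> \<open>A \<ge> 0\<close> p by (simp add: \<sigma>_def powr_powr)
  then have A\<sigma>: "A * \<sigma> powr p \<le> d"
    using \<open>d > 0\<close> \<open>A \<ge> 0\<close> powr_ge_zero[of \<sigma> p] by (simp add: field_simps del: powr_ge_zero)
  have "\<forall>\<^sub>F n in sequentially. \<forall>z\<in>cball 0 (1 - q). dist (f n z) 0 < \<sigma>"
    using unif[of "1 - q"] q \<sigma> by (auto dest: uniform_limitD)
  then show "\<forall>\<^sub>F n in sequentially. dist (bergman_norm p \<alpha> (volterra_op G (f n))) 0 < e"
  proof eventually_elim
    case (elim n)
    have "bergman_mass p \<alpha> (volterra_op G (f n))
      \<le> ennreal (B powr p * (A * \<sigma> powr p + 4 * (1 - (1 - q)) * bergman_norm p \<alpha> (f n) powr p))"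
      unfolding A_def using elim q
      by (intro volterra_bounded_symbol_mass_le p \<alpha> G B f) (auto simp: less_imp_le)
    also have "\<dots> \<le> ennreal (B powr p * (d + d))"
    proof (intro ennreal_leI mult_left_mono add_mono A\<sigma>)
      have "4 * (1 - (1 - q)) * bergman_norm p \<alpha> (f n) powr p \<le> 4 * q * C powr p"
        using q C[of n] p by (auto intro!: mult_left_mono powr_mono2)
      then show "4 * (1 - (1 - q)) * bergman_norm p \<alpha> (f n) powr p \<le> d" using q by linarith
    qed auto
    also have "B powr p * (d + d) = (e / 2) powr p"
      using B by (simp add: d_def)
    finally have "bergman_norm p \<alpha> (volterra_op G (f n)) \<le> e / 2"
      using \<open>e > 0\<close> p volterra_bounded_symbol_maps[OF f]
      by (intro bergman_norm_leI bergman_space_continuous) auto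
    then show ?case using \<open>e > 0\<close> by simp
  qed
qed

end

text \<open>Point evaluations bound the sequence on compact sets, so Montel's theorem yields a
  locally uniform limit, and Fatou's lemma puts this limit into the space.\<close>

lemma bergman_bounded_imp_convergent_subseq:
  assumes p: "p > 1" and \<alpha>: "\<alpha> \<ge> 0"
    and f: "\<And>n. f n \<in> bergman_space p \<alpha>" and C: "\<And>n. bergman_norm p \<alpha> (f n) \<le> C"
  obtains r h where "strict_mono (r :: nat \<Rightarrow> nat)" "h \<in> bergman_space p \<alpha>"
    "\<And>R. R < 1 \<Longrightarrow> uniform_limit (cball 0 R) (\<lambda>n z. f (r n) z - h z) (\<lambda>_. 0) sequentially"
proof -
  have bounded: "\<exists>B. \<forall>h\<in>range f. \<forall>z\<in>K. cmod (h z) \<le> B" if K: "compact K" "K \<subseteq> unit_disk" for K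
  proof -
    obtain R where R: "R < 1" "K \<subseteq> cball 0 R"
    proof (cases "K = {}")
      case False
      then obtain z where "z \<in> K" "\<forall>w\<in>K. cmod w \<le> cmod z"
        using continuous_attains_sup[OF K(1), of cmod] by (auto intro: continuous_intros)
      then show ?thesis using K(2) by (intro that[of "cmod z"]) auto
    qed (use that[of 0] in auto)
    obtain D where D: "D \<ge> 0" "\<And>f a. f \<in> bergman_space p \<alpha> \<Longrightarrow> cmod a \<le> R \<Longrightarrow> cmod (f a) \<le> D * bergman_norm p \<alpha> f"
      using bergman_point_bound[OF p \<alpha> R(1)] by blast
    have "cmod (f n z) \<le> D * C" if "z \<in> K" for n z
    proof -
      have "cmod (f n z) \<le> D * bergman_norm p \<alpha> (f n)" using D(2)[OF f] R that by auto
      also have "\<dots> \<le> D * C" using C D(1) by (intro mult_left_mono)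
      finally show ?thesis .
    qed
    then show ?thesis by blast
  qed
  have hol_range: "k holomorphic_on unit_disk" if "k \<in> range f" for k
    using that f by (auto simp: bergman_space_iff)
  obtain g r where g: "g holomorphic_on unit_disk" "strict_mono (r :: nat \<Rightarrow> nat)"
      "\<And>x. x \<in> unit_disk \<Longrightarrow> (\<lambda>n. f (r n) x) \<longlonglongrightarrow> g x"
      "\<And>K. compact K \<Longrightarrow> K \<subseteq> unit_disk \<Longrightarrow> uniform_limit K (f \<circ> r) g sequentially"
    by (rule Montel[OF open_ball hol_range bounded subset_refl]) (assumption | rule that)+
  \<comment> \<open>The limit function is arbitrary outside the disk, whereas elements of the space
    vanish there.\<close>
  define h where "h = (\<lambda>z. if z \<in> unit_disk then g z else 0)"
  have hol: "h holomorphic_on unit_disk"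
    using g(1) by (rule holomorphic_transform) (simp add: h_def)
  have m: "(\<lambda>z. ennreal (cmod (f n z) powr p)) \<in> borel_measurable (disk_measure \<alpha>)" for n
  proof -
    have [measurable]: "f n \<in> borel_measurable (disk_measure \<alpha>)"
      by (intro continuous_imp_measurable_disk_measure bergman_space_continuous[OF f])
    show ?thesis by measurable
  qed
  have "bergman_mass p \<alpha> h = (\<integral>\<^sup>+z. liminf (\<lambda>n. ennreal (cmod (f (r n) z) powr p)) \<partial>disk_measure \<alpha>)"
    unfolding bergman_mass_def
  proof (intro nn_integral_cong)
    fix z assume "z \<in> space (disk_measure \<alpha>)"
    then have "(\<lambda>n. f (r n) z) \<longlonglongrightarrow> h z" using g(3) by (simp add: h_def)
    then have "(\<lambda>n. ennreal (cmod (f (r n) z) powr p)) \<longlonglongrightarrow> ennreal (cmod (h z) powr p)"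
      using p by (intro tendsto_ennrealI tendsto_powr' tendsto_norm tendsto_const) auto
    then show "ennreal (cmod (h z) powr p) = liminf (\<lambda>n. ennreal (cmod (f (r n) z) powr p))"
      by (intro lim_imp_Liminf[symmetric]) auto
  qed
  also have "\<dots> \<le> liminf (\<lambda>n. bergman_mass p \<alpha> (f (r n)))"
    unfolding bergman_mass_def using m by (intro nn_integral_liminf)
  also have "\<dots> \<le> liminf (\<lambda>n. ennreal (C powr p))"
    using bergman_mass_eq_norm[OF f p] C p
    by (intro Liminf_mono always_eventually) (auto intro!: ennreal_leI powr_mono2)
  also have "\<dots> < \<infinity>" by (simp add: Liminf_const)
  finally have h: "h \<in> bergman_space p \<alpha>"
    using hol by (simp add: bergman_space_iff h_def)
  moreover have "uniform_limit (cball 0 R) (\<lambda>n z. f (r n) z - h z) (\<lambda>_. 0) sequentially" if "R < 1" for R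
  proof -
    have "uniform_limit (cball 0 R) (f \<circ> r) g sequentially" using that by (intro g(4)) auto
    then show ?thesis
      using that unfolding uniform_limit_iff by (auto simp: h_def dist_norm elim!: eventually_mono)
  qed
  ultimately show ?thesis using that g(2) by blast
qed

text \<open>Along the subsequence of the normal family argument the differences f_n - h are bounded
  and tend to 0 locally uniformly, hence their images tend to 0 in norm; the limit of the images is
  the image of h.\<close>

lemma volterra_bounded_symbol_compact:
  assumes p: "p > 1" and \<alpha>: "\<alpha> \<ge> 0" and G: "G holomorphic_on unit_disk"
    and B: "\<And>z. z \<in> unit_disk \<Longrightarrow> cmod (G z) \<le> B" "B > 0"
  shows "bergman_compact p \<alpha> (volterra_op G)"
  unfolding bergman_compact_def
proof (intro conjI allI impI)
  have V: "volterra_op G f \<in> bergman_space p \<alpha>" if "f \<in> bergman_space p \<alpha>" for f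
    using B that by (intro volterra_bounded_symbol_maps[OF p \<alpha> G])
  show "bergman_linear p \<alpha> (volterra_op G)"
    using V G by (intro volterra_op_linear)
  fix f :: "nat \<Rightarrow> complex \<Rightarrow> complex"
  assume "(\<forall>n. f n \<in> bergman_space p \<alpha>) \<and> (\<exists>C. \<forall>n. bergman_norm p \<alpha> (f n) \<le> C)"
  then obtain C where f: "\<And>n. f n \<in> bergman_space p \<alpha>" "\<And>n. bergman_norm p \<alpha> (f n) \<le> C" by auto
  obtain r h where rh: "strict_mono (r :: nat \<Rightarrow> nat)" "h \<in> bergman_space p \<alpha>"
    "\<And>R. R < 1 \<Longrightarrow> uniform_limit (cball 0 R) (\<lambda>n z. f (r n) z - h z) (\<lambda>_. 0) sequentially"
    using bergman_bounded_imp_convergent_subseq[where f = f, OF p \<alpha> f] by blast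
  have "bergman_norm p \<alpha> (\<lambda>z. f (r n) z - h z) \<le> C + bergman_norm p \<alpha> h" for n
    using bergman_diff(2)[OF f(1) rh(2) p, of "r n"] f(2)[of "r n"] by linarith
  then have "(\<lambda>n. bergman_norm p \<alpha> (volterra_op G (\<lambda>z. f (r n) z - h z))) \<longlonglongrightarrow> 0"
    using rh f by (intro volterra_bounded_symbol_tendsto_0[OF p \<alpha> G B, where C = "C + bergman_norm p \<alpha> h"] bergman_diff p) auto
  moreover have "volterra_op G (\<lambda>z. f (r n) z - h z) = (\<lambda>z. volterra_op G (f (r n)) z - volterra_op G h z)" for n
    using volterra_op_add[of "f (r n)" "\<lambda>z. - 1 * h z" G] volterra_op_scale[of h G "-1"] f(1) rh(2) G
    by (auto simp: bergman_space_iff fun_eq_iff intro!: holomorphic_intros)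
  ultimately show "\<exists>r h. strict_mono r \<and> h \<in> bergman_space p \<alpha> \<and>
      (\<lambda>n. bergman_norm p \<alpha> (\<lambda>z. volterra_op G (f (r n)) z - h z)) \<longlonglongrightarrow> 0"
    using rh V[OF rh(2)] by auto
qed

section \<open>Horodisk maps\<close>

text \<open>In the coordinate z/(1 - z), which sends the disk to the half-plane Re > -1/2 and 1 to
  infinity, this is multiplication by t. For t > 0 the image is thus Re > -t/2, which is a horodisk
  at 1 when t < 1.\<close>

definition horo_map :: "real \<Rightarrow> complex \<Rightarrow> complex" where
  "horo_map t z = of_real t * z / (1 - of_real (1 - t) * z)"

abbreviation horo_denom :: "real \<Rightarrow> complex \<Rightarrow> complex" where
  "horo_denom t z \<equiv> 1 - of_real (1 - t) * z"

context
  fixes t :: real and z :: complex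
  assumes t: "0 \<le> t" "t \<le> 1" and z: "z \<in> unit_disk"
begin

lemma horo_denom_nonzero: "horo_denom t z \<noteq> 0"
proof
  assume "horo_denom t z = 0"
  then have "cmod (of_real (1 - t) * z) = 1" by (metis eq_iff_diff_eq_0 norm_one)
  moreover have "cmod (of_real (1 - t) * z) \<le> 1 * cmod z"
    unfolding norm_mult norm_of_real using t by (intro mult_right_mono) auto
  ultimately show False using z by simp
qed

text \<open>The source of all estimates on \<open>horo_map\<close>. Both summands on the right are
  nonnegative: keeping the first compares the weights at z and at its image, keeping the second
  places the image in a horodisk.\<close>

lemma cmod_horo_denom_sq:
  "(cmod (horo_denom t z))\<^sup>2 - (t * cmod z)\<^sup>2
    = t * (1 - (cmod z)\<^sup>2) + (1 - t) * (cmod (1 - z))\<^sup>2"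
  unfolding power_mult_distrib cmod_power2 by (simp add: power2_eq_square) algebra

lemma cmod_horo_map: "cmod (horo_map t z) = t * cmod z / cmod (horo_denom t z)"
  using t by (simp add: horo_map_def norm_mult norm_divide)

lemma one_minus_horo_map: "1 - horo_map t z = (1 - z) / (horo_denom t z)"
  using horo_denom_nonzero by (simp add: horo_map_def field_simps)

lemma one_minus_cmod_horo_map_sq:
  "1 - (cmod (horo_map t z))\<^sup>2
    = (t * (1 - (cmod z)\<^sup>2) + (1 - t) * (cmod (1 - z))\<^sup>2) / (cmod (horo_denom t z))\<^sup>2"
  unfolding cmod_horo_map cmod_horo_denom_sq[symmetric]
  using horo_denom_nonzero by (simp add: power_divide diff_divide_distrib)

lemma disk_sq_less_1: "0 < 1 - (cmod z)\<^sup>2"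
  using z by (simp add: power_less_one_iff abs_less_iff)

lemma horo_map_in_disk: "horo_map t z \<in> unit_disk"
proof -
  have "0 < t * (1 - (cmod z)\<^sup>2) + (1 - t) * (cmod (1 - z))\<^sup>2"
  proof (cases "t = 0")
    case True
    have "z \<noteq> 1" using z by auto
    then show ?thesis using True by simp
  next
    case False
    then show ?thesis using t disk_sq_less_1 by (intro add_pos_nonneg) auto
  qed
  then have "0 < 1 - (cmod (horo_map t z))\<^sup>2"
    unfolding one_minus_cmod_horo_map_sq using horo_denom_nonzero by simp
  then show ?thesis by (simp add: power_less_one_iff abs_less_iff)
qed

text \<open>A bound on |1 - w|^2 / (1 - |w|^2) describes a horodisk at 1. Here the bound is 1/(1 -
  t), obtained by discarding the summand with 1 - |z|^2.\<close>

lemma horodisk: "(1 - t) * (cmod (1 - horo_map t z))\<^sup>2 \<le> 1 - (cmod (horo_map t z))\<^sup>2"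
  unfolding one_minus_cmod_horo_map_sq unfolding one_minus_horo_map
  using t disk_sq_less_1 by (simp add: norm_divide power_divide divide_right_mono)

lemma horo_map_has_field_derivative:
  "(horo_map t has_field_derivative of_real t / (horo_denom t z)\<^sup>2) (at z)"
  unfolding horo_map_def[abs_def] using horo_denom_nonzero
  by (auto intro!: derivative_eq_intros simp: power2_eq_square field_simps)

lemma horo_map_has_vector_derivative:
  "((\<lambda>t. horo_map t z) has_vector_derivative z * (1 - z) / (horo_denom t z)\<^sup>2) (at t within A)"
proof -
  have "((\<lambda>u. u * z / (1 - (1 - u) * z)) has_field_derivative z * (1 - z) / (horo_denom t z)\<^sup>2)
     (at (of_real t :: complex))"
    using horo_denom_nonzero
    by (auto intro!: derivative_eq_intros simp: power2_eq_square field_simps)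
  then show ?thesis
    unfolding horo_map_def
    by (auto dest!: has_vector_derivative_real_field intro: has_vector_derivative_at_within)
qed

text \<open>With w the image and D = |1 - (1 - t) z|, one has 1 - |z|^2 <= (1 - |w|^2) D^2/t, while
  the derivative has modulus t/D^2. The surplus D^(2 \<alpha>) of the weight and D^4 of the Jacobian
  are absorbed by |w|^(4 + 2 \<alpha>), because |w| <= t/D.\<close>

lemma disk_weight_horo_map_le:
  assumes "t > 0" "\<alpha> \<ge> 0"
  shows "disk_weight \<alpha> z * cmod (horo_map t z) powr (4 + 2 * \<alpha>)
     \<le> t powr (2 + \<alpha>) * ((cmod (of_real t / (horo_denom t z)\<^sup>2))\<^sup>2 * disk_weight \<alpha> (horo_map t z))"
proof -
  define D where "D = cmod (horo_denom t z)"
  define w where "w = horo_map t z"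
  have "D > 0" using horo_denom_nonzero by (simp add: D_def)
  have "w \<in> unit_disk" using horo_map_in_disk by (simp add: w_def)
  then have w0: "1 - (cmod w)\<^sup>2 > 0" by (simp add: power_less_one_iff abs_less_iff)
  have "t * (1 - (cmod z)\<^sup>2) / D\<^sup>2 \<le> 1 - (cmod w)\<^sup>2"
    unfolding w_def one_minus_cmod_horo_map_sq D_def[symmetric]
    using t by (intro divide_right_mono) auto
  then have "1 - (cmod z)\<^sup>2 \<le> (1 - (cmod w)\<^sup>2) * (D\<^sup>2 / t)"
    using \<open>t > 0\<close> \<open>D > 0\<close> by (simp add: field_simps)
  then have "(1 - (cmod z)\<^sup>2) powr \<alpha> \<le> ((1 - (cmod w)\<^sup>2) * (D\<^sup>2 / t)) powr \<alpha>"
    using disk_sq_less_1 \<open>\<alpha> \<ge> 0\<close> by (intro powr_mono2) auto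
  also have "\<dots> = (1 - (cmod w)\<^sup>2) powr \<alpha> * (D powr (2 * \<alpha>) / t powr \<alpha>)"
    using w0 \<open>t > 0\<close> \<open>D > 0\<close>
    by (simp add: powr_mult powr_divide powr_powr flip: powr_numeral)
  finally have 1: "(1 - (cmod z)\<^sup>2) powr \<alpha> \<le> (1 - (cmod w)\<^sup>2) powr \<alpha> * (D powr (2 * \<alpha>) / t powr \<alpha>)" .
  have "cmod w \<le> t / D"
    using z t \<open>D > 0\<close> unfolding w_def cmod_horo_map D_def[symmetric]
    by (intro divide_right_mono mult_left_le) auto
  then have "cmod w powr (4 + 2 * \<alpha>) \<le> (t / D) powr (4 + 2 * \<alpha>)"
    using \<open>\<alpha> \<ge> 0\<close> by (intro powr_mono2) auto
  then have "(1 - (cmod z)\<^sup>2) powr \<alpha> * cmod w powr (4 + 2 * \<alpha>)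
      \<le> ((1 - (cmod w)\<^sup>2) powr \<alpha> * (D powr (2 * \<alpha>) / t powr \<alpha>)) * (t / D) powr (4 + 2 * \<alpha>)"
    using 1 by (intro mult_mono) auto
  also have "\<dots> = (1 - (cmod w)\<^sup>2) powr \<alpha> * (t powr (2 + \<alpha>) * (t / D\<^sup>2)\<^sup>2)"
  proof -
    have "D powr (2 * \<alpha>) / t powr \<alpha> * (t / D) powr (4 + 2 * \<alpha>) = t powr (2 + \<alpha>) * (t / D\<^sup>2)\<^sup>2"
    proof -
      have "(t / D) powr (4 + 2 * \<alpha>) = t powr (4 + 2 * \<alpha>) / D powr (4 + 2 * \<alpha>)"
        using \<open>t > 0\<close> \<open>D > 0\<close> by (simp add: powr_divide)
      moreover have "t powr (4 + 2 * \<alpha>) = t powr \<alpha> * (t powr (2 + \<alpha>) * t\<^sup>2)"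
        using \<open>t > 0\<close> by (simp add: add.commute flip: powr_numeral powr_add)
      moreover have "D powr (4 + 2 * \<alpha>) = D powr (2 * \<alpha>) * D ^ 4"
        using \<open>D > 0\<close> by (simp add: add.commute flip: powr_numeral powr_add)
      ultimately show ?thesis
        using \<open>t > 0\<close> \<open>D > 0\<close> by (simp add: power_divide)
    qed
    then show ?thesis by (simp only: mult.assoc)
  qed
  finally have "(1 - (cmod z)\<^sup>2) powr \<alpha> * cmod w powr (4 + 2 * \<alpha>)
      \<le> (1 - (cmod w)\<^sup>2) powr \<alpha> * (t powr (2 + \<alpha>) * (t / D\<^sup>2)\<^sup>2)" .
  then have "(1 + \<alpha>) / pi * ((1 - (cmod z)\<^sup>2) powr \<alpha> * cmod w powr (4 + 2 * \<alpha>))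
      \<le> (1 + \<alpha>) / pi * ((1 - (cmod w)\<^sup>2) powr \<alpha> * (t powr (2 + \<alpha>) * (t / D\<^sup>2)\<^sup>2))"
    using \<open>\<alpha> \<ge> 0\<close> by (intro mult_left_mono) auto
  moreover have "cmod (of_real t / (horo_denom t z)\<^sup>2) = t / D\<^sup>2"
    using t by (simp add: norm_divide norm_power D_def)
  ultimately show ?thesis
    unfolding w_def[symmetric] disk_weight_def
    using z \<open>w \<in> unit_disk\<close> by (simp add: mult_ac)
qed

end

lemma inj_on_horo_map: "t > 0 \<Longrightarrow> t \<le> 1 \<Longrightarrow> inj_on (horo_map t) unit_disk"
proof (rule inj_onI)
  fix z w :: complex
  assume t: "t > 0" "t \<le> 1" and zw: "z \<in> unit_disk" "w \<in> unit_disk" and eq: "horo_map t z = horo_map t w"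
  have "horo_denom t z \<noteq> 0" "1 - of_real (1 - t) * w \<noteq> 0"
    using horo_denom_nonzero t zw by auto
  then have "of_real t * z * (1 - of_real (1 - t) * w) = of_real t * w * (horo_denom t z)"
    using eq by (simp add: horo_map_def frac_eq_eq)
  then have "of_real t * (z - w) = 0" by (simp add: algebra_simps)
  then show "z = w" using t by simp
qed

text \<open>The pointwise comparison integrated with the substitution w = phi_t(z). The power t^(2 +
  \<alpha>) is the p-th power of t^\<gamma>, which is how \<gamma> = (2 + \<alpha>)/p
  arises.\<close>

lemma nn_integral_horo_map_le:
  assumes f: "f \<in> bergman_space p \<alpha>" and "p > 1" "\<alpha> \<ge> 0" and t: "0 < t" "t \<le> 1"
  shows "(\<integral>\<^sup>+z. ennreal (disk_weight \<alpha> z * (cmod (horo_map t z) powr (4 + 2 * \<alpha>) * cmod (f (horo_map t z)) powr p)) \<partial>lborel)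
     \<le> ennreal (t powr (2 + \<alpha>) * bergman_norm p \<alpha> f powr p)"
proof -
  let ?u = "\<lambda>z. cmod (horo_map t z) powr (4 + 2 * \<alpha>) * cmod (f (horo_map t z)) powr p"
  note bergman_space_measurable[OF f, measurable]
  let ?F = "\<lambda>z. t powr (2 + \<alpha>) * (disk_weight \<alpha> z * cmod (f z) powr p)"
  let ?d = "\<lambda>z. of_real t / (horo_denom t z)\<^sup>2"
  have "(\<integral>\<^sup>+z. ennreal (disk_weight \<alpha> z * ?u z) \<partial>lborel)
     \<le> (\<integral>\<^sup>+z. ennreal (indicator unit_disk z * ((cmod (?d z))\<^sup>2 * ?F (horo_map t z))) \<partial>lborel)"
  proof (intro nn_integral_mono ennreal_leI)
    fix z
    show "disk_weight \<alpha> z * ?u z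
      \<le> indicator unit_disk z * ((cmod (?d z))\<^sup>2 * ?F (horo_map t z))"
    proof (cases "z \<in> unit_disk")
      case True
      then show ?thesis
        using mult_right_mono[OF disk_weight_horo_map_le[of t z \<alpha>], of "cmod (f (horo_map t z)) powr p"] assms
        by (simp add: mult_ac)
    qed (auto simp: disk_weight_def)
  qed
  also have "\<dots> \<le> (\<integral>\<^sup>+z. ennreal (indicator (horo_map t ` unit_disk) z * ?F z) \<partial>lborel)"
    using assms by (intro nn_integral_change_of_variables_complex_le horo_map_has_field_derivative inj_on_horo_map)
      (auto simp: disk_weight_nonneg)
  also have "\<dots> \<le> (\<integral>\<^sup>+z. ennreal (t powr (2 + \<alpha>)) * ennreal (disk_weight \<alpha> z * cmod (f z) powr p) \<partial>lborel)"
    using assms by (intro nn_integral_mono, subst ennreal_mult'[symmetric])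
      (auto split: split_indicator simp: disk_weight_nonneg intro!: ennreal_leI)
  also have "\<dots> = ennreal (t powr (2 + \<alpha>)) * bergman_mass p \<alpha> f"
    using bergman_mass_eq[OF bergman_space_continuous[OF f], of \<alpha> p] assms by (simp add: nn_integral_cmult)
  also have "\<dots> = ennreal (t powr (2 + \<alpha>) * bergman_norm p \<alpha> f powr p)"
    using bergman_mass_eq_norm[OF f] assms by (subst ennreal_mult') auto
  finally show ?thesis .
qed

lemma has_integral_powr_indicator_Icc:
  fixes \<gamma> a :: real
  assumes "\<gamma> > 0" "0 < a" "a \<le> 1"
  shows "((\<lambda>t. t powr (\<gamma> - 1) * indicator {a..1} t) has_integral (1 - a powr \<gamma>) / \<gamma>) {0..1}"
proof -
  have "((\<lambda>t. t powr (\<gamma> - 1)) has_integral (1 powr \<gamma> / \<gamma> - a powr \<gamma> / \<gamma>)) {a..1}"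
    using assms
    by (intro fundamental_theorem_of_calculus)
       (auto intro!: derivative_eq_intros simp flip: has_real_derivative_iff_has_vector_derivative)
  then have "((\<lambda>t. if t \<in> {a..1} then t powr (\<gamma> - 1) else 0) has_integral (1 - a powr \<gamma>) / \<gamma>) {0..1}"
    using assms by (subst has_integral_restrict) (auto simp: diff_divide_distrib)
  then show ?thesis
    by (rule has_integral_eq[rotated]) (auto simp: indicator_def)
qed

section \<open>The upper estimate\<close>

lemma continuous_on_horo_map:
  "continuous_on ({0..1} \<times> unit_disk) (\<lambda>x. horo_map (fst x) (snd x))"
  unfolding horo_map_def
  by (intro continuous_intros) (use horo_denom_nonzero in force)

lemma volterra_horo_has_integral:
  assumes "f holomorphic_on unit_disk" "H holomorphic_on unit_disk" "z \<in> unit_disk"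
  shows "((\<lambda>t. f (horo_map t z) * H (horo_map t z) * (z * (1 - z) / (horo_denom t z)\<^sup>2))
     has_integral volterra_op H f z) {0..1}"
proof (rule volterra_op_has_integral_path[OF assms(1,2)])
  show "horo_map 0 z = 0" "horo_map 1 z = z" by (simp_all add: horo_map_def)
  fix t :: real assume "t \<in> {0..1}"
  then show "((\<lambda>t. horo_map t z) has_vector_derivative z * (1 - z) / (horo_denom t z)\<^sup>2) (at t within {0..1})"
      "horo_map t z \<in> unit_disk"
    using assms(3) horo_map_has_vector_derivative horo_map_in_disk by auto
qed

text \<open>Along the orbit of z the integrand is (w^j (1 - w) G(w)) (w^(m + 1) f(w)) / t with w =
  phi_t(z). The first factor is at most \<open>L'\<close> for t <= a and at most \<open>B\<close>
  otherwise; the second is handled by the change of variables. Jensen's inequality with weight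
  t^(\<gamma> - 1), of total mass 1/\<gamma>, then combines all t.\<close>

lemma volterra_monomial_mass_le:
  fixes p \<alpha> B a L' :: real and m j :: nat
  assumes p: "p > 1" and \<alpha>: "\<alpha> \<ge> 0" and G: "G holomorphic_on unit_disk"
    and B: "\<And>z. z \<in> unit_disk \<Longrightarrow> cmod ((1 - z) * G z) \<le> B" "B \<ge> 0"
    and m: "4 + 2 * \<alpha> \<le> p * (real m + 1)"
    and a: "0 < a" "a < 1" and L': "L' \<ge> 0"
    and near: "\<And>t z. 0 < t \<Longrightarrow> t \<le> a \<Longrightarrow> z \<in> unit_disk \<Longrightarrow>
       cmod (horo_map t z) ^ j * cmod ((1 - horo_map t z) * G (horo_map t z)) \<le> L'"
    and f: "f \<in> bergman_space p \<alpha>"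
    and \<gamma>: "\<gamma> = (2 + \<alpha>) / p"
  shows "bergman_mass p \<alpha> (volterra_op (\<lambda>z. z ^ (m + j) * G z) f)
     \<le> ennreal ((1 / \<gamma>) powr p * (L' powr p + B powr p * (1 - a powr \<gamma>)) * bergman_norm p \<alpha> f powr p)"
proof -
  let ?u = "\<lambda>t z. cmod (horo_map t z) powr (4 + 2 * \<alpha>) * cmod (f (horo_map t z)) powr p"
  define H where "H = (\<lambda>z. z ^ (m + j) * G z)"
  define N where "N = bergman_norm p \<alpha> f powr p"
  \<comment> \<open>The bound for the p-th power of the norm at time t, divided by (t^(\<gamma> -
    1))^p. On [a, 1] the two constants are added rather than exchanged, which keeps the integral
    elementary.\<close>
  define c where "c = (\<lambda>t. N * (L' powr p + B powr p * indicator {a..1} t))"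
  define \<Phi> where "\<Phi> = (\<lambda>t z. f (horo_map t z) * H (horo_map t z) * (z * (1 - z) / (horo_denom t z)\<^sup>2))"
  have "\<gamma> > 0" using p \<alpha> by (simp add: \<gamma>)
  have p\<gamma>: "p * \<gamma> = 2 + \<alpha>" using p by (simp add: \<gamma>)
  have H: "H holomorphic_on unit_disk" unfolding H_def using G by (intro holomorphic_intros)
  have hf: "f holomorphic_on unit_disk" using f by (simp add: bergman_space_iff)
  have cont: "continuous_on ({0..1} \<times> unit_disk) (\<lambda>x. \<Phi> (fst x) (snd x))"
    unfolding \<Phi>_def
  proof (intro continuous_intros)
    have sub: "(\<lambda>x. horo_map (fst x) (snd x)) ` ({0..1} \<times> unit_disk) \<subseteq> unit_disk"
      using horo_map_in_disk by force
    show "continuous_on ({0..1} \<times> unit_disk) (\<lambda>x. f (horo_map (fst x) (snd x)))"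
      using continuous_on_compose2[OF holomorphic_on_imp_continuous_on[OF hf] continuous_on_horo_map sub] .
    show "continuous_on ({0..1} \<times> unit_disk) (\<lambda>x. H (horo_map (fst x) (snd x)))"
      using continuous_on_compose2[OF holomorphic_on_imp_continuous_on[OF H] continuous_on_horo_map sub] .
  qed (use horo_denom_nonzero in force)
  have "bergman_mass p \<alpha> (volterra_op H f)
     = (\<integral>\<^sup>+z. ennreal (disk_weight \<alpha> z * cmod (volterra_op H f z) powr p) \<partial>lborel)"
    using volterra_op_holomorphic[OF hf H] p \<alpha>
    by (intro bergman_mass_eq holomorphic_on_imp_continuous_on)
  also have "\<dots> \<le> ennreal ((1 / \<gamma>) powr (p - 1) * (N * (L' powr p * (1 / \<gamma>) + B powr p * ((1 - a powr \<gamma>) / \<gamma>))))"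
  proof (rule nn_integral_powr_integral_le[where \<Phi> = \<Phi> and \<omega> = "\<lambda>t. t powr (\<gamma> - 1)" and c = c and S = unit_disk])
    show "continuous_on ({0<..<1} \<times> unit_disk) (\<lambda>(t, z). \<Phi> t z)"
      unfolding case_prod_unfold by (rule continuous_on_subset[OF cont]) (intro Sigma_mono, auto)
    show "continuous_on {0..1} (\<lambda>t. \<Phi> t z)" if "z \<in> unit_disk" for z
    proof -
      have "continuous_on {0..1} (\<lambda>t :: real. (t, z))"
        by (intro continuous_on_Pair continuous_on_id continuous_on_const)
      moreover have "(\<lambda>t :: real. (t, z)) ` {0..1} \<subseteq> {0..1} \<times> unit_disk" using that by auto
      ultimately show ?thesis using continuous_on_compose2[OF cont] by fastforce
    qed
    show "((\<lambda>t. \<Phi> t z) has_integral volterra_op H f z) {0..1}" if "z \<in> unit_disk" for z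
      unfolding \<Phi>_def using hf H that by (rule volterra_horo_has_integral)
    show "continuous_on {0<..<1} (\<lambda>t. t powr (\<gamma> - 1))"
      by (intro continuous_intros) auto
    have int1: "((\<lambda>t. t powr (\<gamma> - 1)) has_integral 1 / \<gamma>) {0..1}"
      using has_integral_powr_from_0[of "\<gamma> - 1" 1] \<open>\<gamma> > 0\<close> by simp
    then show "((\<lambda>t. t powr (\<gamma> - 1)) has_integral 1 / \<gamma>) {0..1}" .
    have "((\<lambda>t. N * (L' powr p * t powr (\<gamma> - 1) + B powr p * (t powr (\<gamma> - 1) * indicator {a..1} t)))
       has_integral N * (L' powr p * (1 / \<gamma>) + B powr p * ((1 - a powr \<gamma>) / \<gamma>))) {0..1}"
      using int1 has_integral_powr_indicator_Icc[of \<gamma> a] \<open>\<gamma> > 0\<close> a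
      by (intro has_integral_mult_right has_integral_add) auto
    then show "((\<lambda>t. t powr (\<gamma> - 1) * c t) has_integral N * (L' powr p * (1 / \<gamma>) + B powr p * ((1 - a powr \<gamma>) / \<gamma>))) {0..1}"
      by (rule has_integral_eq[rotated]) (simp add: c_def algebra_simps)
    show wt0: "disk_weight \<alpha> z = 0" if "z \<notin> unit_disk" for z
      using that by (auto simp: disk_weight_def)
    show "c t \<ge> 0" for t by (simp add: c_def N_def)
    fix t :: real assume t: "t \<in> {0<..<1}"
    define K where "K = L' powr p + B powr p * indicator {a..1} t"
    have "K \<ge> 0" by (simp add: K_def)
    have pw: "cmod (\<Phi> t z) powr p
        \<le> t powr (- p) * K * ?u t z"
      if z: "z \<in> unit_disk" for z
    proof -
      define w where "w = horo_map t z"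
      define M where "M = cmod ((1 - w) * G w)"
      have w: "w \<in> unit_disk" using t z by (simp add: w_def horo_map_in_disk[unfolded mem_ball_0])
      then have w1: "cmod w < 1" by simp
      define d where "d = horo_denom t z"
      have "d \<noteq> 0" using t z horo_denom_nonzero by (simp add: d_def)
      \<comment> \<open>The square of the denominator is shared out: one factor turns 1 - z into 1 -
        w, the other turns z into w/t. The latter supplies one more power of w, hence m + 1.\<close>
      have "\<Phi> t z = f w * (w ^ (m + j) * (G w * ((1 - z) / d))) * (z / d)"
      proof -
        have "\<Phi> t z = f w * (w ^ (m + j) * G w) * (z * (1 - z) / d\<^sup>2)"
          by (simp only: \<Phi>_def H_def w_def d_def)
        then show ?thesis by (simp add: power2_eq_square)
      qed
      also have "(1 - z) / d = 1 - w"
        using t z by (simp add: d_def w_def one_minus_horo_map)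
      also have "z / d = w / of_real t"
        using t by (simp add: w_def horo_map_def d_def)
      finally have "\<Phi> t z = (w ^ j * ((1 - w) * G w)) * (w ^ (m + 1) * f w) / of_real t"
        by (simp add: power_add mult_ac)
      then have "cmod (\<Phi> t z) = (cmod w ^ j * M) * (cmod w ^ (m + 1) * cmod (f w)) / t"
        using t by (simp add: M_def norm_mult norm_divide norm_power)
      then have "cmod (\<Phi> t z) powr p
          = (cmod w ^ j * M) powr p * ((cmod w ^ (m + 1)) powr p * cmod (f w) powr p) * t powr (- p)"
      proof -
        have "(x * (y * u) / t) powr p = x powr p * (y powr p * u powr p) * t powr (- p)"
          if "x \<ge> 0" "y \<ge> 0" "u \<ge> 0" for x y u :: real
          using that t by (simp add: powr_mult powr_divide powr_minus_divide)
        then show ?thesis using \<open>cmod (\<Phi> t z) = _\<close> by (simp add: M_def)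
      qed
      also have "\<dots> \<le> K * (cmod w powr (4 + 2 * \<alpha>) * cmod (f w) powr p) * t powr (- p)"
      proof (intro mult_right_mono mult_mono)
        show "(cmod w ^ j * M) powr p \<le> K"
        proof (cases "t \<le> a")
          case True
          then have "(cmod w ^ j * M) powr p \<le> L' powr p"
            using near[of t z] t z p unfolding w_def M_def by (intro powr_mono2) auto
          then show ?thesis using B by (simp add: K_def add_increasing2)
        next
          case False
          have "cmod w ^ j * M \<le> 1 * B"
            using B(1)[OF w] w1 unfolding M_def by (intro mult_mono power_le_one) auto
          then have "(cmod w ^ j * M) powr p \<le> B powr p"
            using p by (intro powr_mono2) (auto simp: M_def)
          then show ?thesis using False t by (simp add: K_def add_increasing)
        qed
        show "(cmod w ^ (m + 1)) powr p \<le> cmod w powr (4 + 2 * \<alpha>)"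
        proof (cases "w = 0")
          case False
          have "(cmod w ^ (m + 1)) powr p = (cmod w powr real (m + 1)) powr p"
            using False by (subst powr_realpow) auto
          also have "\<dots> = cmod w powr (p * (real m + 1))"
            by (simp add: powr_powr algebra_simps)
          also have "\<dots> \<le> cmod w powr (4 + 2 * \<alpha>)"
            using m w1 by (intro powr_mono') auto
          finally show ?thesis .
        qed simp
      qed (use \<open>K \<ge> 0\<close> in auto)
      finally show ?thesis by (simp add: w_def mult_ac)
    qed
    have "(\<integral>\<^sup>+z. ennreal (disk_weight \<alpha> z * cmod (\<Phi> t z) powr p) \<partial>lborel)
       \<le> (\<integral>\<^sup>+z. ennreal (t powr (- p) * K) * ennreal (disk_weight \<alpha> z *
            ?u t z) \<partial>lborel)"
    proof (intro nn_integral_mono, subst ennreal_mult'[symmetric])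
      fix z
      show "ennreal (disk_weight \<alpha> z * cmod (\<Phi> t z) powr p)
         \<le> ennreal (t powr (- p) * K * (disk_weight \<alpha> z *
            ?u t z))"
        using mult_left_mono[OF pw[of z] disk_weight_nonneg[OF \<alpha>, of z]] wt0[of z]
        by (cases "z \<in> unit_disk") (auto simp: mult_ac intro!: ennreal_leI)
    qed (use \<open>K \<ge> 0\<close> in auto)
    also have "\<dots> = ennreal (t powr (- p) * K) * (\<integral>\<^sup>+z. ennreal (disk_weight \<alpha> z *
            ?u t z) \<partial>lborel)"
    proof (intro nn_integral_cmult)
      note bergman_space_measurable[OF f, measurable]
      have [measurable]: "horo_map t \<in> borel_measurable borel"
        unfolding horo_map_def[abs_def] by measurable
      show "(\<lambda>z. ennreal (disk_weight \<alpha> z * ?u t z))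
         \<in> borel_measurable lborel" by measurable
    qed
    also have "\<dots> \<le> ennreal (t powr (- p) * K) * ennreal (t powr (2 + \<alpha>) * N)"
      unfolding N_def using t by (intro mult_left_mono nn_integral_horo_map_le f p \<alpha>) auto
    also have "\<dots> = ennreal ((t powr (\<gamma> - 1)) powr p * c t)"
    proof -
      have "(t powr (\<gamma> - 1)) powr p = t powr (- p) * t powr (2 + \<alpha>)"
        unfolding powr_powr powr_add[symmetric] using p\<gamma> by (simp add: algebra_simps)
      then show ?thesis
        using \<open>K \<ge> 0\<close> by (subst ennreal_mult'[symmetric]) (auto simp: c_def K_def mult_ac)
    qed
    finally show "(\<integral>\<^sup>+z. ennreal (disk_weight \<alpha> z * cmod (\<Phi> t z) powr p) \<partial>lborel)
       \<le> ennreal ((t powr (\<gamma> - 1)) powr p * c t)" .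
  qed (use p \<alpha> \<open>\<gamma> > 0\<close> in \<open>auto simp: disk_weight_nonneg\<close>)
  also have "(1 / \<gamma>) powr (p - 1) * (N * (L' powr p * (1 / \<gamma>) + B powr p * ((1 - a powr \<gamma>) / \<gamma>)))
     = ((1 / \<gamma>) powr (p - 1) * (1 / \<gamma>)) * (L' powr p + B powr p * (1 - a powr \<gamma>)) * N"
    using \<open>\<gamma> > 0\<close> by (simp add: field_simps)
  also have "(1 / \<gamma>) powr (p - 1) * (1 / \<gamma>) = (1 / \<gamma>) powr p"
    using \<open>\<gamma> > 0\<close> powr_mult_base[of "1 / \<gamma>" "p - 1"] by simp
  finally show ?thesis by (simp add: H_def N_def)
qed

text \<open>For \<open>t \<le> a < 1\<close> the images of \<^term>\<open>horo_map t\<close> lie in one horodisk, which touches the unit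
  circle at 1 only; a high power of \<open>z\<close> is therefore small there away from 1.\<close>

lemma volterra_monomial_norm_le:
  fixes p \<alpha> L e :: real
  assumes p: "p > 1" and \<alpha>: "\<alpha> \<ge> 0" and G: "G holomorphic_on unit_disk"
    and bounded: "bounded ((\<lambda>z. (1 - z) * G z) ` unit_disk)"
    and lim: "((\<lambda>z. cmod ((1 - z) * G z)) \<longlongrightarrow> L) (at 1 within unit_disk)"
    and "L \<ge> 0" "e > 0"
  obtains m :: nat where
    "\<And>f. f \<in> bergman_space p \<alpha> \<Longrightarrow> volterra_op (\<lambda>z. z ^ m * G z) f \<in> bergman_space p \<alpha>"
    "\<And>f. f \<in> bergman_space p \<alpha> \<Longrightarrow>
       bergman_norm p \<alpha> (volterra_op (\<lambda>z. z ^ m * G z) f) \<le> (L * p / (2 + \<alpha>) + e) * bergman_norm p \<alpha> f"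
proof -
  define \<gamma> where "\<gamma> = (2 + \<alpha>) / p"
  have "\<gamma> > 0" using p \<alpha> by (simp add: \<gamma>_def)
  obtain B where B: "B > 0" "\<And>z. z \<in> unit_disk \<Longrightarrow> cmod ((1 - z) * G z) \<le> B"
    using bounded unfolding bounded_pos by auto
  \<comment> \<open>Halfway between L and L + e \<gamma>: one half of the slack is for the
    neighbourhood of 1, the other for the times t near 1.\<close>
  define L' where "L' = L + e * \<gamma> / 2"
  have L': "L' > L" "L' > 0" using \<open>L \<ge> 0\<close> \<open>e > 0\<close> \<open>\<gamma> > 0\<close> by (auto simp: L'_def add_nonneg_pos)
  \<comment> \<open>The room that remains for B^p (1 - a^\<gamma>), the contribution of the times t
    in [a, 1]; \<open>q\<close> and \<open>a\<close> are chosen to fit into it.\<close>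
  define gap where "gap = (L + e * \<gamma>) powr p - L' powr p"
  have "gap > 0"
    using p L' \<open>e > 0\<close> \<open>\<gamma> > 0\<close> by (auto simp: gap_def L'_def intro!: powr_less_mono2)
  define q where "q = min (1 / 2) (gap / B powr p)"
  have q: "0 < q" "q \<le> 1 / 2" "B powr p * q \<le> gap"
  proof -
    show "0 < q" "q \<le> 1 / 2" using \<open>gap > 0\<close> B by (auto simp: q_def min_def)
    have "B powr p * q \<le> B powr p * (gap / B powr p)"
      by (intro mult_left_mono) (auto simp: q_def)
    then show "B powr p * q \<le> gap" using B by simp
  qed
  define a where "a = (1 - q) powr (1 / \<gamma>)"
  have a: "0 < a" "a < 1" "1 - a powr \<gamma> = q"
    using q \<open>\<gamma> > 0\<close> powr_less_mono2[of "1 / \<gamma>" "1 - q" 1] by (auto simp: a_def powr_powr)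
  obtain \<eta> where \<eta>: "0 < \<eta>" "\<eta> \<le> 1" "\<And>z. z \<in> unit_disk \<Longrightarrow> dist z 1 < \<eta> \<Longrightarrow> cmod ((1 - z) * G z) < L'"
  proof -
    have "\<forall>\<^sub>F z in at 1 within unit_disk. cmod ((1 - z) * G z) < L'"
      using lim L'(1) by (rule order_tendstoD)
    then obtain d where "d > 0" and d: "\<And>z. z \<in> unit_disk \<Longrightarrow> z \<noteq> 1 \<Longrightarrow> dist z 1 < d \<Longrightarrow> cmod ((1 - z) * G z) < L'"
      by (auto simp: eventually_at)
    have "cmod ((1 - z) * G z) < L'" if "z \<in> unit_disk" "dist z 1 < d" for z
      using d[OF that(1) _ that(2)] L'(2) by (cases "z = 1") auto
    then show ?thesis using \<open>d > 0\<close> by (intro that[of "min d 1"]) auto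
  qed
  \<comment> \<open>A point w of the horodisk with |1 - w| >= \<eta> satisfies |w|^2 <= 1 - (1 - a)
    \<eta>^2, so |w| <= \<rho> < 1 and a high power of w beats the bound \<open>B\<close>. The
    radicand is nonnegative since \<eta> <= 1.\<close>
  define \<rho> where "\<rho> = sqrt (1 - (1 - a) * \<eta>\<^sup>2)"
  have \<eta>sq: "0 < (1 - a) * \<eta>\<^sup>2" "(1 - a) * \<eta>\<^sup>2 \<le> 1"
    using a \<eta> by (auto intro!: mult_le_one power_le_one)
  then have \<rho>: "0 \<le> \<rho>" "\<rho> < 1" by (auto simp: \<rho>_def)
  obtain j where j: "\<rho> ^ j * B < L'"
  proof -
    have "(\<lambda>j. \<rho> ^ j * B) \<longlonglongrightarrow> 0 * B"
      using \<rho> by (intro tendsto_mult LIMSEQ_power_zero tendsto_const) auto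
    then have "\<forall>\<^sub>F j in sequentially. \<rho> ^ j * B < L'"
      using L' by (auto dest: order_tendstoD(2))
    then show ?thesis using that by (auto dest: eventually_happens)
  qed
  obtain m :: nat where m: "(4 + 2 * \<alpha>) / p < real m" using reals_Archimedean2 by blast
  then have m': "4 + 2 * \<alpha> \<le> p * (real m + 1)" using p by (simp add: field_simps)
  have near: "cmod w ^ j * cmod ((1 - w) * G w) \<le> L'"
    if "0 < t" "t \<le> a" "z \<in> unit_disk" and w_def: "w = horo_map t z" for t z w
  proof -
    have w: "w \<in> unit_disk" unfolding w_def using that a by (intro horo_map_in_disk) auto
    then have w1: "cmod w < 1" by simp
    show ?thesis
    proof (cases "dist w 1 < \<eta>")
      case True
      then have "cmod w ^ j * cmod ((1 - w) * G w) \<le> 1 * L'"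
        using \<eta>(3)[OF w] w1 by (intro mult_mono power_le_one) auto
      then show ?thesis by simp
    next
      case False
      have "(1 - a) * \<eta>\<^sup>2 \<le> (1 - t) * (cmod (1 - w))\<^sup>2"
        using False that a \<eta> by (intro mult_mono power_mono) (auto simp: dist_norm norm_minus_commute)
      also have "\<dots> \<le> 1 - (cmod w)\<^sup>2"
        unfolding w_def using that a by (intro horodisk) auto
      finally have "cmod w \<le> \<rho>" unfolding \<rho>_def by (intro real_le_rsqrt) auto
      then have "cmod w ^ j * cmod ((1 - w) * G w) \<le> \<rho> ^ j * B"
        using B(2)[OF w] \<rho> B(1) by (intro mult_mono power_mono) auto
      then show ?thesis using j by simp
    qed
  qed
  have le: "bergman_mass p \<alpha> (volterra_op (\<lambda>z. z ^ (m + j) * G z) f)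
      \<le> ennreal (((L * p / (2 + \<alpha>) + e) * bergman_norm p \<alpha> f) powr p)"
    if f: "f \<in> bergman_space p \<alpha>" for f
  proof -
    have "bergman_mass p \<alpha> (volterra_op (\<lambda>z. z ^ (m + j) * G z) f)
      \<le> ennreal ((1 / \<gamma>) powr p * (L' powr p + B powr p * (1 - a powr \<gamma>)) * bergman_norm p \<alpha> f powr p)"
      using B L' a near by (intro volterra_monomial_mass_le[OF p \<alpha> G _ _ m' _ _ _ _ f \<gamma>_def]) auto
    also have "\<dots> \<le> ennreal ((1 / \<gamma>) powr p * (L + e * \<gamma>) powr p * bergman_norm p \<alpha> f powr p)"
      using q(3) a(3) by (intro ennreal_leI mult_right_mono mult_left_mono) (auto simp: gap_def)
    also have "(1 / \<gamma>) powr p * (L + e * \<gamma>) powr p * bergman_norm p \<alpha> f powr p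
       = (1 / \<gamma> * (L + e * \<gamma>) * bergman_norm p \<alpha> f) powr p"
    proof -
      have "L + e * \<gamma> \<ge> 0" using \<open>\<gamma> > 0\<close> \<open>L \<ge> 0\<close> \<open>e > 0\<close> by simp
      then show ?thesis using \<open>\<gamma> > 0\<close> by (simp add: powr_mult powr_divide)
    qed
    also have "1 / \<gamma> * (L + e * \<gamma>) = L * p / (2 + \<alpha>) + e"
    proof -
      have "1 / \<gamma> * (L + e * \<gamma>) = L * (1 / \<gamma>) + e" using \<open>\<gamma> > 0\<close> by (simp add: field_simps)
      then show ?thesis by (simp add: \<gamma>_def)
    qed
    finally show ?thesis .
  qed
  have sp: "volterra_op (\<lambda>z. z ^ (m + j) * G z) f \<in> bergman_space p \<alpha>" if "f \<in> bergman_space p \<alpha>" for f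
    using that G le[OF that]
    by (intro volterra_op_in_bergman_space) (auto intro!: holomorphic_intros intro: le_less_trans)
  have "0 \<le> L * p / (2 + \<alpha>) + e" using p \<alpha> \<open>L \<ge> 0\<close> \<open>e > 0\<close> by (intro add_nonneg_nonneg) auto
  then have nm: "bergman_norm p \<alpha> (volterra_op (\<lambda>z. z ^ (m + j) * G z) f)
      \<le> (L * p / (2 + \<alpha>) + e) * bergman_norm p \<alpha> f" if "f \<in> bergman_space p \<alpha>" for f
    using p that by (intro bergman_norm_leI le bergman_space_continuous[OF sp]) auto
  show ?thesis using that[of "m + j"] sp nm by blast
qed

section \<open>Peak functions\<close>

definition peak :: "real \<Rightarrow> complex \<Rightarrow> complex" where
  "peak \<beta> z = (if z \<in> unit_disk then (1 - z) powr (- of_real \<beta>) else 0)"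

lemma Re_one_minus_pos: "z \<in> unit_disk \<Longrightarrow> Re (1 - z) > 0"
  using complex_Re_le_cmod[of z] by simp

lemma cmod_one_minus_pos: "z \<in> unit_disk \<Longrightarrow> cmod (1 - z) > 0"
  using Re_one_minus_pos by fastforce

lemma one_minus_notin_nonpos_Reals: "z \<in> unit_disk \<Longrightarrow> 1 - z \<notin> \<real>\<^sub>\<le>\<^sub>0"
  using Re_one_minus_pos[of z] by (auto simp: complex_nonpos_Reals_iff)

text \<open>The exponent is real, so the argument of 1 - z does not enter the modulus.\<close>

lemma cmod_peak: "z \<in> unit_disk \<Longrightarrow> cmod (peak \<beta> z) = cmod (1 - z) powr (- \<beta>)"
  using cmod_one_minus_pos[of z]
  by (auto simp: peak_def powr_def norm_exp_eq_Re Re_Ln)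

lemma powr_one_minus_has_field_derivative:
  assumes "z \<in> unit_disk"
  shows "((\<lambda>z. (1 - z) powr (- of_real \<beta>)) has_field_derivative of_real \<beta> * ((1 - z) powr (- of_real \<beta>) / (1 - z))) (at z)"
proof -
  have "((\<lambda>z. (1 - z) powr (- of_real \<beta>)) has_field_derivative - (- of_real \<beta> * (1 - z) powr (- of_real \<beta> - 1))) (at z)"
    using one_minus_notin_nonpos_Reals[OF assms]
    by (auto intro!: derivative_eq_intros DERIV_chain2[OF has_field_derivative_powr])
  moreover have "(1 - z) powr (- of_real \<beta> - 1) = (1 - z) powr (- of_real \<beta>) / (1 - z)"
    using cmod_one_minus_pos[OF assms] by (subst powr_diff) (auto simp: powr_to_1)
  ultimately show ?thesis by simp
qed

lemma peak_holomorphic: "peak \<beta> holomorphic_on unit_disk"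
proof -
  have "(\<lambda>z. (1 - z) powr (- of_real \<beta>)) holomorphic_on unit_disk"
    using powr_one_minus_has_field_derivative holomorphic_on_open[OF open_ball] by blast
  then show ?thesis by (rule holomorphic_transform) (simp add: peak_def)
qed

text \<open>The power (1 - z)^(-\<beta>) / \<beta> is a primitive of the integrand. The subtracted
  constant is its value at the base point 0, the only defect of an eigenfunction with eigenvalue
  1/\<beta>.\<close>

lemma volterra_op_peak:
  assumes "\<beta> > 0"
  shows "volterra_op (\<lambda>z. 1 / (1 - z)) (peak \<beta>)
     = (\<lambda>z. of_real (1 / \<beta>) * (peak \<beta> z - (if z \<in> unit_disk then 1 else 0)))"
proof
  fix z
  let ?F = "\<lambda>z. of_real (1 / \<beta>) * (1 - z) powr (- of_real \<beta>)"
  show "volterra_op (\<lambda>z. 1 / (1 - z)) (peak \<beta>) z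
     = of_real (1 / \<beta>) * (peak \<beta> z - (if z \<in> unit_disk then 1 else 0))"
  proof (cases "z \<in> unit_disk")
    case True
    then have sub: "closed_segment 0 z \<subseteq> unit_disk"
      by (intro closed_segment_subset) auto
    have "(?F has_field_derivative peak \<beta> w * (1 / (1 - w))) (at w within unit_disk)"
      if "w \<in> unit_disk" for w
      using DERIV_cmult[OF powr_one_minus_has_field_derivative[OF that, of \<beta>], of "of_real (1 / \<beta>)"] assms that
      by (auto simp: peak_def has_field_derivative_at_within)
    then have "((\<lambda>w. peak \<beta> w * (1 / (1 - w))) has_contour_integral ?F z - ?F 0) (linepath 0 z)"
      using contour_integral_primitive[of unit_disk ?F "\<lambda>w. peak \<beta> w * (1 / (1 - w))" "linepath 0 z"] sub
      by simp
    then show ?thesis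
      using True by (simp add: volterra_op_def contour_integral_unique peak_def right_diff_distrib)
  qed (simp add: volterra_op_def peak_def)
qed

text \<open>Dyadic layers: \<open>\<bar>1 - z\<bar>\<^sup>-\<^sup>s\<close> is at most \<open>2\<^sup>k\<^sup>s\<close> where \<open>\<bar>1 - z\<bar> \<ge> 2\<^sup>-\<^sup>k\<close>.\<close>

lemma nn_integral_one_minus_powr_finite:
  fixes s :: real
  assumes "0 < s" "s < 2"
  shows "(\<integral>\<^sup>+z. ennreal (indicator unit_disk z * cmod (1 - z) powr (- s)) \<partial>lborel) < \<infinity>"
proof -
  \<comment> \<open>Layer k is 2^(-k) <= |1 - z| < 2^(1 - k), contained in the ball of radius
    \<open>R k\<close> around 1; for k = 0 this is |1 - z| < 2.\<close>
  define R where "R = (\<lambda>k :: nat. 2 * (1 / 2) ^ k :: real)"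
  let ?u = "\<lambda>k z. ennreal ((2 powr s) ^ k) * indicator (ball (1 :: complex) (R k)) z"
  have "(\<integral>\<^sup>+z. ennreal (indicator unit_disk z * cmod (1 - z) powr (- s)) \<partial>lborel)
     \<le> (\<integral>\<^sup>+z. (\<Sum>k. ?u k z) \<partial>lborel)"
  proof (intro nn_integral_mono)
    fix z :: complex
    show "ennreal (indicator unit_disk z * cmod (1 - z) powr (- s))
       \<le> (\<Sum>k. ?u k z)"
    proof (cases "z \<in> unit_disk")
      case True
      define x where "x = cmod (1 - z)"
      have x: "0 < x" "x < 2"
        using cmod_one_minus_pos[OF True] norm_triangle_ineq4[of 1 z] True by (auto simp: x_def)
      define k where "k = (LEAST k :: nat. (1 / 2) ^ k \<le> x)"
      have "\<exists>k :: nat. (1 / 2) ^ k \<le> x"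
        using real_arch_pow_inv[OF x(1), of "1/2"] by (auto intro: less_imp_le)
      then have k: "(1 / 2) ^ k \<le> x" unfolding k_def by (rule LeastI_ex)
      have kx: "x < R k"
      proof (cases k)
        case 0
        then show ?thesis using x by (simp add: R_def)
      next
        case (Suc i)
        then have "\<not> (1 / 2) ^ i \<le> x" unfolding k_def by (metis lessI not_less_Least)
        then show ?thesis using Suc by (simp add: R_def)
      qed
      have "x powr (- s) \<le> ((1 / 2) ^ k) powr (- s)"
        using assms k by (intro powr_mono2') auto
      also have "\<dots> = (2 powr s) ^ k"
      proof -
        have "(1 / 2 :: real) ^ k = 2 powr (- real k)"
          by (simp add: powr_minus powr_realpow power_one_over inverse_eq_divide)
        moreover have "(2 powr s) ^ k = (2 powr s) powr real k"
          by (simp add: powr_realpow)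
        ultimately show ?thesis by (simp only: powr_powr) (simp add: mult.commute)
      qed
      finally have "ennreal (x powr (- s)) \<le> ?u k z"
        using kx by (simp add: x_def dist_norm ennreal_leI)
      also have "\<dots> \<le> (\<Sum>k. ?u k z)"
      proof -
        define u where "u = (\<lambda>k. ?u k z)"
        have "u k = sum u {k}" by simp
        also have "\<dots> \<le> suminf u" by (intro sum_le_suminf) auto
        finally show ?thesis by (simp only: u_def)
      qed
      finally show ?thesis using True by (simp add: x_def)
    qed simp
  qed
  also have "\<dots> = (\<Sum>k. \<integral>\<^sup>+z. ?u k z \<partial>lborel)"
    by (rule nn_integral_suminf)
      (rule borel_measurable_times_ennreal[OF borel_measurable_const borel_measurable_indicator], simp)
  also have "\<dots> = (\<Sum>k. ennreal ((2 powr s) ^ k) * emeasure lborel (ball (1 :: complex) (R k)))"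
    by (rule suminf_cong, rule nn_integral_cmult_indicator) simp
  \<comment> \<open>The k-th ball has area 4 pi 4^(-k), so the series is geometric with ratio 2^(s -
    2) < 1.\<close>
  also have "\<dots> = (\<Sum>k. ennreal (4 * pi * (2 powr (s - 2)) ^ k))"
  proof (rule suminf_cong)
    fix k :: nat
    have em: "emeasure lborel (ball (1 :: complex) (R k)) = ennreal (pi * (R k)\<^sup>2)"
      by (subst emeasure_ball) (auto simp: R_def unit_ball_vol_2)
    have eq: "(2 powr s) ^ k * (pi * (R k)\<^sup>2) = 4 * pi * (2 powr (s - 2)) ^ k"
    proof -
      have "((1 / 2 :: real) ^ k)\<^sup>2 = (1 / 4) ^ k"
        unfolding power2_eq_square power_mult_distrib[symmetric] by simp
      then have "(R k)\<^sup>2 = 4 * (1 / 4) ^ k"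
        unfolding R_def power_mult_distrib by simp
      moreover have "2 powr (s - 2) = 2 powr s * (1 / 4 :: real)"
        by (simp add: powr_diff)
      ultimately show ?thesis
        by (simp only: power_mult_distrib mult_ac)
    qed
    show "ennreal ((2 powr s) ^ k) * emeasure lborel (ball (1 :: complex) (R k))
        = ennreal (4 * pi * (2 powr (s - 2)) ^ k)"
      unfolding em by (subst ennreal_mult'[symmetric]) (simp_all only: eq zero_le_power powr_ge_zero)
  qed
  also have "\<dots> < \<infinity>"
  proof -
    have "(2 :: real) powr (s - 2) < 2 powr 0" using assms by (intro powr_less_mono) auto
    then have "summable (\<lambda>k. 4 * pi * (2 powr (s - 2)) ^ k)"
      by (intro summable_mult summable_geometric) auto
    then have "(\<Sum>k. ennreal (4 * pi * (2 powr (s - 2)) ^ k)) \<noteq> top"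
      by (rule ennreal_suminf_neq_top) (intro mult_nonneg_nonneg zero_le_power, auto)
    then show ?thesis unfolding infinity_ennreal_def top.not_eq_extremum .
  qed
  finally show ?thesis .
qed

text \<open>Since 1 - |z|^2 <= 2 |1 - z|, the weighted p-th power is at most a constant times |1 -
  z|^(-(\<beta> p - \<alpha>)). The two conditions on \<beta> put the exponent strictly between 0
  and 2.\<close>

lemma peak_in_bergman_space:
  assumes p: "p > 1" and \<alpha>: "\<alpha> \<ge> 0" and \<beta>: "\<alpha> < \<beta> * p" "\<beta> * p < 2 + \<alpha>"
  shows "peak \<beta> \<in> bergman_space p \<alpha>"
proof -
  define C where "C = (1 + \<alpha>) * 2 powr \<alpha> / pi"
  have "bergman_mass p \<alpha> (peak \<beta>) = (\<integral>\<^sup>+z. ennreal (disk_weight \<alpha> z * cmod (peak \<beta> z) powr p) \<partial>lborel)"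
    using peak_holomorphic p \<alpha> by (intro bergman_mass_eq holomorphic_on_imp_continuous_on)
  also have "\<dots> \<le> (\<integral>\<^sup>+z. ennreal C * ennreal (indicator unit_disk z * cmod (1 - z) powr (- (\<beta> * p - \<alpha>))) \<partial>lborel)"
  proof (intro nn_integral_mono, subst ennreal_mult'[symmetric])
    fix z
    show "ennreal (disk_weight \<alpha> z * cmod (peak \<beta> z) powr p)
       \<le> ennreal (C * (indicator unit_disk z * cmod (1 - z) powr (- (\<beta> * p - \<alpha>))))"
    proof (intro ennreal_leI, cases "z \<in> unit_disk")
      case True
      define x where "x = cmod (1 - z)"
      have "x > 0" using cmod_one_minus_pos[OF True] by (simp add: x_def)
      have "1 - cmod z \<le> x" using norm_triangle_ineq2[of 1 z] by (simp add: x_def)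
      have "1 - (cmod z)\<^sup>2 = (1 + cmod z) * (1 - cmod z)" by (simp add: power2_eq_square algebra_simps)
      also have "\<dots> \<le> 2 * x" using True \<open>1 - cmod z \<le> x\<close> by (intro mult_mono) auto
      finally have "(1 - (cmod z)\<^sup>2) powr \<alpha> \<le> (2 * x) powr \<alpha>"
        using True \<alpha> by (intro powr_mono2) (auto simp: power_le_one)
      also have "\<dots> = 2 powr \<alpha> * x powr \<alpha>" using \<open>x > 0\<close> by (simp add: powr_mult)
      finally have "(1 + \<alpha>) * (1 - (cmod z)\<^sup>2) powr \<alpha> / pi \<le> (1 + \<alpha>) * (2 powr \<alpha> * x powr \<alpha>) / pi"
        using \<alpha> by (intro divide_right_mono mult_left_mono) auto
      then have "disk_weight \<alpha> z \<le> C * x powr \<alpha>"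
        using True by (simp add: disk_weight_def C_def mult_ac)
      then have "disk_weight \<alpha> z * x powr (- \<beta> * p) \<le> C * x powr \<alpha> * x powr (- \<beta> * p)"
        by (intro mult_right_mono) auto
      also have "\<dots> = C * x powr (- (\<beta> * p - \<alpha>))"
        by (simp add: mult.assoc flip: powr_add)
      finally show "disk_weight \<alpha> z * cmod (peak \<beta> z) powr p
         \<le> C * (indicator unit_disk z * cmod (1 - z) powr (- (\<beta> * p - \<alpha>)))"
        using True by (simp add: cmod_peak powr_powr x_def)
    qed (auto simp: disk_weight_def)
  qed (use \<alpha> in \<open>simp add: C_def\<close>)
  also have "\<dots> = ennreal C * (\<integral>\<^sup>+z. ennreal (indicator unit_disk z * cmod (1 - z) powr (- (\<beta> * p - \<alpha>))) \<partial>lborel)"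
  proof (intro nn_integral_cmult)
    have [measurable]: "(unit_disk :: complex set) \<in> sets borel" by simp
    show "(\<lambda>z :: complex. ennreal (indicator unit_disk z * cmod (1 - z) powr (- (\<beta> * p - \<alpha>)))) \<in> borel_measurable lborel"
      by measurable
  qed
  also have "\<dots> < \<infinity>"
    using nn_integral_one_minus_powr_finite[of "\<beta> * p - \<alpha>"] \<beta> by (simp add: ennreal_mult_less_top)
  finally show ?thesis
    using peak_holomorphic by (auto simp: bergman_space_iff peak_def)
qed

text \<open>The contraction \<open>z \<mapsto> (1 + z) / 2\<close> of the disk towards 1 does not decrease the integral.\<close>

lemma nn_integral_critical_peak_eq_top:
  assumes \<alpha>: "\<alpha> \<ge> 0"
  shows "(\<integral>\<^sup>+z. ennreal (disk_weight \<alpha> z * cmod (1 - z) powr (- (2 + \<alpha>))) \<partial>lborel) = \<infinity>"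
proof (rule ccontr)
  define F where "F = (\<lambda>z. disk_weight \<alpha> z * cmod (1 - z) powr (- (2 + \<alpha>)))"
  define I where "I = (\<integral>\<^sup>+z. ennreal (F z) \<partial>lborel)"
  assume "\<not> ?thesis"
  then have fin: "I \<noteq> \<infinity>" by (simp add: I_def F_def)
  have F0: "F z \<ge> 0" for z using \<alpha> by (simp add: F_def disk_weight_nonneg)
  have [measurable]: "F \<in> borel_measurable borel" unfolding F_def by measurable
  define \<phi> where "\<phi> = (\<lambda>z :: complex. (1 + z) / 2)"
  \<comment> \<open>A disk in the left half-plane; the contracted disk \<open>\<phi>\<close> lies in
    Re > 0 and misses it.\<close>
  define S where "S = ball (- 1 / 2 :: complex) (1 / 4)"
  have [measurable]: "S \<in> sets borel" by (simp add: S_def)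
  have \<phi>: "\<phi> z \<in> unit_disk" if "z \<in> unit_disk" for z
    using that norm_triangle_ineq[of 1 z] by (simp add: \<phi>_def norm_divide)
  let ?I = "\<lambda>S. \<integral>\<^sup>+z. ennreal (indicator S z * F z) \<partial>lborel"
  have disj: "S \<inter> \<phi> ` unit_disk = {}"
  proof -
    have "Re (\<phi> z) > 0" if "z \<in> unit_disk" for z
      using that abs_Re_le_cmod[of z] by (simp add: \<phi>_def)
    moreover have "Re w < 0" if "w \<in> S" for w
      using that abs_Re_le_cmod[of "- 1 / 2 - w"] by (simp add: S_def dist_norm)
    ultimately show ?thesis by force
  qed
  have "open (\<phi> ` unit_disk)"
    by (rule open_mapping_thm3) (auto simp: \<phi>_def inj_on_def intro!: holomorphic_intros)
  then have [measurable]: "\<phi> ` unit_disk \<in> sets borel" by simp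
  have "I = (\<integral>\<^sup>+z. ennreal (indicator unit_disk z * F z) \<partial>lborel)"
    unfolding I_def by (intro nn_integral_cong) (auto simp: F_def disk_weight_def split: split_indicator)
  \<comment> \<open>Scale invariance at the critical exponent: passing from z to \<phi>(z), the
    weight loses at most the factor 2^\<alpha> and |1 - z|^(-(2 + \<alpha>)) gains 2^(2 + \<alpha>).
    The net gain of 4 cancels the Jacobian 1/4.\<close>
  also have "\<dots> \<le> (\<integral>\<^sup>+z. ennreal (indicator unit_disk z * ((cmod (1 / 2))\<^sup>2 * F (\<phi> z))) \<partial>lborel)"
  proof (intro nn_integral_mono ennreal_leI)
    fix z :: complex
    show "indicator unit_disk z * F z \<le> indicator unit_disk z * ((cmod (1 / 2))\<^sup>2 * F (\<phi> z))"
    proof (cases "z \<in> unit_disk")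
      case True
      define x where "x = cmod (1 - z)"
      have "x > 0" using cmod_one_minus_pos[OF True] by (simp add: x_def)
      have "1 - \<phi> z = (1 - z) / 2" by (simp add: \<phi>_def field_simps)
      then have x\<phi>: "cmod (1 - \<phi> z) = x / 2" by (simp only: x_def norm_divide norm_numeral)
      have "2 * (1 - (cmod (\<phi> z))\<^sup>2) - (1 - (cmod z)\<^sup>2) = x\<^sup>2 / 2"
        unfolding \<phi>_def x_def norm_divide power_divide cmod_power2 by (simp add: power2_eq_square field_simps)
      then have "1 - (cmod z)\<^sup>2 \<le> 2 * (1 - (cmod (\<phi> z))\<^sup>2)"
        by (smt (verit) zero_le_power2 divide_nonneg_nonneg)
      then have 1: "(1 - (cmod z)\<^sup>2) powr \<alpha> \<le> (2 * (1 - (cmod (\<phi> z))\<^sup>2)) powr \<alpha>"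
        using True \<alpha> by (intro powr_mono2) (auto simp: power_le_one)
      have 2: "(2 * (1 - (cmod (\<phi> z))\<^sup>2)) powr \<alpha> = 2 powr \<alpha> * (1 - (cmod (\<phi> z))\<^sup>2) powr \<alpha>"
        by (rule powr_mult)
      have "(1 + \<alpha>) / pi * (1 - (cmod z)\<^sup>2) powr \<alpha>
          \<le> (1 + \<alpha>) / pi * (2 powr \<alpha> * (1 - (cmod (\<phi> z))\<^sup>2) powr \<alpha>)"
        using \<alpha> 1 unfolding 2 by (intro mult_left_mono) auto
      then have "disk_weight \<alpha> z \<le> 2 powr \<alpha> * disk_weight \<alpha> (\<phi> z)"
        using True \<phi>[OF True] by (simp add: disk_weight_def mult_ac)
      then have 3: "disk_weight \<alpha> z * x powr (- (2 + \<alpha>)) \<le> 2 powr \<alpha> * disk_weight \<alpha> (\<phi> z) * x powr (- (2 + \<alpha>))"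
        by (rule mult_right_mono) (rule powr_ge_zero)
      have "(x / 2) powr (- b) = x powr (- b) * 2 powr b" for b
        using \<open>x > 0\<close> by (simp add: powr_divide powr_minus_divide)
      then have "(x / 2) powr (- (2 + \<alpha>)) = x powr (- (2 + \<alpha>)) * 2 powr (2 + \<alpha>)" .
      also have "(2 :: real) powr (2 + \<alpha>) = 4 * 2 powr \<alpha>"
        by (simp add: powr_add)
      finally have 4: "2 powr \<alpha> * disk_weight \<alpha> (\<phi> z) * x powr (- (2 + \<alpha>))
          = 1 / 4 * (disk_weight \<alpha> (\<phi> z) * (x / 2) powr (- (2 + \<alpha>)))"
        by (simp add: mult_ac)
      have "F z \<le> 1 / 4 * F (\<phi> z)"
        unfolding F_def x\<phi> x_def[symmetric] using 3 unfolding 4 .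
      moreover have eq: "(cmod (1 / 2))\<^sup>2 = 1 / 4" by (simp add: norm_divide power2_eq_square)
      ultimately show ?thesis unfolding eq using True by simp
    qed simp
  qed
  also have "\<dots> \<le> ?I (\<phi> ` unit_disk)"
    using F0 by (intro nn_integral_change_of_variables_complex_le)
      (auto simp: \<phi>_def inj_on_def intro!: derivative_eq_intros)
  finally have le: "I \<le> ?I (\<phi> ` unit_disk)" .
  \<comment> \<open>The image of \<phi> already carries all of \<open>I\<close>; a finite
    \<open>I\<close> leaves nothing for the disjoint disk \<open>S\<close>, although the integrand
    is positive there.\<close>
  have "I + ?I S
      \<le> ?I (\<phi> ` unit_disk) + ?I S"
    by (rule add_right_mono[OF le])
  also have "?I (\<phi> ` unit_disk) + ?I S
      = (\<integral>\<^sup>+z. ennreal (indicator (\<phi> ` unit_disk) z * F z) + ennreal (indicator S z * F z) \<partial>lborel)"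
    by (rule nn_integral_add[symmetric]) measurable
  also have "\<dots> \<le> I"
    unfolding I_def using disj F0 by (intro nn_integral_mono) (auto split: split_indicator)
  finally have "I + ?I S \<le> I + 0"
    by (simp only: add_0_right)
  then have "?I S = 0"
    using fin by (simp add: ennreal_add_left_cancel_le)
  then have "AE z in lborel. ennreal (indicator S z * F z) = 0"
    by (subst (asm) nn_integral_0_iff_AE) measurable
  moreover have "F z > 0" if "z \<in> S" for z
  proof -
    have "cmod z \<le> cmod (z - (- 1 / 2)) + cmod (- 1 / 2 :: complex)"
      using norm_triangle_ineq[of "z - (- 1 / 2)" "- 1 / 2"] by simp
    then have "cmod z < 1" using that by (simp add: S_def dist_norm norm_minus_commute norm_divide)
    moreover from this have "1 - (cmod z)\<^sup>2 > 0" by (simp add: power_less_one_iff abs_less_iff)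
    ultimately show ?thesis
      using \<alpha> cmod_one_minus_pos[of z]
      by (auto simp: F_def disk_weight_def intro!: mult_pos_pos divide_pos_pos)
  qed
  ultimately have "AE z in lborel. z \<notin> S"
    by (auto elim!: eventually_mono split: split_indicator_asm) (metis ennreal_eq_0_iff not_less)
  then have "emeasure lborel S = 0"
    by (subst (asm) AE_iff_measurable[of S]) auto
  then show False by (simp add: S_def emeasure_ball unit_ball_vol_2)
qed

section \<open>Null sequences and compact operators\<close>

text \<open>By Fatou's lemma the lower limit of the p-th powers of the norms is at least the
  integral at the critical exponent, which is infinite.\<close>

lemma bergman_norm_peak_at_top:
  assumes p: "p > 1" and \<alpha>: "\<alpha> \<ge> 0" and \<beta>: "\<beta> \<longlonglongrightarrow> (2 + \<alpha>) / p"
    and sp: "\<And>n. peak (\<beta> n) \<in> bergman_space p \<alpha>"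
  shows "filterlim (\<lambda>n. bergman_norm p \<alpha> (peak (\<beta> n))) at_top sequentially"
  unfolding filterlim_at_top_gt[where c = 0]
proof (intro allI impI)
  fix C :: real assume "C > 0"
  let ?u = "\<lambda>n z. ennreal (disk_weight \<alpha> z * cmod (peak (\<beta> n) z) powr p)"
  have "(\<integral>\<^sup>+z. ennreal (disk_weight \<alpha> z * cmod (1 - z) powr (- (2 + \<alpha>))) \<partial>lborel)
     = (\<integral>\<^sup>+z. liminf (\<lambda>n. ?u n z) \<partial>lborel)"
  proof (intro nn_integral_cong)
    fix z
    show "ennreal (disk_weight \<alpha> z * cmod (1 - z) powr (- (2 + \<alpha>)))
        = liminf (\<lambda>n. ?u n z)"
    proof (cases "z \<in> unit_disk")
      case True
      define x where "x = cmod (1 - z)"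
      have "x > 0" using cmod_one_minus_pos[OF True] by (simp add: x_def)
      have "(\<lambda>n. x powr (- \<beta> n * p)) \<longlonglongrightarrow> x powr (- ((2 + \<alpha>) / p) * p)"
        using \<open>x > 0\<close> \<beta> by (intro tendsto_powr tendsto_mult tendsto_minus tendsto_const) auto
      then have "(\<lambda>n. cmod (peak (\<beta> n) z) powr p) \<longlonglongrightarrow> x powr (- (2 + \<alpha>))"
        using True p by (simp add: cmod_peak powr_powr x_def)
      then have "(\<lambda>n. ?u n z)
          \<longlonglongrightarrow> ennreal (disk_weight \<alpha> z * x powr (- (2 + \<alpha>)))"
        by (intro tendsto_ennrealI tendsto_mult tendsto_const)
      then show ?thesis
        unfolding x_def by (intro lim_imp_Liminf[symmetric]) auto
    next
      case False
      then have "disk_weight \<alpha> z = 0" by (auto simp: disk_weight_def)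
      then show ?thesis by (simp add: Liminf_const)
    qed
  qed
  also have "\<dots> \<le> liminf (\<lambda>n. (\<integral>\<^sup>+z. ?u n z \<partial>lborel))"
  proof (intro nn_integral_liminf)
    fix n
    note bergman_space_measurable[OF sp[of n], measurable]
    show "(\<lambda>z. ?u n z) \<in> borel_measurable lborel"
      by measurable
  qed
  also have "\<dots> = liminf (\<lambda>n. ennreal (bergman_norm p \<alpha> (peak (\<beta> n)) powr p))"
    using bergman_mass_eq[OF bergman_space_continuous[OF sp] \<alpha> p] bergman_mass_eq_norm[OF sp p] by simp
  finally have "liminf (\<lambda>n. ennreal (bergman_norm p \<alpha> (peak (\<beta> n)) powr p)) = \<infinity>"
    using nn_integral_critical_peak_eq_top[OF \<alpha>] by (simp add: top.extremum_unique)
  then have "ennreal (C powr p) < liminf (\<lambda>n. ennreal (bergman_norm p \<alpha> (peak (\<beta> n)) powr p))"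
    by simp
  then have "\<forall>\<^sub>F n in sequentially. ennreal (C powr p) < ennreal (bergman_norm p \<alpha> (peak (\<beta> n)) powr p)"
    by (rule less_LiminfD)
  then show "\<forall>\<^sub>F n in sequentially. C \<le> bergman_norm p \<alpha> (peak (\<beta> n))"
  proof eventually_elim
    case (elim n)
    then have "C powr p < bergman_norm p \<alpha> (peak (\<beta> n)) powr p"
      by (simp add: ennreal_less_iff)
    then show ?case
      using powr_mono2[of p "bergman_norm p \<alpha> (peak (\<beta> n))" C] p by (force simp: not_le[symmetric])
  qed
qed

text \<open>A bounded sequence tending to 0 pointwise is asymptotically disjoint from any fixed element,
  so that the \<open>p\<close>-th powers of the norms nearly add up.\<close>

lemma bergman_norm_powr_add_null_sequence:
  assumes p: "p > 1" and F: "F \<in> bergman_space p \<alpha>"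
    and f: "\<And>n. f n \<in> bergman_space p \<alpha>" "\<And>n. bergman_norm p \<alpha> (f n) \<le> 1"
    and lim: "\<And>z. z \<in> unit_disk \<Longrightarrow> (\<lambda>n. f n z) \<longlonglongrightarrow> 0"
  shows "\<forall>\<^sub>F n in sequentially. bergman_norm p \<alpha> (\<lambda>z. F z + f n z) powr p \<le> bergman_norm p \<alpha> F powr p + 3"
proof -
  let ?M = "disk_measure \<alpha>"
  \<comment> \<open>Makes the coefficient l^(1 - p) equal to 2. The final constant 3 is this 2,
    times the norm bound 1, plus a slack of 1 from the limit.\<close>
  define l where "l = (2 :: real) powr (- 1 / (p - 1))"
  have l: "0 < l" "l < 1" using p powr_less_mono[of "- 1 / (p - 1)" 0 2] by (auto simp: l_def)
  have l2: "l powr (1 - p) = 2"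
  proof -
    have "- 1 / (p - 1) * (1 - p) = 1" using p by (simp add: field_simps)
    then show ?thesis unfolding l_def powr_powr by simp
  qed
  define C where "C = (1 - l) powr (1 - p)"
  have C: "C \<ge> 0" by (simp add: C_def)
  have norm_powr: "bergman_norm p \<alpha> h powr p = (\<integral>z. cmod (h z) powr p \<partial>?M)" for h
    using p by (simp add: bergman_norm_def powr_powr)
  have int: "integrable ?M (\<lambda>z. cmod (h z) powr p)" if "h \<in> bergman_space p \<alpha>" for h
    using that by (simp add: bergman_space_def)
  have le: "cmod (F z + f n z) powr p \<le> 2 * cmod (f n z) powr p + C * cmod (F z) powr p" for n z
  proof -
    have "cmod (F z + f n z) powr p \<le> (cmod (f n z) + cmod (F z)) powr p"
      using p norm_triangle_ineq[of "F z" "f n z"] by (intro powr_mono2) auto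
    also have "\<dots> \<le> l powr (1 - p) * cmod (f n z) powr p + (1 - l) powr (1 - p) * cmod (F z) powr p"
      using p l by (intro add_powr_le) auto
    finally show ?thesis by (simp add: l2 C_def)
  qed
  \<comment> \<open>The excess of |F + f_n|^p over 2 |f_n|^p. It is dominated by a multiple of |F|^p
    and tends to |F|^p pointwise, so dominated convergence applies although |f_n|^p itself has no
    integrable majorant.\<close>
  define u where "u = (\<lambda>n z. max 0 (cmod (F z + f n z) powr p - 2 * cmod (f n z) powr p))"
  have intF: "integrable ?M (\<lambda>z. cmod (F z + f n z) powr p)" for n
    by (intro int bergman_add F f p)
  have intu: "integrable ?M (u n)" for n
    unfolding u_def using intF int[OF f(1)] by (intro integrable_max) auto
  have "(\<lambda>n. \<integral>z. u n z \<partial>?M) \<longlonglongrightarrow> (\<integral>z. cmod (F z) powr p \<partial>?M)"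
  proof (rule integral_dominated_convergence[where w = "\<lambda>z. C * cmod (F z) powr p"])
    show "integrable ?M (\<lambda>z. C * cmod (F z) powr p)" using int[OF F] by simp
    show "AE z in ?M. norm (u n z) \<le> C * cmod (F z) powr p" for n
      using le[of _ n] C by (intro AE_I2) (auto simp: u_def max_def algebra_simps)
    show "AE z in ?M. (\<lambda>n. u n z) \<longlonglongrightarrow> cmod (F z) powr p"
    proof (intro AE_I2)
      fix z assume "z \<in> space ?M"
      then have "(\<lambda>n. f n z) \<longlonglongrightarrow> 0" using lim by simp
      then have "(\<lambda>n. u n z) \<longlonglongrightarrow> max 0 (cmod (F z + 0) powr p - 2 * cmod 0 powr p)"
        unfolding u_def using p
        by (intro tendsto_max tendsto_diff tendsto_powr' tendsto_norm tendsto_add tendsto_mult tendsto_const) auto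
      then show "(\<lambda>n. u n z) \<longlonglongrightarrow> cmod (F z) powr p" using p by simp
    qed
    show "u n \<in> borel_measurable ?M" for n using intu by (rule borel_measurable_integrable)
    show "(\<lambda>z. cmod (F z) powr p) \<in> borel_measurable ?M" using int[OF F] by (rule borel_measurable_integrable)
  qed
  then have "\<forall>\<^sub>F n in sequentially. (\<integral>z. u n z \<partial>?M) < (\<integral>z. cmod (F z) powr p \<partial>?M) + 1"
    by (rule order_tendstoD) simp
  then show ?thesis
  proof eventually_elim
    case (elim n)
    have "(\<integral>z. cmod (F z + f n z) powr p \<partial>?M) \<le> (\<integral>z. u n z + 2 * cmod (f n z) powr p \<partial>?M)"
      using intF intu int[OF f(1)] by (intro integral_mono) (auto simp: u_def)
    also have "\<dots> = (\<integral>z. u n z \<partial>?M) + 2 * bergman_norm p \<alpha> (f n) powr p"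
      using intu int[OF f(1)] by (simp add: norm_powr)
    also have "bergman_norm p \<alpha> (f n) powr p \<le> 1 powr p"
      using f p by (intro powr_mono2) auto
    finally show ?case using elim by (simp add: norm_powr)
  qed
qed

text \<open>If \<open>K\<close> were unbounded, suitable multiples h_n in the unit ball would have
  images of norm exactly n, and no subsequence of these converges.\<close>

lemma bergman_compact_imp_bounded:
  assumes p: "p > 1" and K: "bergman_compact p \<alpha> K"
  obtains C where "C \<ge> 0" "\<And>f. f \<in> bergman_space p \<alpha> \<Longrightarrow> bergman_norm p \<alpha> (K f) \<le> C * bergman_norm p \<alpha> f"
proof -
  have lin: "bergman_linear p \<alpha> K" using K by (simp add: bergman_compact_def)
  have "\<exists>C\<ge>0. \<forall>f\<in>bergman_space p \<alpha>. bergman_norm p \<alpha> (K f) \<le> C * bergman_norm p \<alpha> f"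
  proof (rule ccontr)
    assume neg: "\<not> ?thesis"
    have "\<exists>f. f \<in> bergman_space p \<alpha> \<and> real n * bergman_norm p \<alpha> f < bergman_norm p \<alpha> (K f)" for n :: nat
      using neg of_nat_0_le_iff[of n] by (meson not_le)
    then obtain f where f: "\<And>n. f n \<in> bergman_space p \<alpha>"
        "\<And>n. real n * bergman_norm p \<alpha> (f n) < bergman_norm p \<alpha> (K (f n))" by metis
    \<comment> \<open>The image is normalised rather than the function: the strict inequality
      guarantees that the norm of the image is positive, while that of \<open>f n\<close> might be
      0.\<close>
    define c where "c = (\<lambda>n. real n / bergman_norm p \<alpha> (K (f n)))"
    define h where "h = (\<lambda>n z. of_real (c n) * f n z)"
    have pos: "bergman_norm p \<alpha> (K (f n)) > 0" for n
      using f(2)[of n] by (rule le_less_trans[rotated]) simp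
    have c0: "c n \<ge> 0" for n using pos[of n] by (simp add: c_def less_imp_le)
    have h: "h n \<in> bergman_space p \<alpha>" for n
      unfolding h_def using f p by (intro bergman_scale)
    have "bergman_norm p \<alpha> (h n) \<le> 1" for n
    proof -
      have "bergman_norm p \<alpha> (h n) = c n * bergman_norm p \<alpha> (f n)"
        unfolding h_def using bergman_scale(2)[OF f(1) p, of "of_real (c n)"] c0 by simp
      also have "\<dots> \<le> 1" using f(2)[of n] pos[of n] by (simp add: c_def field_simps)
      finally show ?thesis .
    qed
    then obtain r k where rk: "strict_mono (r :: nat \<Rightarrow> nat)" "k \<in> bergman_space p \<alpha>"
        "(\<lambda>n. bergman_norm p \<alpha> (\<lambda>z. K (h (r n)) z - k z)) \<longlonglongrightarrow> 0"
      using K h unfolding bergman_compact_def by meson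
    have Kh: "K (h n) \<in> bergman_space p \<alpha>" "bergman_norm p \<alpha> (K (h n)) = real n" for n
    proof -
      have Kf: "K (f n) \<in> bergman_space p \<alpha>" using lin f by (simp add: bergman_linear_def)
      have "K (h n) = (\<lambda>z. of_real (c n) * K (f n) z)"
        unfolding h_def using lin f by (simp add: bergman_linear_def)
      then have "bergman_norm p \<alpha> (K (h n)) = cmod (of_real (c n)) * bergman_norm p \<alpha> (K (f n))"
        using bergman_scale(2)[OF Kf p] by (simp only:)
      also have "cmod (of_real (c n)) = c n" using c0 by simp
      finally show "bergman_norm p \<alpha> (K (h n)) = real n" using pos[of n] by (simp add: c_def)
      show "K (h n) \<in> bergman_space p \<alpha>" using lin h by (simp add: bergman_linear_def)
    qed
    have "\<forall>\<^sub>F n in sequentially. bergman_norm p \<alpha> (\<lambda>z. K (h (r n)) z - k z) < 1"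
      using rk(3) by (rule order_tendstoD) simp
    moreover have "\<forall>\<^sub>F n in sequentially. 1 + bergman_norm p \<alpha> k < real n"
      using filterlim_real_sequentially by (simp add: filterlim_at_top_dense)
    ultimately have "\<forall>\<^sub>F n in sequentially. False"
    proof eventually_elim
      case (elim n)
      have "real n \<le> real (r n)" using seq_suble[OF rk(1)] by simp
      also have "\<dots> = bergman_norm p \<alpha> (\<lambda>z. (K (h (r n)) z - k z) + k z)"
        using Kh(2)[of "r n"] by simp
      also have "\<dots> \<le> bergman_norm p \<alpha> (\<lambda>z. K (h (r n)) z - k z) + bergman_norm p \<alpha> k"
        using Kh rk p by (intro bergman_add bergman_diff)
      finally show ?case using elim by simp
    qed
    then show False by simp
  qed
  then show ?thesis using that by blast
qed

text \<open>Let the images converge to h along a subsequence. Adding N terms taken far enough apart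
  gives a function of norm at most (3 N)^(1/p), while its image differs from N h by at most e N.
  Boundedness of \<open>K\<close> then bounds the norm of h by e plus a multiple of N^(1/p - 1), and
  N may be arbitrarily large.\<close>

lemma bergman_compact_null_subsequence:
  assumes p: "p > 1" and K: "bergman_compact p \<alpha> K"
    and f: "\<And>n. f n \<in> bergman_space p \<alpha>" "\<And>n. bergman_norm p \<alpha> (f n) \<le> 1"
    and lim: "\<And>z. z \<in> unit_disk \<Longrightarrow> (\<lambda>n. f n z) \<longlonglongrightarrow> 0"
  obtains r where "strict_mono (r :: nat \<Rightarrow> nat)" "(\<lambda>n. bergman_norm p \<alpha> (K (f (r n)))) \<longlonglongrightarrow> 0"
proof -
  have lin: "bergman_linear p \<alpha> K" using K by (simp add: bergman_compact_def)
  obtain C where C: "C \<ge> 0" "\<And>f. f \<in> bergman_space p \<alpha> \<Longrightarrow> bergman_norm p \<alpha> (K f) \<le> C * bergman_norm p \<alpha> f"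
    using bergman_compact_imp_bounded[OF p K] by blast
  obtain r h where rh: "strict_mono (r :: nat \<Rightarrow> nat)" "h \<in> bergman_space p \<alpha>"
      "(\<lambda>n. bergman_norm p \<alpha> (\<lambda>z. K (f (r n)) z - h z)) \<longlonglongrightarrow> 0"
    using K f unfolding bergman_compact_def by meson
  let ?d = "\<lambda>n. bergman_norm p \<alpha> (\<lambda>z. K (f (r n)) z - h z)"
  let ?q = "\<lambda>N F. bergman_norm p \<alpha> (\<lambda>z. K F z - of_nat N * h z)"
  have Ksp: "K F \<in> bergman_space p \<alpha>" if "F \<in> bergman_space p \<alpha>" for F
    using lin that by (simp add: bergman_linear_def)
  have K0: "K (\<lambda>z. 0) = (\<lambda>z. 0)"
  proof -
    have "K (\<lambda>z. 0 * f 0 z) = (\<lambda>z. 0 * K (f 0) z)"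
      using lin f unfolding bergman_linear_def by blast
    then show ?thesis by simp
  qed
  \<comment> \<open>The hump is built one term at a time: each new index is so late that the p-th
    power of the norm grows by at most 3 and that K f_n is within \<open>e\<close> of h.\<close>
  have sums: "\<exists>F\<in>bergman_space p \<alpha>. bergman_norm p \<alpha> F powr p \<le> 3 * real N \<and>
      ?q N F \<le> e * real N" if "e > 0" for e :: real and N
  proof (induction N)
    case 0
    show ?case using p K0 by (intro bexI[of _ "\<lambda>z. 0"]) auto
  next
    case (Suc N)
    then obtain F where F: "F \<in> bergman_space p \<alpha>" "bergman_norm p \<alpha> F powr p \<le> 3 * real N"
        "?q N F \<le> e * real N" by blast
    have "\<forall>\<^sub>F n in sequentially. bergman_norm p \<alpha> (\<lambda>z. F z + f (r n) z) powr p \<le> bergman_norm p \<alpha> F powr p + 3"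
      using f lim rh(1)
      by (intro bergman_norm_powr_add_null_sequence p F)
        (auto intro: LIMSEQ_subseq_LIMSEQ[unfolded o_def])
    moreover have "\<forall>\<^sub>F n in sequentially. ?d n < e"
      using rh(3) that by (rule order_tendstoD)
    ultimately have "\<forall>\<^sub>F n in sequentially. bergman_norm p \<alpha> (\<lambda>z. F z + f (r n) z) powr p \<le> bergman_norm p \<alpha> F powr p + 3
        \<and> ?d n < e"
      by (rule eventually_conj)
    from eventually_happens'[OF sequentially_bot this]
    obtain n where n: "bergman_norm p \<alpha> (\<lambda>z. F z + f (r n) z) powr p \<le> bergman_norm p \<alpha> F powr p + 3"
        "?d n < e" by blast
    have "K (\<lambda>z. F z + f (r n) z) = (\<lambda>z. K F z + K (f (r n)) z)"
      using lin F f by (simp add: bergman_linear_def)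
    then have "(\<lambda>z. K (\<lambda>z. F z + f (r n) z) z - of_nat (Suc N) * h z)
        = (\<lambda>z. (K F z - of_nat N * h z) + (K (f (r n)) z - h z))"
      by (simp add: algebra_simps)
    moreover have "bergman_norm p \<alpha> (\<lambda>z. (K F z - of_nat N * h z) + (K (f (r n)) z - h z))
        \<le> ?q N F + ?d n"
      by (intro bergman_add bergman_diff bergman_scale Ksp F(1) f(1) rh(2) p)
    ultimately have "bergman_norm p \<alpha> (\<lambda>z. K (\<lambda>z. F z + f (r n) z) z - of_nat (Suc N) * h z) \<le> e * real (Suc N)"
      using n F by (simp add: algebra_simps)
    moreover have "(\<lambda>z. F z + f (r n) z) \<in> bergman_space p \<alpha>" using F f p by (intro bergman_add)
    ultimately show ?case using n F by (intro bexI[of _ "\<lambda>z. F z + f (r n) z"]) auto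
  qed
  have bound: "bergman_norm p \<alpha> h \<le> e + C * 3 powr (1 / p) * real N powr (1 / p - 1)" if e: "e > 0" and "N > 0" for e :: real and N :: nat
  proof -
    obtain F where F: "F \<in> bergman_space p \<alpha>" "bergman_norm p \<alpha> F powr p \<le> 3 * real N"
        "?q N F \<le> e * real N"
      using sums[OF e] by blast
    have "(bergman_norm p \<alpha> F powr p) powr (1 / p) \<le> (3 * real N) powr (1 / p)"
      using F p by (intro powr_mono2) auto
    then have "bergman_norm p \<alpha> F \<le> 3 powr (1 / p) * real N powr (1 / p)"
      using p by (simp add: powr_powr powr_mult)
    then have KF: "bergman_norm p \<alpha> (K F) \<le> C * (3 powr (1 / p) * real N powr (1 / p))"
      using C(2)[OF F(1)] mult_left_mono[OF _ C(1)] order_trans by blast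
    have "real N * bergman_norm p \<alpha> h = bergman_norm p \<alpha> (\<lambda>z. of_nat N * h z)"
      using bergman_scale(2)[OF rh(2) p, of "of_nat N"] by simp
    also have "\<dots> = bergman_norm p \<alpha> (\<lambda>z. K F z - (K F z - of_nat N * h z))" by simp
    also have "\<dots> \<le> bergman_norm p \<alpha> (K F) + ?q N F"
      by (intro bergman_diff bergman_scale Ksp F(1) rh(2) p)
    finally have "real N * bergman_norm p \<alpha> h \<le> C * (3 powr (1 / p) * real N powr (1 / p)) + e * real N"
      using KF F(3) by linarith
    then show ?thesis using \<open>N > 0\<close> by (simp add: powr_diff field_simps)
  qed
  have le: "bergman_norm p \<alpha> h \<le> e" if "e > 0" for e
  proof (rule tendsto_lowerbound)
    have "(\<lambda>N. real N powr (1 / p - 1)) \<longlonglongrightarrow> 0"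
      using p by (intro tendsto_neg_powr filterlim_real_sequentially) auto
    then have "(\<lambda>N. e + C * 3 powr (1 / p) * real N powr (1 / p - 1)) \<longlonglongrightarrow> e + C * 3 powr (1 / p) * 0"
      by (intro tendsto_intros)
    then show "(\<lambda>N. e + C * 3 powr (1 / p) * real N powr (1 / p - 1)) \<longlonglongrightarrow> e" by simp
    show "\<forall>\<^sub>F N in sequentially. bergman_norm p \<alpha> h \<le> e + C * 3 powr (1 / p) * real N powr (1 / p - 1)"
      using eventually_gt_at_top[of 0] by eventually_elim (rule bound[OF that])
  qed simp
  have "bergman_norm p \<alpha> h \<le> 0" by (rule field_le_epsilon) (simp add: le)
  \<comment> \<open>Vanishing of the norm is enough: by the triangle inequality, K f_n is at most as
    large as K f_n - h.\<close>
  then have h0: "bergman_norm p \<alpha> h = 0" using bergman_norm_nonneg by (rule antisym)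
  have "(\<lambda>n. bergman_norm p \<alpha> (K (f (r n)))) \<longlonglongrightarrow> 0"
  proof (rule tendsto_sandwich[OF _ _ tendsto_const rh(3)])
    show "\<forall>\<^sub>F n in sequentially. bergman_norm p \<alpha> (K (f (r n))) \<le> ?d n"
    proof (intro always_eventually allI)
      fix n
      have "bergman_norm p \<alpha> (\<lambda>z. (K (f (r n)) z - h z) + h z) \<le> ?d n + bergman_norm p \<alpha> h"
        by (intro bergman_add bergman_diff Ksp f(1) rh(2) p)
      then show "bergman_norm p \<alpha> (K (f (r n))) \<le> ?d n"
        using h0 by simp
    qed
  qed simp
  then show ?thesis using that rh(1) by blast
qed

section \<open>The essential norm\<close>

text \<open>The supremum is taken in the reals, so an a priori bound is required for it to dominate
  its members.\<close>

lemma bergman_opnorm_ge: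
  assumes "\<And>f. f \<in> bergman_space p \<alpha> \<Longrightarrow> bergman_norm p \<alpha> (T f) \<le> C * bergman_norm p \<alpha> f" "C \<ge> 0"
    and "f \<in> bergman_space p \<alpha>" "bergman_norm p \<alpha> f \<le> 1"
  shows "bergman_norm p \<alpha> (T f) \<le> bergman_opnorm p \<alpha> T"
  unfolding bergman_opnorm_def
proof (rule cSUP_upper)
  have "bergman_norm p \<alpha> (T f) \<le> C" if "f \<in> bergman_space p \<alpha>" "bergman_norm p \<alpha> f \<le> 1" for f
    using assms(1)[OF that(1)] mult_left_mono[OF that(2) assms(2)] by simp
  then show "bdd_above ((\<lambda>f. bergman_norm p \<alpha> (T f)) ` {f \<in> bergman_space p \<alpha>. bergman_norm p \<alpha> f \<le> 1})"
    by (intro bdd_aboveI[of _ C]) auto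
qed (use assms in auto)

lemma bergman_opnorm_le:
  assumes "\<And>f. f \<in> bergman_space p \<alpha> \<Longrightarrow> bergman_norm p \<alpha> f \<le> 1 \<Longrightarrow> bergman_norm p \<alpha> (T f) \<le> c"
  shows "bergman_opnorm p \<alpha> T \<le> c"
  unfolding bergman_opnorm_def
proof (rule cSUP_least)
  have "(\<lambda>z. 0) \<in> {f \<in> bergman_space p \<alpha>. bergman_norm p \<alpha> f \<le> 1}" by simp
  then show "{f \<in> bergman_space p \<alpha>. bergman_norm p \<alpha> f \<le> 1} \<noteq> {}" by blast
qed (use assms in auto)

text \<open>The factor 1 - z^m is (1 - z) times the sum of the z^i with i < m, and its zero at 1
  cancels the possible growth of \<open>G\<close> there.\<close>

lemma remainder_symbol_bounded:
  assumes "bounded ((\<lambda>z. (1 - z) * G z) ` unit_disk)"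
  obtains B where "B > 0" "\<And>z. z \<in> unit_disk \<Longrightarrow> cmod ((1 - z ^ m) * G z) \<le> B"
proof -
  obtain B where B: "B > 0" "\<And>z. z \<in> unit_disk \<Longrightarrow> cmod ((1 - z) * G z) \<le> B"
    using assms unfolding bounded_pos by auto
  \<comment> \<open>The sum is at most m; m + 1 keeps the bound positive for m = 0.\<close>
  have "cmod ((1 - z ^ m) * G z) \<le> (real m + 1) * B" if z: "z \<in> unit_disk" for z
  proof -
    have "cmod (\<Sum>i<m. z ^ i) \<le> (\<Sum>i<m. 1)"
      using z by (intro sum_norm_le) (auto simp: norm_power power_le_one)
    then have "cmod (\<Sum>i<m. z ^ i) * cmod ((1 - z) * G z) \<le> (real m + 1) * B"
      using B(2)[OF z] by (intro mult_mono) auto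
    moreover have "(1 - z ^ m) * G z = (\<Sum>i<m. z ^ i) * ((1 - z) * G z)"
      by (simp add: one_diff_power_eq)
    ultimately show ?thesis by (simp only: norm_mult)
  qed
  then show ?thesis using B(1) by (intro that[of "(real m + 1) * B"]) auto
qed

lemma volterra_op_split_monomial:
  assumes "f holomorphic_on unit_disk" "G holomorphic_on unit_disk"
  shows "volterra_op G f = (\<lambda>z. volterra_op (\<lambda>z. z ^ m * G z) f z + volterra_op (\<lambda>z. (1 - z ^ m) * G z) f z)"
proof -
  have "volterra_op (\<lambda>z. z ^ m * G z + (1 - z ^ m) * G z) f
      = (\<lambda>z. volterra_op (\<lambda>z. z ^ m * G z) f z + volterra_op (\<lambda>z. (1 - z ^ m) * G z) f z)"
    using assms by (intro volterra_op_add_symbol) (auto intro!: holomorphic_intros)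
  moreover have "(\<lambda>z. z ^ m * G z + (1 - z ^ m) * G z) = G" by (simp add: algebra_simps)
  ultimately show ?thesis by simp
qed

context
  fixes p \<alpha> L :: real and G :: "complex \<Rightarrow> complex"
  assumes p: "p > 1" and \<alpha>: "\<alpha> \<ge> 0" and G: "G holomorphic_on unit_disk"
    and bnd: "bounded ((\<lambda>z. (1 - z) * G z) ` unit_disk)"
    and lim: "((\<lambda>z. cmod ((1 - z) * G z)) \<longlongrightarrow> L) (at 1 within unit_disk)" and L: "L \<ge> 0"
begin

lemma remainder_holomorphic: "(\<lambda>z. (1 - z ^ m) * G z) holomorphic_on unit_disk"
  using G by (intro holomorphic_intros)

lemma volterra_op_bounded:
  obtains C where "C \<ge> 0" "\<And>f. f \<in> bergman_space p \<alpha> \<Longrightarrow> volterra_op G f \<in> bergman_space p \<alpha>"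
    "\<And>f. f \<in> bergman_space p \<alpha> \<Longrightarrow> bergman_norm p \<alpha> (volterra_op G f) \<le> C * bergman_norm p \<alpha> f"
proof -
  obtain m where m: "\<And>f. f \<in> bergman_space p \<alpha> \<Longrightarrow> volterra_op (\<lambda>z. z ^ m * G z) f \<in> bergman_space p \<alpha>"
    "\<And>f. f \<in> bergman_space p \<alpha> \<Longrightarrow>
       bergman_norm p \<alpha> (volterra_op (\<lambda>z. z ^ m * G z) f) \<le> (L * p / (2 + \<alpha>) + 1) * bergman_norm p \<alpha> f"
    using volterra_monomial_norm_le[OF p \<alpha> G bnd lim L zero_less_one] by blast
  let ?P = "volterra_op (\<lambda>z. z ^ m * G z)" and ?R = "volterra_op (\<lambda>z. (1 - z ^ m) * G z)"
  obtain B where B: "B > 0" "\<And>z. z \<in> unit_disk \<Longrightarrow> cmod ((1 - z ^ m) * G z) \<le> B"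
    using remainder_symbol_bounded[OF bnd] by blast
  obtain C where C: "C \<ge> 0" "\<And>f. f \<in> bergman_space p \<alpha> \<Longrightarrow>
      bergman_norm p \<alpha> (?R f) \<le> C * bergman_norm p \<alpha> f"
    using volterra_bounded_symbol_bounded[OF p \<alpha> remainder_holomorphic B(2,1)] by blast
  have sp: "?R f \<in> bergman_space p \<alpha>" if "f \<in> bergman_space p \<alpha>" for f
    using volterra_bounded_symbol_maps[OF p \<alpha> remainder_holomorphic B(2,1) that] by blast
  show ?thesis
  proof (rule that[of "(L * p / (2 + \<alpha>) + 1) + C"])
    show "0 \<le> (L * p / (2 + \<alpha>) + 1) + C" using p \<alpha> L C by simp
    fix f assume f: "f \<in> bergman_space p \<alpha>"
    have eq: "volterra_op G f = (\<lambda>z. ?P f z + ?R f z)"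
      using f G by (intro volterra_op_split_monomial) (auto simp: bergman_space_iff)
    show "volterra_op G f \<in> bergman_space p \<alpha>"
      unfolding eq by (intro bergman_add m sp f p)
    have "bergman_norm p \<alpha> (volterra_op G f)
        \<le> bergman_norm p \<alpha> (?P f) + bergman_norm p \<alpha> (?R f)"
      unfolding eq by (intro bergman_add m sp f p)
    then show "bergman_norm p \<alpha> (volterra_op G f) \<le> ((L * p / (2 + \<alpha>) + 1) + C) * bergman_norm p \<alpha> f"
      using m(2)[OF f] C(2)[OF f] by (simp add: distrib_right)
  qed
qed

text \<open>With limit 0 at 1 the monomial part has arbitrarily small norm, and the remainder has a
  bounded symbol and sends such sequences to 0. Applied to the difference between a symbol and its
  model c/(1 - z).\<close>

lemma volterra_op_tendsto_0:
  assumes "L = 0" and f: "\<And>n. f n \<in> bergman_space p \<alpha>" "\<And>n. bergman_norm p \<alpha> (f n) \<le> 1"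
    and unif: "\<And>r. r < 1 \<Longrightarrow> uniform_limit (cball 0 r) f (\<lambda>_. 0) sequentially"
  shows "(\<lambda>n. bergman_norm p \<alpha> (volterra_op G (f n))) \<longlonglongrightarrow> 0"
proof (rule tendstoI)
  fix e :: real assume "e > 0"
  then have e2: "e / 2 > 0" by simp
  obtain m where m: "\<And>f. f \<in> bergman_space p \<alpha> \<Longrightarrow> volterra_op (\<lambda>z. z ^ m * G z) f \<in> bergman_space p \<alpha>"
    "\<And>f. f \<in> bergman_space p \<alpha> \<Longrightarrow>
       bergman_norm p \<alpha> (volterra_op (\<lambda>z. z ^ m * G z) f) \<le> (L * p / (2 + \<alpha>) + e / 2) * bergman_norm p \<alpha> f"
    using volterra_monomial_norm_le[OF p \<alpha> G bnd lim L e2] by blast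
  let ?P = "volterra_op (\<lambda>z. z ^ m * G z)" and ?R = "volterra_op (\<lambda>z. (1 - z ^ m) * G z)"
  obtain B where B: "B > 0" "\<And>z. z \<in> unit_disk \<Longrightarrow> cmod ((1 - z ^ m) * G z) \<le> B"
    using remainder_symbol_bounded[OF bnd] by blast
  have sp: "?R f \<in> bergman_space p \<alpha>" if "f \<in> bergman_space p \<alpha>" for f
    using volterra_bounded_symbol_maps[OF p \<alpha> remainder_holomorphic B(2,1) that] by blast
  have "(\<lambda>n. bergman_norm p \<alpha> (?R (f n))) \<longlonglongrightarrow> 0"
    using volterra_bounded_symbol_tendsto_0[OF p \<alpha> remainder_holomorphic B(2,1) f unif] by blast
  then have "\<forall>\<^sub>F n in sequentially. bergman_norm p \<alpha> (?R (f n)) < e / 2"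
    using \<open>e > 0\<close> by (intro order_tendstoD(2)) auto
  then show "\<forall>\<^sub>F n in sequentially. dist (bergman_norm p \<alpha> (volterra_op G (f n))) 0 < e"
  proof eventually_elim
    case (elim n)
    have eq: "volterra_op G (f n) = (\<lambda>z. ?P (f n) z + ?R (f n) z)"
      using f(1)[of n] G by (intro volterra_op_split_monomial) (auto simp: bergman_space_iff)
    have "bergman_norm p \<alpha> (volterra_op G (f n))
        \<le> bergman_norm p \<alpha> (?P (f n)) + bergman_norm p \<alpha> (?R (f n))"
      unfolding eq by (intro bergman_add m sp f(1) p)
    moreover have "bergman_norm p \<alpha> (?P (f n)) \<le> e / 2 * bergman_norm p \<alpha> (f n)"
      using m(2)[OF f(1)[of n]] \<open>L = 0\<close> by simp
    moreover have "e / 2 * bergman_norm p \<alpha> (f n) \<le> e / 2 * 1"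
      using \<open>e > 0\<close> by (intro mult_left_mono f) auto
    ultimately show ?case using elim by simp
  qed
qed

lemma essential_norm_volterra_le: "essential_norm p \<alpha> (volterra_op G) \<le> L * p / (2 + \<alpha>)"
proof (rule field_le_epsilon)
  fix e :: real assume "e > 0"
  obtain m where "\<And>f. f \<in> bergman_space p \<alpha> \<Longrightarrow> volterra_op (\<lambda>z. z ^ m * G z) f \<in> bergman_space p \<alpha>"
    and m: "\<And>f. f \<in> bergman_space p \<alpha> \<Longrightarrow>
       bergman_norm p \<alpha> (volterra_op (\<lambda>z. z ^ m * G z) f) \<le> (L * p / (2 + \<alpha>) + e) * bergman_norm p \<alpha> f"
    using volterra_monomial_norm_le[OF p \<alpha> G bnd lim L \<open>e > 0\<close>] by blast
  let ?P = "volterra_op (\<lambda>z. z ^ m * G z)" and ?R = "volterra_op (\<lambda>z. (1 - z ^ m) * G z)"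
  obtain B where B: "B > 0" "\<And>z. z \<in> unit_disk \<Longrightarrow> cmod ((1 - z ^ m) * G z) \<le> B"
    using remainder_symbol_bounded[OF bnd] by blast
  define K where "K = ?R"
  have K: "bergman_compact p \<alpha> K"
    unfolding K_def using volterra_bounded_symbol_compact[OF p \<alpha> remainder_holomorphic B(2,1)] by blast
  obtain C where C: "C \<ge> 0" "\<And>f. f \<in> bergman_space p \<alpha> \<Longrightarrow> volterra_op G f \<in> bergman_space p \<alpha>"
    "\<And>f. f \<in> bergman_space p \<alpha> \<Longrightarrow> bergman_norm p \<alpha> (volterra_op G f) \<le> C * bergman_norm p \<alpha> f"
    using volterra_op_bounded by blast
  \<comment> \<open>The infimum is taken in the reals, so the operator norms of all differences must
    be bounded below. This in turn needs each supremum to be bounded above, hence the bounds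
    \<open>C\<close> and \<open>D\<close>.\<close>
  have nonneg: "0 \<le> bergman_opnorm p \<alpha> (\<lambda>f z. volterra_op G f z - T f z)" if T: "bergman_compact p \<alpha> T" for T
  proof -
    obtain D where D: "D \<ge> 0" "\<And>f. f \<in> bergman_space p \<alpha> \<Longrightarrow> bergman_norm p \<alpha> (T f) \<le> D * bergman_norm p \<alpha> f"
      using bergman_compact_imp_bounded[OF p T] by blast
    have "bergman_norm p \<alpha> (\<lambda>z. volterra_op G f z - T f z) \<le> (C + D) * bergman_norm p \<alpha> f"
      if f: "f \<in> bergman_space p \<alpha>" for f
    proof -
      have "T f \<in> bergman_space p \<alpha>" using T f by (simp add: bergman_compact_def bergman_linear_def)
      then have "bergman_norm p \<alpha> (\<lambda>z. volterra_op G f z - T f z) \<le> bergman_norm p \<alpha> (volterra_op G f) + bergman_norm p \<alpha> (T f)"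
        by (intro bergman_diff C(2) f p)
      then show ?thesis using C(3)[OF f] D(2)[OF f] by (simp add: distrib_right)
    qed
    from bergman_opnorm_ge[where T = "\<lambda>f z. volterra_op G f z - T f z" and f = "\<lambda>z. 0", OF this]
    have "bergman_norm p \<alpha> (\<lambda>z. volterra_op G (\<lambda>z. 0) z - T (\<lambda>z. 0) z)
        \<le> bergman_opnorm p \<alpha> (\<lambda>f z. volterra_op G f z - T f z)"
      using C(1) D(1) by simp
    then show ?thesis by (rule order_trans[OF bergman_norm_nonneg])
  qed
  have "essential_norm p \<alpha> (volterra_op G) \<le> bergman_opnorm p \<alpha> (\<lambda>f z. volterra_op G f z - K f z)"
    unfolding essential_norm_def
  proof (rule cINF_lower)
    show "bdd_below ((\<lambda>K. bergman_opnorm p \<alpha> (\<lambda>f z. volterra_op G f z - K f z)) ` {K. bergman_compact p \<alpha> K})"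
      by (rule bdd_belowI[of _ 0]) (use nonneg in blast)
  qed (use K in simp)
  also have "\<dots> \<le> L * p / (2 + \<alpha>) + e"
  proof (rule bergman_opnorm_le)
    fix f assume f: "f \<in> bergman_space p \<alpha>" "bergman_norm p \<alpha> f \<le> 1"
    have "volterra_op G f = (\<lambda>z. ?P f z + K f z)"
      unfolding K_def using f G by (intro volterra_op_split_monomial) (auto simp: bergman_space_iff)
    then have "volterra_op G f z - K f z = ?P f z" for z
      by (metis add_diff_cancel_right')
    then have "bergman_norm p \<alpha> (\<lambda>z. volterra_op G f z - K f z) \<le> (L * p / (2 + \<alpha>) + e) * bergman_norm p \<alpha> f"
      using m[OF f(1)] by (simp only:)
    also have "(L * p / (2 + \<alpha>) + e) * bergman_norm p \<alpha> f \<le> (L * p / (2 + \<alpha>) + e) * 1"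
      using f p \<alpha> L \<open>e > 0\<close> by (intro mult_left_mono) auto
    finally show "bergman_norm p \<alpha> (\<lambda>z. volterra_op G f z - K f z) \<le> L * p / (2 + \<alpha>) + e"
      by simp
  qed
  finally show "essential_norm p \<alpha> (volterra_op G) \<le> L * p / (2 + \<alpha>) + e" .
qed

end

lemma normalized_peak_sequence:
  assumes p: "p > 1" and \<alpha>: "\<alpha> \<ge> 0"
  obtains f :: "nat \<Rightarrow> complex \<Rightarrow> complex"
  where "\<And>n. f n \<in> bergman_space p \<alpha>" "\<And>n. bergman_norm p \<alpha> (f n) \<le> 1"
    "\<And>r. r < 1 \<Longrightarrow> uniform_limit (cball 0 r) f (\<lambda>_. 0) sequentially"
    "(\<lambda>n. bergman_norm p \<alpha> (volterra_op (\<lambda>z. 1 / (1 - z)) (f n))) \<longlonglongrightarrow> p / (2 + \<alpha>)"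
proof -
  define \<gamma> where "\<gamma> = (2 + \<alpha>) / p"
  \<comment> \<open>Gives \<beta> p = 2 + \<alpha> - 1/(n + 1): below the critical value, tending to
    it, and above \<alpha> from n = 0 on.\<close>
  define \<beta> where "\<beta> = (\<lambda>n. \<gamma> - 1 / p / real (Suc n))"
  have "\<gamma> * p = 2 + \<alpha>" using p by (simp add: \<gamma>_def)
  then have \<beta>p: "\<beta> n * p = 2 + \<alpha> - 1 / real (Suc n)" for n
    using p by (simp add: \<beta>_def left_diff_distrib)
  have \<beta>1: "\<alpha> < \<beta> n * p" "\<beta> n * p < 2 + \<alpha>" for n
    unfolding \<beta>p by (auto simp: field_simps)
  then have \<beta>pos: "\<beta> n > 0" for n using p \<alpha> by (meson le_less_trans zero_less_mult_pos2 less_trans zero_less_one)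
  have \<beta>lt: "\<beta> n < \<gamma>" for n using p by (simp add: \<beta>_def)
  have \<beta>lim: "\<beta> \<longlonglongrightarrow> \<gamma>"
    unfolding \<beta>_def by (rule tendsto_eq_intros tendsto_divide_0[OF tendsto_const] filterlim_compose[OF filterlim_real_at_infinity_sequentially filterlim_Suc] | simp)+
  have sp: "peak (\<beta> n) \<in> bergman_space p \<alpha>" for n
    using p \<alpha> \<beta>1 by (rule peak_in_bergman_space)
  define N where "N = (\<lambda>n. bergman_norm p \<alpha> (peak (\<beta> n)))"
  have Ntop: "filterlim N at_top sequentially"
    unfolding N_def using p \<alpha> \<beta>lim sp by (intro bergman_norm_peak_at_top) (simp_all add: \<gamma>_def)
  have N0: "N n \<ge> 0" for n by (simp add: N_def)
  \<comment> \<open>If a norm were 0, the inverse is 0 by default and the bound by 1 still holds;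
    from some index on the norms are positive and the functions have norm 1.\<close>
  define c where "c = (\<lambda>n. inverse (N n))"
  have c0: "c n \<ge> 0" for n using N0 by (simp add: c_def)
  have clim: "c \<longlonglongrightarrow> 0"
    unfolding c_def by (rule tendsto_inverse_0_at_top[OF Ntop])
  define f where "f = (\<lambda>n z. of_real (c n) * peak (\<beta> n) z)"
  have f: "f n \<in> bergman_space p \<alpha>" "bergman_norm p \<alpha> (f n) = c n * N n" for n
    unfolding f_def N_def using bergman_scale[OF sp[of n] p, of "of_real (c n)"] c0[of n] by auto
  have f1: "bergman_norm p \<alpha> (f n) \<le> 1" for n
    unfolding f(2) c_def by (cases "N n = 0") auto
  have unif: "uniform_limit (cball 0 r) f (\<lambda>_. 0) sequentially" if "r < 1" for r
  proof -
    have bound: "norm (f n z) \<le> c n * (1 - r) powr (- \<gamma>)" if "z \<in> cball 0 r" for n z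
    proof -
      have "cmod z \<le> r" using that by simp
      then have "0 \<le> r" by (rule order_trans[OF norm_ge_zero])
      have z: "z \<in> unit_disk" using that \<open>r < 1\<close> by auto
      have "1 - r \<le> cmod (1 - z)" using that norm_triangle_ineq2[of 1 z] by simp
      then have "cmod (1 - z) powr (- \<beta> n) \<le> (1 - r) powr (- \<beta> n)"
        using \<open>r < 1\<close> \<beta>pos[of n] by (intro powr_mono2') auto
      also have "\<dots> \<le> (1 - r) powr (- \<gamma>)"
        using \<open>r < 1\<close> \<open>0 \<le> r\<close> \<beta>lt[of n] by (intro powr_mono') auto
      finally show ?thesis
        using c0[of n] z by (simp add: f_def norm_mult cmod_peak mult_left_mono)
    qed
    have "(\<lambda>n. c n * (1 - r) powr (- \<gamma>)) \<longlonglongrightarrow> 0"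
      using tendsto_mult_right[OF clim, of "(1 - r) powr (- \<gamma>)"] by simp
    then show ?thesis
      unfolding uniform_limit_iff
    proof (intro allI impI)
      fix e :: real assume "e > 0" and "(\<lambda>n. c n * (1 - r) powr (- \<gamma>)) \<longlonglongrightarrow> 0"
      then have "\<forall>\<^sub>F n in sequentially. c n * (1 - r) powr (- \<gamma>) < e" by (intro order_tendstoD(2))
      then show "\<forall>\<^sub>F n in sequentially. \<forall>z\<in>cball 0 r. dist (f n z) 0 < e"
        by eventually_elim (use bound in \<open>fastforce intro: le_less_trans\<close>)
    qed
  qed
  \<comment> \<open>The constant produced by the base point 0 of the Volterra integral. After
    normalisation it is multiplied by \<open>c n\<close> and disappears in the limit.\<close>
  define one where "one = (\<lambda>z :: complex. if z \<in> unit_disk then 1 else 0 :: complex)"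
  have one: "one \<in> bergman_space p \<alpha>"
  proof -
    have "one holomorphic_on unit_disk"
      by (rule holomorphic_transform[OF holomorphic_on_const[of 1]]) (simp add: one_def)
    moreover have "bergman_mass p \<alpha> one = (\<integral>\<^sup>+z. ennreal 1 \<partial>disk_measure \<alpha>)"
      unfolding bergman_mass_def by (intro nn_integral_cong) (simp add: one_def)
    then have "bergman_mass p \<alpha> one < \<infinity>"
      using emeasure_disk_measure_finite[OF \<alpha>] by simp
    ultimately show ?thesis by (simp add: bergman_space_iff one_def)
  qed
  let ?d = "\<lambda>n. bergman_norm p \<alpha> (\<lambda>z. f n z - of_real (c n) * one z)"
  define h where "h = (\<lambda>n. bergman_norm p \<alpha> (volterra_op (\<lambda>z. 1 / (1 - z)) (f n)))"
  have h_eq: "h n = 1 / \<beta> n * ?d n" for n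
  proof -
    have "volterra_op (\<lambda>z. 1 / (1 - z)) (f n)
        = (\<lambda>z. of_real (c n) * volterra_op (\<lambda>z. 1 / (1 - z)) (peak (\<beta> n)) z)"
      unfolding f_def by (intro volterra_op_scale peak_holomorphic) (auto intro!: holomorphic_intros)
    also have "\<dots> = (\<lambda>z. of_real (1 / \<beta> n) * (f n z - of_real (c n) * one z))"
      unfolding volterra_op_peak[OF \<beta>pos] by (simp add: f_def one_def fun_eq_iff algebra_simps)
    finally have "h n = bergman_norm p \<alpha> (\<lambda>z. of_real (1 / \<beta> n) * (f n z - of_real (c n) * one z))"
      by (simp only: h_def)
    also have "\<dots> = cmod (of_real (1 / \<beta> n)) * ?d n"
      by (intro bergman_scale bergman_diff f one p)
    finally show ?thesis using \<beta>pos[of n] by (simp only: norm_of_real) simp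
  qed
  have cone: "bergman_norm p \<alpha> (\<lambda>z. of_real (c n) * one z) = c n * bergman_norm p \<alpha> one" for n
    using bergman_scale(2)[OF one p, of "of_real (c n)"] c0[of n] by simp
  have up: "?d n \<le> c n * N n + c n * bergman_norm p \<alpha> one" for n
    using bergman_diff(2)[OF f(1)[of n] bergman_scale(1)[OF one p, of "of_real (c n)"] p] unfolding cone f(2) .
  have low: "c n * N n - c n * bergman_norm p \<alpha> one \<le> ?d n" for n
  proof -
    have "bergman_norm p \<alpha> (\<lambda>z. (f n z - of_real (c n) * one z) + of_real (c n) * one z)
      \<le> ?d n + bergman_norm p \<alpha> (\<lambda>z. of_real (c n) * one z)"
      by (intro bergman_add bergman_diff bergman_scale f one p)
    then show ?thesis using f(2)[of n] cone[of n] by simp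
  qed
  have cN: "(\<lambda>n. c n * N n) \<longlonglongrightarrow> 1"
  proof (rule tendsto_eventually)
    have "\<forall>\<^sub>F n in sequentially. N n > 0" using Ntop by (simp add: filterlim_at_top_dense)
    then show "\<forall>\<^sub>F n in sequentially. c n * N n = 1" by eventually_elim (simp add: c_def)
  qed
  have c1: "(\<lambda>n. c n * bergman_norm p \<alpha> one) \<longlonglongrightarrow> 0"
    using tendsto_mult_right[OF clim, of "bergman_norm p \<alpha> one"] by simp
  have "(\<lambda>n. ?d n) \<longlonglongrightarrow> 1"
  proof (rule tendsto_sandwich)
    show "(\<lambda>n. c n * N n - c n * bergman_norm p \<alpha> one) \<longlonglongrightarrow> 1"
      using tendsto_diff[OF cN c1] by simp
    show "(\<lambda>n. c n * N n + c n * bergman_norm p \<alpha> one) \<longlonglongrightarrow> 1"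
      using tendsto_add[OF cN c1] by simp
  qed (intro always_eventually allI low up)+
  moreover have "\<gamma> > 0" using p \<alpha> by (simp add: \<gamma>_def)
  ultimately have "(\<lambda>n. 1 / \<beta> n * ?d n) \<longlonglongrightarrow> 1 / \<gamma> * 1"
    by (intro tendsto_mult tendsto_divide tendsto_const \<beta>lim) auto
  moreover have "h = (\<lambda>n. 1 / \<beta> n * ?d n)"
    by (rule ext) (rule h_eq)
  ultimately have "h \<longlonglongrightarrow> p / (2 + \<alpha>)"
    by (simp only: \<gamma>_def) simp
  then show ?thesis using that[OF f(1) f1 unif] by (simp add: h_def)
qed

lemma tendsto_at_1_within_disk_cong:
  assumes "\<And>z. z \<in> unit_disk \<Longrightarrow> u z = v z"
  shows "(u \<longlongrightarrow> l) (at 1 within unit_disk) \<longleftrightarrow> (v \<longlongrightarrow> l) (at 1 within unit_disk)"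
  using assms by (intro tendsto_cong) (simp add: eventually_at_filter)

text \<open>On normalised peaks the part c/(1 - z) of the symbol produces norms tending to |c| p/(2
  + \<alpha>). The rest of the symbol contributes nothing in the limit, and a compact operator
  contributes nothing along a subsequence, so every admissible difference has at least this operator
  norm.\<close>

lemma essential_norm_volterra_ge:
  assumes p: "p > 1" and \<alpha>: "\<alpha> \<ge> 0" and G: "G holomorphic_on unit_disk"
    and bnd: "bounded ((\<lambda>z. (1 - z) * G z) ` unit_disk)"
    and lim: "((\<lambda>z. (1 - z) * G z) \<longlongrightarrow> c) (at 1 within unit_disk)"
  shows "cmod c * p / (2 + \<alpha>) \<le> essential_norm p \<alpha> (volterra_op G)"
proof -
  define G2 where "G2 = (\<lambda>z. G z + (- c) * (1 / (1 - z)))"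
  define J where "J = volterra_op (\<lambda>z. 1 / (1 - z))"
  have holJ: "(\<lambda>z. 1 / (1 - z)) holomorphic_on unit_disk"
    by (auto intro!: holomorphic_intros)
  have G2: "G2 holomorphic_on unit_disk"
    unfolding G2_def using G holJ by (intro holomorphic_on_add holomorphic_on_mult holomorphic_on_const)
  have G2_eq: "(1 - z) * G2 z = (1 - z) * G z - c" if "z \<in> unit_disk" for z
  proof -
    have "(1 - z) * ((- c) * (1 / (1 - z))) = - c"
      using cmod_one_minus_pos[OF that] by simp
    then show ?thesis by (simp only: G2_def distrib_left) simp
  qed
  have bnd2: "bounded ((\<lambda>z. (1 - z) * G2 z) ` unit_disk)"
  proof -
    obtain B where "B > 0" "\<And>z. z \<in> unit_disk \<Longrightarrow> cmod ((1 - z) * G z) \<le> B"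
      using bnd unfolding bounded_pos by auto
    then have "cmod ((1 - z) * G2 z) \<le> B + cmod c" if "z \<in> unit_disk" for z
      unfolding G2_eq[OF that] using that norm_triangle_ineq4[of "(1 - z) * G z" c] by fastforce
    then show ?thesis unfolding bounded_iff by blast
  qed
  have "((\<lambda>z. (1 - z) * G z - c) \<longlongrightarrow> c - c) (at 1 within unit_disk)"
    by (intro tendsto_diff lim tendsto_const)
  then have "((\<lambda>z. (1 - z) * G2 z) \<longlongrightarrow> 0) (at 1 within unit_disk)"
    using tendsto_at_1_within_disk_cong[OF G2_eq] by simp
  then have lim2: "((\<lambda>z. cmod ((1 - z) * G2 z)) \<longlongrightarrow> 0) (at 1 within unit_disk)"
    by (rule tendsto_norm_zero)
  obtain f :: "nat \<Rightarrow> complex \<Rightarrow> complex"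
    where f: "\<And>n. f n \<in> bergman_space p \<alpha>" "\<And>n. bergman_norm p \<alpha> (f n) \<le> 1"
      and unif: "\<And>r. r < 1 \<Longrightarrow> uniform_limit (cball 0 r) f (\<lambda>_. 0) sequentially"
      and J_lim: "(\<lambda>n. bergman_norm p \<alpha> (J (f n))) \<longlonglongrightarrow> p / (2 + \<alpha>)"
    unfolding J_def using normalized_peak_sequence[OF p \<alpha>] by blast
  have pointwise: "(\<lambda>n. f n z) \<longlonglongrightarrow> 0" if "z \<in> unit_disk" for z
    using tendsto_uniform_limitI[OF unif[of "cmod z"], of z] that by simp
  obtain C where C: "C \<ge> 0" "\<And>f. f \<in> bergman_space p \<alpha> \<Longrightarrow> volterra_op G f \<in> bergman_space p \<alpha>"
    "\<And>f. f \<in> bergman_space p \<alpha> \<Longrightarrow> bergman_norm p \<alpha> (volterra_op G f) \<le> C * bergman_norm p \<alpha> f"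
    using volterra_op_bounded[OF p \<alpha> G bnd tendsto_norm[OF lim] norm_ge_zero] by blast
  obtain C2 where "C2 \<ge> 0" and sp2: "\<And>f. f \<in> bergman_space p \<alpha> \<Longrightarrow> volterra_op G2 f \<in> bergman_space p \<alpha>"
    and "\<And>f. f \<in> bergman_space p \<alpha> \<Longrightarrow> bergman_norm p \<alpha> (volterra_op G2 f) \<le> C2 * bergman_norm p \<alpha> f"
    using volterra_op_bounded[OF p \<alpha> G2 bnd2 lim2 order_refl] by blast
  have V2_lim: "(\<lambda>n. bergman_norm p \<alpha> (volterra_op G2 (f n))) \<longlonglongrightarrow> 0"
    using volterra_op_tendsto_0[OF p \<alpha> G2 bnd2 lim2 order_refl refl f unif] by blast
  have split: "(\<lambda>z. c * J (f n) z) = (\<lambda>z. volterra_op G (f n) z - volterra_op G2 (f n) z)" for n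
  proof -
    have hf: "f n holomorphic_on unit_disk" using f(1)[of n] by (simp add: bergman_space_iff)
    have "(\<lambda>z. G2 z + c * (1 / (1 - z))) = G" by (simp add: G2_def)
    moreover have "volterra_op (\<lambda>z. G2 z + c * (1 / (1 - z))) (f n)
        = (\<lambda>z. volterra_op G2 (f n) z + volterra_op (\<lambda>z. c * (1 / (1 - z))) (f n) z)"
      using holJ by (intro volterra_op_add_symbol hf G2 holomorphic_on_mult holomorphic_on_const)
    moreover have "volterra_op (\<lambda>z. c * (1 / (1 - z))) (f n) = (\<lambda>z. c * J (f n) z)"
      unfolding J_def volterra_op_mult_symbol[of "\<lambda>z. c"] by (rule volterra_op_scale[OF hf holJ])
    ultimately show ?thesis by (simp add: fun_eq_iff)
  qed
  have "cmod c * (p / (2 + \<alpha>)) \<le> bergman_opnorm p \<alpha> (\<lambda>f z. volterra_op G f z - K f z)"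
    if K: "bergman_compact p \<alpha> K" for K
  proof -
    let ?T = "\<lambda>f z. volterra_op G f z - K f z"
    define S where "S = bergman_opnorm p \<alpha> ?T"
    have Ksp: "K f \<in> bergman_space p \<alpha>" if "f \<in> bergman_space p \<alpha>" for f
      using K that by (simp add: bergman_compact_def bergman_linear_def)
    obtain D where D: "D \<ge> 0" "\<And>f. f \<in> bergman_space p \<alpha> \<Longrightarrow> bergman_norm p \<alpha> (K f) \<le> D * bergman_norm p \<alpha> f"
      using bergman_compact_imp_bounded[OF p K] by blast
    have diff: "bergman_norm p \<alpha> (\<lambda>z. volterra_op G f z - K f z) \<le> (C + D) * bergman_norm p \<alpha> f"
      if f: "f \<in> bergman_space p \<alpha>" for f
    proof -
      have "bergman_norm p \<alpha> (\<lambda>z. volterra_op G f z - K f z) \<le> bergman_norm p \<alpha> (volterra_op G f) + bergman_norm p \<alpha> (K f)"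
        by (intro bergman_diff C(2) Ksp f p)
      then show ?thesis using C(3)[OF f] D(2)[OF f] by (simp add: distrib_right)
    qed
    obtain r where r: "strict_mono (r :: nat \<Rightarrow> nat)" "(\<lambda>n. bergman_norm p \<alpha> (K (f (r n)))) \<longlonglongrightarrow> 0"
      using bergman_compact_null_subsequence[OF p K f pointwise] by blast
    have le: "cmod c * bergman_norm p \<alpha> (J (f n)) \<le> S + (bergman_norm p \<alpha> (K (f n)) + bergman_norm p \<alpha> (volterra_op G2 (f n)))" for n
    proof -
      have "cmod c * bergman_norm p \<alpha> (J (f n)) = bergman_norm p \<alpha> (\<lambda>z. c * J (f n) z)"
        using p by (simp add: bergman_norm_def norm_mult powr_mult powr_powr)
      \<comment> \<open>The first bracket is controlled by the operator norm of the difference; both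
        terms of the second tend to 0 along the subsequence.\<close>
      also have "(\<lambda>z. c * J (f n) z)
          = (\<lambda>z. (volterra_op G (f n) z - K (f n) z) + (K (f n) z - volterra_op G2 (f n) z))"
        unfolding split by simp
      also have "bergman_norm p \<alpha> \<dots> \<le> bergman_norm p \<alpha> (\<lambda>z. volterra_op G (f n) z - K (f n) z)
          + bergman_norm p \<alpha> (\<lambda>z. K (f n) z - volterra_op G2 (f n) z)"
        by (intro bergman_add bergman_diff C(2) Ksp sp2 f(1) p)
      also have "bergman_norm p \<alpha> (\<lambda>z. volterra_op G (f n) z - K (f n) z) \<le> S"
        unfolding S_def using diff C(1) D(1) f
        by (intro bergman_opnorm_ge[where T = ?T and C = "C + D"]) auto
      also have "bergman_norm p \<alpha> (\<lambda>z. K (f n) z - volterra_op G2 (f n) z)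
          \<le> bergman_norm p \<alpha> (K (f n)) + bergman_norm p \<alpha> (volterra_op G2 (f n))"
        by (intro bergman_diff Ksp sp2 f(1) p)
      finally show ?thesis by simp
    qed
    have "(\<lambda>n. cmod c * bergman_norm p \<alpha> (J (f (r n)))) \<longlonglongrightarrow> cmod c * (p / (2 + \<alpha>))"
      using LIMSEQ_subseq_LIMSEQ[OF J_lim r(1)] by (intro tendsto_mult tendsto_const) (simp add: o_def)
    moreover have "(\<lambda>n. S + (bergman_norm p \<alpha> (K (f (r n))) + bergman_norm p \<alpha> (volterra_op G2 (f (r n))))) \<longlonglongrightarrow> S + (0 + 0)"
      using LIMSEQ_subseq_LIMSEQ[OF V2_lim r(1)] by (intro tendsto_add tendsto_const r(2)) (simp add: o_def)
    ultimately have "cmod c * (p / (2 + \<alpha>)) \<le> S + (0 + 0)"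
      by (rule LIMSEQ_le) (use le in blast)
    then show ?thesis by (simp add: S_def)
  qed
  \<comment> \<open>A real infimum is bounded below by its members only over a nonempty set; the
    zero operator is a compact one.\<close>
  moreover have "bergman_compact p \<alpha> (volterra_op (\<lambda>z. 0))"
    by (rule volterra_bounded_symbol_compact[OF p \<alpha>, where B = 1]) auto
  ultimately have "cmod c * (p / (2 + \<alpha>)) \<le> essential_norm p \<alpha> (volterra_op G)"
    unfolding essential_norm_def by (intro cINF_greatest) auto
  then show ?thesis by simp
qed

theorem mainTheorem6:
  fixes p \<alpha> :: real and g :: "complex \<Rightarrow> complex"
  assumes "p > 1" and "\<alpha> \<ge> 0"
    and "g holomorphic_on unit_disk"
    and "bounded ((\<lambda>z. (1 - z) * deriv g z) ` unit_disk)"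
    and "\<exists>U h. open U \<and> 1 \<in> U \<and> continuous_on (U \<inter> cball 0 1) h \<and>
           (\<forall>z\<in>U \<inter> unit_disk. h z = (1 - z) * deriv g z)"
  shows "bergman_bounded p \<alpha> (volterra g) \<and>
    (\<exists>L. ((\<lambda>z. cmod ((1 - z) * deriv g z)) \<longlongrightarrow> L) (at 1 within unit_disk) \<and>
         essential_norm p \<alpha> (volterra g) =
           L * integral {0..1} (\<lambda>t. t powr ((2 + \<alpha>) / p - 1)))"
proof -
  obtain U h where Uh: "open U" "1 \<in> U" "continuous_on (U \<inter> cball 0 1) h"
    "\<And>z. z \<in> U \<inter> unit_disk \<Longrightarrow> h z = (1 - z) * deriv g z"
    using assms(5) by blast
  have G: "deriv g holomorphic_on unit_disk"
    using assms(3) by (intro holomorphic_deriv) auto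
  \<comment> \<open>The upper bound uses only the limit of the modulus; the lower bound subtracts
    h(1)/(1 - z) and so uses the complex value.\<close>
  have "(h \<longlongrightarrow> h 1) (at 1 within U \<inter> cball 0 1)"
    using Uh(2,3) by (auto simp: continuous_on_def)
  then have "(h \<longlongrightarrow> h 1) (at 1 within U \<inter> unit_disk)"
    by (rule tendsto_within_subset) auto
  then have "((\<lambda>z. (1 - z) * deriv g z) \<longlongrightarrow> h 1) (at 1 within U \<inter> unit_disk)"
    using Uh(4) by (subst (asm) tendsto_cong) (auto simp: eventually_at_filter)
  moreover have "at 1 within U \<inter> unit_disk = at 1 within unit_disk"
    using Uh(1,2) by (intro at_within_nhd[of _ U]) auto
  ultimately have lim: "((\<lambda>z. (1 - z) * deriv g z) \<longlongrightarrow> h 1) (at 1 within unit_disk)" by simp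
  note lim_norm = tendsto_norm[OF lim]
  obtain C where "C \<ge> 0" "\<And>f. f \<in> bergman_space p \<alpha> \<Longrightarrow> volterra g f \<in> bergman_space p \<alpha>"
    "\<And>f. f \<in> bergman_space p \<alpha> \<Longrightarrow> bergman_norm p \<alpha> (volterra g f) \<le> C * bergman_norm p \<alpha> f"
    using volterra_op_bounded[OF assms(1,2) G assms(4) lim_norm norm_ge_zero]
    unfolding volterra_eq_volterra_op by blast
  then have "bergman_bounded p \<alpha> (volterra g)"
    using volterra_op_linear[OF G] unfolding bergman_bounded_def volterra_eq_volterra_op by blast
  moreover have "essential_norm p \<alpha> (volterra g) = cmod (h 1) * p / (2 + \<alpha>)"
    unfolding volterra_eq_volterra_op
    using essential_norm_volterra_le[OF assms(1,2) G assms(4) lim_norm norm_ge_zero]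
      essential_norm_volterra_ge[OF assms(1,2) G assms(4) lim]
    by (rule antisym)
  moreover have "integral {0..1} (\<lambda>t. t powr ((2 + \<alpha>) / p - 1)) = p / (2 + \<alpha>)"
    using has_integral_powr_from_0[of "(2 + \<alpha>) / p - 1" 1] assms(1,2)
    by (intro integral_unique) simp
  ultimately show ?thesis using lim_norm by auto
qed

end
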